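(* The problem Editing to Temporal Cliques (ETC) is NP-complete, even when restricted to inputs whose temporal graph $\mathcal G=(G,\mathcal T)$ has an underlying graph $G$ that is a path.
   Context: A temporal graph $\mathcal G=(G,\mathcal T)$ consists of a finite static undirected graph $G=(V,E)$ and a function $\mathcal T:E\to 2^{\mathbb Z^+}\setminus\{\emptyset\}$ (finite sets) giving the times at which each edge appears; its time-edges are $\mathcal E(\mathcal G)=\{(e,t):e\in E,\ t\in\mathcal T(e)\}$ and its lifetime is $T(\mathcal G)=\max\{t:(e,t)\in\mathcal E(\mathcal G)\}$; the input size is $O(\max\{|\mathcal E(\mathcal G)|,|V|\})$ (edges listed with their appearance times). An interval $[a,b]$ means the integer set $\{a,\dots,b\}$. An edge $e$ is $\Delta_1$-dense in $[a,b]$ if for every $\tau\in[a,\max\{a,b-\Delta_1+1\}]$ there is $t\in\mathcal T(e)$ with $\tau\le t\le \tau+\Delta_1-1$. A template is a pair $(X,[a,b])$ with $X$ a vertex set. Templates $(X,[a,b])$, $(Y,[c,d])$ are $\Delta_2$-independent if $X\cap Y=\emptyset$ or $|s-t|\ge\Delta_2$ for all $s\in[a,b]$, $t\in[c,d]$. $\mathcal G$ realises a collection $\{(X_i,[a_i,b_i])\}_i$ of pairwise $\Delta_2$-independent templates with $1\le a_i\le b_i\le T(\mathcal G)$ if every time-edge $(xy,t)$ has some $i$ with $x,y\in X_i$, $t\in[a_i,b_i]$, and for every $i$ and distinct $x,y\in X_i$, $xy$ is an edge that is $\Delta_1$-dense in $[a_i,b_i]$. $\mathcal G$ is a $(\Delta_1,\Delta_2)$-cluster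 temporal graph if it realises some such collection. ETC: Input: a temporal graph $\mathcal G$ and positive integers $k,\Delta_1,\Delta_2$. Question: is there a set $\Pi$ of at most $k$ time-edge modifications (additions or deletions of time-edges $(e,t)$, $e$ a pair of vertices of $\mathcal G$, $t\in\mathbb Z^+$), such that the modified temporal graph is a $(\Delta_1,\Delta_2)$-cluster temporal graph? *)

theory Defs
  imports "HOL-Computational_Algebra.Polynomial"
begin

section \<open>Polynomial time and NP\<close>

text \<open>
  Deterministic multi-tape Turing machines. Tapes are infinite in both directions; a tape is its
  contents together with the position of its head. The states are the numbers below
  \<open>state_count\<close>, which are the working states, and \<open>state_count\<close> itself, which is the halting
  state; the initial state is 0 (so a machine with \<open>state_count = 0\<close> halts at once). The symbols
  are the numbers below \<open>symbol_count\<close>: 0 is the blank, 1 and 2 are the input and output symbols.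
\<close>

datatype move = Move_Left | Stay | Move_Right

record turing_machine =
  tape_count :: nat
  state_count :: nat
  symbol_count :: nat
  transition :: "nat \<Rightarrow> nat list \<Rightarrow> nat \<times> (nat \<times> move) list"

definition turing_machine :: "turing_machine \<Rightarrow> bool" where
  "turing_machine M \<longleftrightarrow>
     1 \<le> tape_count M \<and> 3 \<le> symbol_count M \<and>
     (\<forall>q < state_count M. \<forall>ss. length ss = tape_count M \<and> set ss \<subseteq> {..<symbol_count M} \<longrightarrow>
        (case transition M q ss of (q', acts) \<Rightarrow>
           q' \<le> state_count M \<and> length acts = tape_count M \<and>
           fst ` set acts \<subseteq> {..<symbol_count M}))"

type_synonym tape = "(int \<Rightarrow> nat) \<times> int"

fun scanned :: "tape \<Rightarrow> nat" where
  "scanned (c, h) = c h"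

fun head_shift :: "move \<Rightarrow> int" where
  "head_shift Move_Left = -1"
| "head_shift Stay = 0"
| "head_shift Move_Right = 1"

fun act :: "tape \<Rightarrow> nat \<times> move \<Rightarrow> tape" where
  "act (c, h) (s, m) = (c(h := s), h + head_shift m)"

fun step :: "turing_machine \<Rightarrow> nat \<times> tape list \<Rightarrow> nat \<times> tape list" where
  "step M (q, tps) =
     (if q < state_count M
      then (case transition M q (map scanned tps) of (q', acts) \<Rightarrow> (q', map2 act tps acts))
      else (q, tps))"

fun symbol :: "bool \<Rightarrow> nat" where
  "symbol False = 1"
| "symbol True = 2"

definition input_tape :: "bool list \<Rightarrow> tape" where
  "input_tape x =
     ((\<lambda>i. if 0 \<le> i \<and> i < int (length x) then symbol (x ! nat i) else 0), 0)"

definition initial :: "turing_machine \<Rightarrow> bool list \<Rightarrow> nat \<times> tape list" where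
  "initial M x = (0, input_tape x # replicate (tape_count M - 1) (\<lambda>_. 0, 0))"

text \<open>The output is the string from the head to the first blank to its right.\<close>

fun outputs :: "tape \<Rightarrow> bool list \<Rightarrow> bool" where
  "outputs (c, h) y \<longleftrightarrow>
     (\<forall>i < length y. c (h + int i) = symbol (y ! i)) \<and> c (h + int (length y)) = 0"

definition computes_within ::
    "turing_machine \<Rightarrow> (bool list \<Rightarrow> bool list) \<Rightarrow> (nat \<Rightarrow> nat) \<Rightarrow> bool" where
  "computes_within M f b \<longleftrightarrow>
     (\<forall>x. \<exists>t \<le> b (length x).
        case (step M ^^ t) (initial M x) of (q, tps) \<Rightarrow>
          q = state_count M \<and> outputs (tps ! 0) (f x))"

definition poly_time :: "(bool list \<Rightarrow> bool list) \<Rightarrow> bool" where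
  "poly_time f \<longleftrightarrow>
     (\<exists>M (p :: nat poly). turing_machine M \<and> computes_within M f (poly p))"

text \<open>
  Self-delimiting binary codes: no code of an object is a proper prefix of the code of another
  object of the same kind, so codes of several objects can simply be concatenated.
\<close>

definition encode_list :: "('a \<Rightarrow> bool list) \<Rightarrow> 'a list \<Rightarrow> bool list" where
  "encode_list enc xs = concat (map (\<lambda>x. True # enc x) xs) @ [False]"

fun bits :: "nat \<Rightarrow> bool list" where
  "bits n = (if n = 0 then [] else odd n # bits (n div 2))"

declare bits.simps [simp del]

definition encode_nat :: "nat \<Rightarrow> bool list" where
  "encode_nat n = encode_list (\<lambda>b. [b]) (bits n)"

definition encode_pair :: "bool list \<Rightarrow> bool list \<Rightarrow> bool list" where
  "encode_pair x y = encode_list (\<lambda>b. [b]) x @ y"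

definition in_P :: "bool list set \<Rightarrow> bool" where
  "in_P L \<longleftrightarrow> poly_time (\<lambda>x. [x \<in> L])"

definition in_NP :: "bool list set \<Rightarrow> bool" where
  "in_NP L \<longleftrightarrow>
     (\<exists>R (p :: nat poly). in_P R \<and>
        (\<forall>x. x \<in> L \<longleftrightarrow> (\<exists>y. length y \<le> poly p (length x) \<and> encode_pair x y \<in> R)))"

definition poly_reducible :: "bool list set \<Rightarrow> bool list set \<Rightarrow> bool" where
  "poly_reducible A B \<longleftrightarrow> (\<exists>f. poly_time f \<and> (\<forall>x. x \<in> A \<longleftrightarrow> f x \<in> B))"

definition NP_complete :: "bool list set \<Rightarrow> bool" where
  "NP_complete L \<longleftrightarrow> in_NP L \<and> (\<forall>A. in_NP A \<longrightarrow> poly_reducible A L)"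


section \<open>Temporal graphs\<close>

record 'v temporal_graph =
  verts :: "'v set"
  edges :: "'v set set"
  appearances :: "'v set \<Rightarrow> nat set"

definition vertex_pairs :: "'v set \<Rightarrow> 'v set set" where
  "vertex_pairs V = {e. e \<subseteq> V \<and> card e = 2}"

definition temporal_graph :: "'v temporal_graph \<Rightarrow> bool" where
  "temporal_graph G \<longleftrightarrow>
     finite (verts G) \<and> edges G \<subseteq> vertex_pairs (verts G) \<and>
     (\<forall>e \<in> edges G. finite (appearances G e) \<and> appearances G e \<noteq> {} \<and> 0 \<notin> appearances G e)"

definition time_edges :: "'v temporal_graph \<Rightarrow> ('v set \<times> nat) set" where
  "time_edges G = (SIGMA e : edges G. appearances G e)"

text \<open>
  The lifetime of a graph without time-edges is a junk value. This is harmless: such a graph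
  realises the empty collection of templates, which does not mention the lifetime.
\<close>

definition lifetime :: "'v temporal_graph \<Rightarrow> nat" where
  "lifetime G = Max (snd ` time_edges G)"

definition dense :: "'v temporal_graph \<Rightarrow> nat \<Rightarrow> 'v set \<Rightarrow> nat \<Rightarrow> nat \<Rightarrow> bool" where
  "dense G \<Delta>1 e a b \<longleftrightarrow>
     (\<forall>\<tau> \<in> {int a .. max (int a) (int b - int \<Delta>1 + 1)}.
        \<exists>t \<in> appearances G e. \<tau> \<le> int t \<and> int t \<le> \<tau> + int \<Delta>1 - 1)"

text \<open>The triple \<open>(X, a, b)\<close> stands for the template \<open>(X, [a, b])\<close>.\<close>

type_synonym 'v template = "'v set \<times> nat \<times> nat"

fun independent :: "nat \<Rightarrow> 'v template \<Rightarrow> 'v template \<Rightarrow> bool" where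
  "independent \<Delta>2 (X, a, b) (Y, c, d) \<longleftrightarrow>
     X \<inter> Y = {} \<or> (\<forall>s \<in> {a..b}. \<forall>t \<in> {c..d}. \<bar>int s - int t\<bar> \<ge> int \<Delta>2)"

definition realises :: "'v temporal_graph \<Rightarrow> nat \<Rightarrow> nat \<Rightarrow> 'v template set \<Rightarrow> bool" where
  "realises G \<Delta>1 \<Delta>2 \<C> \<longleftrightarrow>
     (\<forall>(X, a, b) \<in> \<C>. X \<subseteq> verts G \<and> 1 \<le> a \<and> a \<le> b \<and> b \<le> lifetime G) \<and>
     (\<forall>C \<in> \<C>. \<forall>D \<in> \<C>. C \<noteq> D \<longrightarrow> independent \<Delta>2 C D) \<and>
     (\<forall>(e, t) \<in> time_edges G. \<exists>(X, a, b) \<in> \<C>. e \<subseteq> X \<and> t \<in> {a..b}) \<and>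
     (\<forall>(X, a, b) \<in> \<C>. \<forall>x \<in> X. \<forall>y \<in> X. x \<noteq> y \<longrightarrow>
        {x, y} \<in> edges G \<and> dense G \<Delta>1 {x, y} a b)"

definition cluster_temporal_graph :: "nat \<Rightarrow> nat \<Rightarrow> 'v temporal_graph \<Rightarrow> bool" where
  "cluster_temporal_graph \<Delta>1 \<Delta>2 G \<longleftrightarrow> (\<exists>\<C>. realises G \<Delta>1 \<Delta>2 \<C>)"

text \<open>
  A set of modifications is the set of time-edges whose presence is toggled: the time-edges of the
  graph among them are deleted, the others are added. An edge that loses all its time-edges
  disappears from the underlying graph, and an edge that gains its first one appears in it.
\<close>

definition modify :: "'v temporal_graph \<Rightarrow> ('v set \<times> nat) set \<Rightarrow> 'v temporal_graph" where
  "modify G \<Pi> =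
     (let S = (time_edges G - \<Pi>) \<union> (\<Pi> - time_edges G)
      in \<lparr>verts = verts G, edges = fst ` S, appearances = (\<lambda>e. {t. (e, t) \<in> S})\<rparr>)"

definition ETC :: "'v temporal_graph \<Rightarrow> nat \<Rightarrow> nat \<Rightarrow> nat \<Rightarrow> bool" where
  "ETC G k \<Delta>1 \<Delta>2 \<longleftrightarrow>
     (\<exists>\<Pi>. \<Pi> \<subseteq> vertex_pairs (verts G) \<times> {1..} \<and> finite \<Pi> \<and> card \<Pi> \<le> k \<and>
          cluster_temporal_graph \<Delta>1 \<Delta>2 (modify G \<Pi>))"

definition underlying_path :: "'v temporal_graph \<Rightarrow> bool" where
  "underlying_path G \<longleftrightarrow>
     (\<exists>vs. vs \<noteq> [] \<and> distinct vs \<and> verts G = set vs \<and>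
           edges G = {{vs ! i, vs ! Suc i} | i. Suc i < length vs})"


section \<open>Editing to Temporal Cliques as a language\<close>

text \<open>
  The vertices of an input graph are natural numbers. The graph is presented by the list of its
  vertices and the list of its edges, each edge with the list of its appearance times; there are no
  repetitions in any of these lists. All numbers are written in binary.
\<close>

type_synonym edge_entry = "(nat \<times> nat) \<times> nat list"

definition presents :: "nat list \<Rightarrow> edge_entry list \<Rightarrow> nat temporal_graph \<Rightarrow> bool" where
  "presents vs es G \<longleftrightarrow>
     distinct vs \<and> set vs = verts G \<and>
     distinct (map (\<lambda>((u, v), ts). {u, v}) es) \<and>
     set (map (\<lambda>((u, v), ts). {u, v}) es) = edges G \<and>
     (\<forall>((u, v), ts) \<in> set es. distinct ts \<and> set ts = appearances G {u, v})"

definition encode_edge_entry :: "edge_entry \<Rightarrow> bool list" where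
  "encode_edge_entry = (\<lambda>((u, v), ts). encode_nat u @ encode_nat v @ encode_list encode_nat ts)"

definition encode_input ::
    "nat list \<Rightarrow> edge_entry list \<Rightarrow> nat \<Rightarrow> nat \<Rightarrow> nat \<Rightarrow> bool list" where
  "encode_input vs es k \<Delta>1 \<Delta>2 =
     encode_list encode_nat vs @ encode_list encode_edge_entry es @
     encode_nat k @ encode_nat \<Delta>1 @ encode_nat \<Delta>2"

text \<open>The yes-instances of ETC whose temporal graph satisfies the restriction \<open>P\<close>.\<close>

definition ETC_language :: "(nat temporal_graph \<Rightarrow> bool) \<Rightarrow> bool list set" where
  "ETC_language P =
     {encode_input vs es k \<Delta>1 \<Delta>2 | vs es k \<Delta>1 \<Delta>2 G.
        temporal_graph G \<and> presents vs es G \<and> P G \<and> 1 \<le> k \<and> 1 \<le> \<Delta>1 \<and> 1 \<le> \<Delta>2 \<and>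
        ETC G k \<Delta>1 \<Delta>2}"

end

theory Submission
  imports Defs
begin

text \<open>
  Hardness. A run of a nondeterministic machine is a set of clauses, each of them all positive or
  all negative. Put the variables on rows (time) and the clauses on columns (pairs of consecutive
  edges) of a path, the positive clauses first. With \<open>\<Delta>\<^sub>1 = 1\<close> and only odd times, adding
  time-edges never pays, so editing is a maximum choice of time-edges that are \<open>\<Delta>\<^sub>2\<close>-apart on
  equal or adjacent edges, i.e. a packing of rectangles. In a full packing the rectangle in column
  \<open>j\<close> and row \<open>r\<close> has a horizontal shift (the truth value of \<open>r\<close>), which can only increase along a
  row, and a vertical shift (an element of clause \<open>j\<close>), which can only increase along a column.
  A vertical shift that is monotone in \<open>r\<close> has a fixed point \<open>r\<close>, the literal that satisfies
  clause \<open>j\<close>; there, the horizontal shift is forced to be the sign of the clause.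

  Membership. A solution can be cut off at the first long stretch without time-edges after the
  original lifetime, so its times have polynomially many digits, and density can be checked on the
  gaps between consecutive appearances.

  Polynomial time. Programs on four stacks are Turing machines; functions on prefix-coded binary
  trees that are computed by such programs in polynomial time are closed under the constructs of
  functional programming, including folds with polynomially bounded accumulators.
\<close>

section \<open>Stack programs\<close>

text \<open>A path leaves no room for wires to cross, and nothing can say in advance which variable
  will satisfy a clause. Two slacks take care of both. In a row, \<open>2 * m\<close> rectangles of
  width two lie on \<open>4 * m + 1\<close> vertices, one too many: once a rectangle is pushed to
  the right, all later ones are. Truth can thus travel along a row, but in one direction and without
  being switched off, which is why each clause has a single sign and the positive clauses come
  first. In a column the shifts range over \<open>R\<close> values and form a nondecreasing map on
  the \<open>R\<close> rows; that such a map has a fixed point makes every clause meet one of its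
  literals somewhere, with no row singled out beforehand. The tableau of a machine fits this
  restriction: "some value holds" is a positive clause and "this wrong successor does not occur" is
  a negative one. Rectangles have height \<open>R\<close> because times have the form
  \<open>2 * x + 1\<close> and the required distance is \<open>2 * R\<close>; oddness leaves the
  even times free for the argument that additions never pay.\<close>

datatype instr = IPush nat bool | IPop nat | IBranch nat "bool option \<Rightarrow> bool" nat

type_synonym regs = "nat \<Rightarrow> bool list"

fun first :: "bool list \<Rightarrow> bool option" where
  "first [] = None"
| "first (b # xs) = Some b"

fun istep :: "instr list \<Rightarrow> nat \<times> regs \<Rightarrow> nat \<times> regs" where
  "istep P (pc, s) =
     (if pc < length P then
        (case P ! pc of
           IPush r b \<Rightarrow> (pc + 1, s(r := b # s r))
         | IPop r \<Rightarrow> (pc + 1, s(r := tl (s r)))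
         | IBranch r B l \<Rightarrow> (if B (first (s r)) then pc + 1 else l, s))
      else (pc, s))"

definition reading :: "nat \<Rightarrow> bool option" where
  "reading c = (if c = 0 then None else Some (c = 2))"

fun ireg :: "instr \<Rightarrow> nat" where
  "ireg (IPush r b) = r"
| "ireg (IPop r) = r"
| "ireg (IBranch r B l) = r"

text \<open>
  The instruction at address \<open>i\<close> is executed in the states \<open>2 * i\<close> and, for the second half of a
  push, \<open>2 * i + 1\<close>. A register is a tape whose head is on the top of the stack; the cells to
  the left of the head are garbage.
\<close>

definition trans_of :: "instr list \<Rightarrow> nat \<Rightarrow> nat list \<Rightarrow> nat \<times> (nat \<times> move) list" where
  "trans_of P q ss =
     (let same = map (\<lambda>c. (c, Stay)) ss; go = (\<lambda>l. 2 * min l (length P)) in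
      case P ! (q div 2) of
        IPush r b \<Rightarrow>
          if even q then (q + 1, same[r := (ss ! r, Move_Left)])
          else (go (q div 2 + 1), same[r := (symbol b, Stay)])
      | IPop r \<Rightarrow> (go (q div 2 + 1), if ss ! r = 0 then same else same[r := (ss ! r, Move_Right)])
      | IBranch r B l \<Rightarrow>
          (go (if B (reading (ss ! r)) then q div 2 + 1 else l), same))"

definition machine_of :: "instr list \<Rightarrow> turing_machine" where
  "machine_of P =
     \<lparr>tape_count = 4, state_count = 2 * length P, symbol_count = 3, transition = trans_of P\<rparr>"

lemma symbol_less: "symbol b < 3"
  by (cases b) auto

lemma turing_machine_of:
  assumes "\<forall>i \<in> set P. ireg i < 4"
  shows "turing_machine (machine_of P)"
proof -
  have "case trans_of P q ss of (q', acts) \<Rightarrow> q' \<le> 2 * length P \<and> length acts = 4 \<and>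
      fst ` set acts \<subseteq> {..<3}"
    if q: "q < 2 * length P" and l: "length ss = 4" and s: "set ss \<subseteq> {..<3}" for q ss
  proof -
    let ?same = "map (\<lambda>c. (c, Stay)) ss"
    have q2: "q div 2 < length P" using q by auto
    have same: "fst ` set ?same \<subseteq> {..<3}" using s by auto
    have upd: "fst ` set (?same[r := (v, m)]) \<subseteq> {..<3}" if "v < 3" for r v m
      using same set_update_subset_insert[of ?same r "(v, m)"] that by fastforce
    show ?thesis
    proof (cases "P ! (q div 2)")
      case (IPush r b)
      then have "r < 4" using assms q2 nth_mem by fastforce
      then have "ss ! r < 3" using s l by (metis lessThan_iff nth_mem subset_iff)
      moreover have "q + 1 \<le> 2 * length P" using q by auto
      ultimately show ?thesis using IPush l upd[of "ss ! r"] upd[of "symbol b"] symbol_less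
        by (auto simp: trans_of_def Let_def)
    next
      case (IPop r)
      then have "r < 4" using assms q2 nth_mem by fastforce
      then have "ss ! r < 3" using s l by (metis lessThan_iff nth_mem subset_iff)
      then show ?thesis using IPop l upd[of "ss ! r"] same
        by (auto simp: trans_of_def Let_def)
    next
      case (IBranch r B l')
      then show ?thesis using l same by (auto simp: trans_of_def Let_def)
    qed
  qed
  then show ?thesis by (simp add: turing_machine_def machine_of_def)
qed

definition rep :: "tape list \<Rightarrow> regs \<Rightarrow> bool" where
  "rep tps s \<longleftrightarrow> length tps = 4 \<and> (\<forall>r<4. outputs (tps ! r) (s r))"

lemma scanned_first:
  "outputs tp xs \<Longrightarrow> reading (scanned tp) = first xs"

proof (cases tp, cases xs)
  fix c h b ys assume "outputs tp xs" "tp = (c, h)" "xs = b # ys"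
  then have "c h = symbol b" by fastforce
  then show ?thesis using \<open>tp = (c, h)\<close> \<open>xs = b # ys\<close> by (cases b) (auto simp: reading_def)
qed (auto simp: reading_def)

text \<open>\<open>outputs\<close> constrains the cells only up to the first blank, so a pop of the
  empty stack must leave the head where it is.\<close>

lemma outputs_pop:
  assumes "outputs tp xs"
  shows "outputs (if scanned tp = 0 then tp else act tp (scanned tp, Move_Right)) (tl xs)"
proof (cases xs)
  case Nil
  then show ?thesis using assms by (cases tp) auto
next
  case (Cons b ys)
  obtain c h where tp: "tp = (c, h)" by (cases tp)
  have "c h = symbol b" using assms tp Cons by fastforce
  then have "c h \<noteq> 0" by (cases b) auto
  moreover have "c (h + 1 + int i) = symbol (ys ! i)" if "i < length ys" for i
    using assms that unfolding tp Cons outputs.simps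
    by (auto simp: add.assoc dest!: conjunct1 spec[of _ "Suc i"])
  moreover have "c (h + 1 + int (length ys)) = 0"
    using assms unfolding tp Cons by (simp add: algebra_simps)
  ultimately show ?thesis using tp Cons by (auto simp: fun_upd_idem)
qed

lemma outputs_push:
  assumes "outputs tp xs"
  shows "outputs (act (act tp (scanned tp, Move_Left)) (symbol b, Stay)) (b # xs)"
proof -
  obtain c h where tp: "tp = (c, h)" by (cases tp)
  show ?thesis using assms unfolding tp
    by (auto simp: fun_upd_idem nth_Cons split: nat.splits)
qed

lemma act_same: "act tp (scanned tp, Stay) = tp"
  by (cases tp) (auto simp: fun_upd_idem)

lemma map2_act_same:
  "map2 act tps (map (\<lambda>c. (c, Stay)) (map scanned tps)) = tps"
  by (rule nth_equalityI) (auto simp: act_same)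

lemma map2_act_upd:
  assumes "r < length tps"
  shows "map2 act tps ((map (\<lambda>c. (c, Stay)) (map scanned tps))[r := x]) = tps[r := act (tps ! r) x]"
proof (rule nth_equalityI)
  fix i assume "i < length (map2 act tps ((map (\<lambda>c. (c, Stay)) (map scanned tps))[r := x]))"
  then have i: "i < length tps" by simp
  have "map2 act tps (map (\<lambda>c. (c, Stay)) (map scanned tps)) ! i = tps ! i"
    using map2_act_same[of tps] by simp
  then show "map2 act tps ((map (\<lambda>c. (c, Stay)) (map scanned tps))[r := x]) ! i =
      tps[r := act (tps ! r) x] ! i"
    using i assms by (auto simp: nth_list_update)
qed simp

lemma rep_upd: "rep tps s \<Longrightarrow> r < 4 \<Longrightarrow> outputs tp xs \<Longrightarrow> rep (tps[r := tp]) (s(r := xs))"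
  by (auto simp: rep_def nth_list_update)

text \<open>A push takes two steps, any other instruction one, and none is needed after the end of
  the program. All addresses past the end collapse, by \<open>min\<close>, to the one halting state
  \<open>2 * length P\<close>.\<close>

lemma step_sim:
  assumes P: "\<forall>i \<in> set P. ireg i < 4" and rep: "rep tps s"
    and st: "istep P (pc, s) = (pc', s')"
  shows "\<exists>j \<le> 2. \<exists>tps'. (step (machine_of P) ^^ j) (2 * min pc (length P), tps) =
           (2 * min pc' (length P), tps') \<and> rep tps' s'"
proof (cases "pc < length P")
  case False
  then show ?thesis using st rep by (intro exI[of _ 0]) auto
next
  case True
  let ?M = "machine_of P" and ?same = "map (\<lambda>c. (c, Stay)) (map scanned tps)"
  have len: "length tps = 4" using rep by (simp add: rep_def)
  have r4: "ireg (P ! pc) < 4" using P True nth_mem by blast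
  have m: "min pc (length P) = pc" using True by simp
  have step: "step ?M (q, tps) = (case trans_of P q (map scanned tps) of (q', acts) \<Rightarrow> (q', map2 act tps acts))"
    if "q < 2 * length P" for q tps using that by (simp add: machine_of_def)
  show ?thesis
  proof (cases "P ! pc")
    case (IPush r b)
    then have r: "r < 4" using r4 by simp
    define tps1 where "tps1 = tps[r := act (tps ! r) (scanned (tps ! r), Move_Left)]"
    have a: "step ?M (2 * pc, tps) = (2 * pc + 1, tps1)"
      using IPush True r len map2_act_upd[of r tps]
      by (simp add: step trans_of_def Let_def tps1_def del: step.simps)
    have b: "step ?M (2 * pc + 1, tps1) = (2 * min (pc + 1) (length P), tps1[r := act (tps1 ! r) (symbol b, Stay)])"
      using IPush True r len map2_act_upd[of r tps1]
      by (simp add: step trans_of_def Let_def tps1_def del: step.simps)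
    have c: "(step ?M ^^ 2) (2 * pc, tps) = (2 * min (pc + 1) (length P), tps1[r := act (tps1 ! r) (symbol b, Stay)])"
      using a b by (simp add: eval_nat_numeral del: step.simps)
    have "rep (tps1[r := act (tps1 ! r) (symbol b, Stay)]) (s(r := b # s r))"
    proof -
      have "outputs (act (act (tps ! r) (scanned (tps ! r), Move_Left)) (symbol b, Stay)) (b # s r)"
        using rep r by (intro outputs_push) (simp add: rep_def)
      from rep_upd[OF rep r this] show ?thesis using r len by (simp add: tps1_def del: act.simps)
    qed
    then show ?thesis using c IPush st True m by (intro exI[of _ 2]) (auto simp del: step.simps)
  next
    case (IPop r)
    then have r: "r < 4" using r4 by simp
    have a: "step ?M (2 * pc, tps) = (2 * min (pc + 1) (length P),
        tps[r := if scanned (tps ! r) = 0 then tps ! r else act (tps ! r) (scanned (tps ! r), Move_Right)])"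
      using IPop True r len map2_act_upd[of r tps] map2_act_same[of tps]
      by (auto simp add: step trans_of_def Let_def simp del: step.simps)
    have "rep (tps[r := if scanned (tps ! r) = 0 then tps ! r else act (tps ! r) (scanned (tps ! r), Move_Right)]) (s(r := tl (s r)))"
      using rep r by (intro rep_upd outputs_pop) (auto simp: rep_def)
    then show ?thesis using a IPop st True m by (intro exI[of _ 1]) (auto simp del: step.simps)
  next
    case (IBranch r B l)
    then have r: "r < 4" using r4 by simp
    have "reading (scanned (tps ! r)) = first (s r)"
      using rep r by (intro scanned_first) (auto simp: rep_def)
    then have a: "step ?M (2 * pc, tps) = (2 * min (if B (first (s r)) then pc + 1 else l) (length P), tps)"
      using IBranch True r len map2_act_same[of tps]
      by (simp add: step trans_of_def Let_def del: step.simps)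
    show ?thesis using a IBranch st True m rep by (intro exI[of _ 1]) (auto simp del: step.simps)
  qed
qed

definition reach :: "instr list \<Rightarrow> nat \<Rightarrow> nat \<times> regs \<Rightarrow> nat \<times> regs \<Rightarrow> bool" where
  "reach P n x y \<longleftrightarrow> (\<exists>m \<le> n. (istep P ^^ m) x = y)"

lemma reach_trans: "reach P m x y \<Longrightarrow> reach P n y z \<Longrightarrow> m + n \<le> k \<Longrightarrow> reach P k x z"
proof -
  assume "reach P m x y" "reach P n y z" "m + n \<le> k"
  then obtain i j where "i \<le> m" "j \<le> n" "(istep P ^^ i) x = y" "(istep P ^^ j) y = z"
    unfolding reach_def by blast
  then have "(istep P ^^ (j + i)) x = z" "j + i \<le> k" using \<open>m + n \<le> k\<close> by (auto simp: funpow_add)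
  then show ?thesis unfolding reach_def by blast
qed

lemma reach_mono: "reach P m x y \<Longrightarrow> m \<le> k \<Longrightarrow> reach P k x y"
  unfolding reach_def using le_trans by blast

lemma reach_step: "istep P x = y \<Longrightarrow> 1 \<le> k \<Longrightarrow> reach P k x y"
  unfolding reach_def by (intro exI[of _ 1]) auto

lemma reach_sim:
  assumes P: "\<forall>i \<in> set P. ireg i < 4" and rep: "rep tps s" and "reach P n (pc, s) (pc', s')"
  shows "\<exists>j \<le> 2 * n. \<exists>tps'. (step (machine_of P) ^^ j) (2 * min pc (length P), tps) =
           (2 * min pc' (length P), tps') \<and> rep tps' s'"
proof -
  obtain m where m: "m \<le> n" "(istep P ^^ m) (pc, s) = (pc', s')" using assms(3) reach_def by auto
  have "\<exists>j \<le> 2 * m. \<exists>tps'. (step (machine_of P) ^^ j) (2 * min pc (length P), tps) =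
           (2 * min pc' (length P), tps') \<and> rep tps' s'"
    using m(2)
  proof (induction m arbitrary: pc' s')
    case 0
    then show ?case using rep by auto
  next
    case (Suc m)
    obtain pc1 s1 where 1: "(istep P ^^ m) (pc, s) = (pc1, s1)" by fastforce
    from Suc.IH[OF 1] obtain j tps1 where j: "j \<le> 2 * m"
      "(step (machine_of P) ^^ j) (2 * min pc (length P), tps) = (2 * min pc1 (length P), tps1)"
      "rep tps1 s1" by blast
    have "istep P (pc1, s1) = (pc', s')" using 1 Suc.prems by simp
    from step_sim[OF P j(3) this] obtain i tps2 where i: "i \<le> 2"
      "(step (machine_of P) ^^ i) (2 * min pc1 (length P), tps1) = (2 * min pc' (length P), tps2)"
      "rep tps2 s'" by blast
    have "(step (machine_of P) ^^ (i + j)) (2 * min pc (length P), tps) = (2 * min pc' (length P), tps2)"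
      using i j by (simp add: funpow_add)
    then show ?case using i j by (intro exI[of _ "i + j"]) auto
  qed
  then show ?thesis using m(1) by (meson le_trans mult_le_mono2)
qed

section \<open>A while language on four stacks and its compilation\<close>

datatype cmd =
    Push nat bool
  | Pop nat
  | Seq cmd cmd (infixr ";;" 60)
  | If nat "bool option \<Rightarrow> bool" cmd cmd
  | While nat "bool option \<Rightarrow> bool" cmd

fun creg :: "cmd \<Rightarrow> bool" where
  "creg (Push r b) = (r < 4)"
| "creg (Pop r) = (r < 4)"
| "creg (c ;; d) = (creg c \<and> creg d)"
| "creg (If r B c d) = (r < 4 \<and> creg c \<and> creg d)"
| "creg (While r B c) = (r < 4 \<and> creg c)"

text \<open>The third argument of \<open>big\<close> is an upper bound on the running time.\<close>

inductive big :: "cmd \<Rightarrow> regs \<Rightarrow> nat \<Rightarrow> regs \<Rightarrow> bool" where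
  Push: "1 \<le> t \<Longrightarrow> big (Push r b) s t (s(r := b # s r))"
| Pop: "1 \<le> t \<Longrightarrow> big (Pop r) s t (s(r := tl (s r)))"
| Seq: "big c s t s' \<Longrightarrow> big d s' u s'' \<Longrightarrow> t + u \<le> v \<Longrightarrow> big (c ;; d) s v s''"
| IfT: "B (first (s r)) \<Longrightarrow> big c s t s' \<Longrightarrow> t + 2 \<le> v \<Longrightarrow> big (If r B c d) s v s'"
| IfF: "\<not> B (first (s r)) \<Longrightarrow> big d s t s' \<Longrightarrow> t + 2 \<le> v \<Longrightarrow> big (If r B c d) s v s'"
| WhileF: "\<not> B (first (s r)) \<Longrightarrow> 1 \<le> t \<Longrightarrow> big (While r B c) s t s"
| WhileT: "B (first (s r)) \<Longrightarrow> big c s t s' \<Longrightarrow> big (While r B c) s' u s'' \<Longrightarrow> t + u + 2 \<le> v \<Longrightarrow>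
    big (While r B c) s v s''"

fun clen :: "cmd \<Rightarrow> nat" where
  "clen (Push r b) = 1"
| "clen (Pop r) = 1"
| "clen (c ;; d) = clen c + clen d"
| "clen (If r B c d) = clen c + clen d + 2"
| "clen (While r B c) = clen c + 2"

text \<open>The branch on a constantly false test is an unconditional jump. Targets are absolute
  addresses, hence the parameter \<open>a\<close>.\<close>

fun comp :: "nat \<Rightarrow> cmd \<Rightarrow> instr list" where
  "comp a (Push r b) = [IPush r b]"
| "comp a (Pop r) = [IPop r]"
| "comp a (c ;; d) = comp a c @ comp (a + clen c) d"
| "comp a (If r B c d) =
     IBranch r B (a + clen c + 2) # comp (a + 1) c @
     IBranch 0 (\<lambda>_. False) (a + clen c + 2 + clen d) # comp (a + clen c + 2) d"
| "comp a (While r B c) =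
     IBranch r B (a + clen c + 2) # comp (a + 1) c @ [IBranch 0 (\<lambda>_. False) a]"

lemma length_comp [simp]: "length (comp a c) = clen c"
  by (induction a c rule: comp.induct) auto

lemma ireg_comp: "creg c \<Longrightarrow> \<forall>i \<in> set (comp a c). ireg i < 4"
  by (induction a c rule: comp.induct) auto

definition code_at :: "instr list \<Rightarrow> nat \<Rightarrow> instr list \<Rightarrow> bool" where
  "code_at P a is \<longleftrightarrow> (\<exists>xs ys. P = xs @ is @ ys \<and> length xs = a)"

lemma code_at_append: "code_at P a (is @ js) \<Longrightarrow> code_at P a is \<and> code_at P (a + length is) js"
  unfolding code_at_def by (metis append.assoc length_append)

lemma code_at_Cons: "code_at P a (i # is) \<Longrightarrow> a < length P \<and> P ! a = i \<and> code_at P (a + 1) is"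
proof -
  assume "code_at P a (i # is)"
  then obtain xs ys where P: "P = xs @ (i # is) @ ys" "length xs = a" unfolding code_at_def by blast
  then have "P = (xs @ [i]) @ is @ ys" "length (xs @ [i]) = a + 1" by simp_all
  then have "code_at P (a + 1) is" unfolding code_at_def by blast
  then show ?thesis using P by (auto simp: nth_append)
qed

text \<open>The two extra steps in the rules for \<open>If\<close> and \<open>While\<close> pay for
  the test and for the jump that ends a branch or a round.\<close>

lemma comp_correct:
  "big c s t s' \<Longrightarrow> code_at P a (comp a c) \<Longrightarrow> reach P t (a, s) (a + clen c, s')"
proof (induction arbitrary: a rule: big.induct)
  case (Push t r b s)
  then show ?case by (auto dest!: code_at_Cons intro!: reach_step simp: fun_upd_def)
next
  case (Pop t r s)
  then show ?case by (auto dest!: code_at_Cons intro!: reach_step simp: fun_upd_def)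
next
  case (Seq c s t s' d u s'' v)
  have A: "code_at P a (comp a c)" "code_at P (a + clen c) (comp (a + clen c) d)"
    using code_at_append[of P a "comp a c" "comp (a + clen c) d"] Seq.prems by auto
  show ?case using reach_trans[OF Seq.IH(1)[OF A(1)] Seq.IH(2)[OF A(2)] Seq.hyps(3)]
    by (simp add: add.assoc)
next
  case (IfT B s r c t s' v d)
  have A: "a < length P" "P ! a = IBranch r B (a + clen c + 2)" "code_at P (a + 1) (comp (a + 1) c)"
    "a + 1 + clen c < length P" "P ! (a + 1 + clen c) = IBranch 0 (\<lambda>_. False) (a + clen c + 2 + clen d)"
    using IfT.prems by (auto dest!: code_at_Cons code_at_append)
  have "reach P 1 (a, s) (a + 1, s)" using A IfT.hyps by (intro reach_step) auto
  moreover have "reach P t (a + 1, s) (a + 1 + clen c, s')" using IfT.IH A by blast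
  moreover have "reach P 1 (a + 1 + clen c, s') (a + clen (If r B c d), s')"
    using A by (intro reach_step) auto
  ultimately have "reach P (1 + t + 1) (a, s) (a + clen (If r B c d), s')"
    by (meson reach_trans order_refl)
  then show ?case by (rule reach_mono) (use IfT.hyps in simp)
next
  case (IfF B s r d t s' v c)
  have A: "a < length P" "P ! a = IBranch r B (a + clen c + 2)"
    "code_at P (a + clen c + 2) (comp (a + clen c + 2) d)"
    using IfF.prems by (auto dest!: code_at_Cons code_at_append)
  have "reach P 1 (a, s) (a + clen c + 2, s)" using A IfF.hyps by (intro reach_step) auto
  moreover have "reach P t (a + clen c + 2, s) (a + clen c + 2 + clen d, s')" using IfF.IH A by blast
  ultimately have "reach P (1 + t) (a, s) (a + clen c + 2 + clen d, s')" by (rule reach_trans) simp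
  then have "reach P v (a, s) (a + clen c + 2 + clen d, s')"
    by (rule reach_mono) (use IfF.hyps in simp)
  then show ?case by (simp add: algebra_simps)
next
  case (WhileF B s r t c)
  then show ?case by (auto dest!: code_at_Cons intro!: reach_step)
next
  case (WhileT B s r c t s' u s'' v)
  have A: "a < length P" "P ! a = IBranch r B (a + clen c + 2)" "code_at P (a + 1) (comp (a + 1) c)"
    "a + 1 + clen c < length P" "P ! (a + 1 + clen c) = IBranch 0 (\<lambda>_. False) a"
    using WhileT.prems by (auto dest!: code_at_Cons code_at_append)
  have 1: "reach P 1 (a, s) (a + 1, s)" using A WhileT.hyps by (intro reach_step) auto
  have 2: "reach P t (a + 1, s) (a + 1 + clen c, s')" using WhileT.IH A by blast
  have 3: "reach P 1 (a + 1 + clen c, s') (a, s')" using A by (intro reach_step) auto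
  have 4: "reach P u (a, s') (a + clen (While r B c), s'')" using WhileT by blast
  show ?case
    by (rule reach_trans[OF reach_trans[OF reach_trans[OF 1 2 order_refl] 3 order_refl] 4])
      (use WhileT.hyps in simp)
qed

subsection \<open>Polynomial bounds\<close>

text \<open>With the base \<open>n + 2\<close> a single exponent absorbs constants, sums and
  products for every \<open>n\<close>, zero included, so the closure rules need no
  threshold.\<close>

definition pb :: "(nat \<Rightarrow> nat) \<Rightarrow> bool" where
  "pb f \<longleftrightarrow> (\<exists>k. \<forall>n. f n \<le> (n + 2) ^ k)"

lemma pb_const: "pb (\<lambda>n. c)"
proof -
  have "c \<le> (n + 2) ^ c" for n
  proof -
    have "c \<le> 2 ^ c" by (simp add: less_imp_le)
    also have "\<dots> \<le> (n + 2) ^ c" by (simp add: power_mono)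
    finally show ?thesis .
  qed
  then show ?thesis unfolding pb_def by blast
qed

lemma pb_id: "pb (\<lambda>n. n)"
  unfolding pb_def by (rule exI[of _ 1]) auto

lemma pb_mult: "pb f \<Longrightarrow> pb g \<Longrightarrow> pb (\<lambda>n. f n * g n)"
proof -
  assume "pb f" "pb g"
  then obtain j k where "\<forall>n. f n \<le> (n + 2) ^ j" "\<forall>n. g n \<le> (n + 2) ^ k" unfolding pb_def by blast
  then have "\<forall>n. f n * g n \<le> (n + 2) ^ (j + k)" unfolding power_add by (intro allI mult_mono) auto
  then show ?thesis unfolding pb_def by blast
qed

lemma pb_add: "pb f \<Longrightarrow> pb g \<Longrightarrow> pb (\<lambda>n. f n + g n)"
proof -
  assume "pb f" "pb g"
  then obtain j k where jk: "\<forall>n. f n \<le> (n + 2) ^ j" "\<forall>n. g n \<le> (n + 2) ^ k" unfolding pb_def by blast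
  have "f n + g n \<le> (n + 2) ^ (j + k + 1)" for n
  proof -
    have "(n + 2) ^ j \<le> (n + 2) ^ (j + k)" "(n + 2) ^ k \<le> (n + 2) ^ (j + k)"
      by (auto intro!: power_increasing)
    then have "f n + g n \<le> 2 * (n + 2) ^ (j + k)"
      using spec[OF jk(1), of n] spec[OF jk(2), of n] by linarith
    also have "\<dots> \<le> (n + 2) ^ (j + k + 1)" by simp
    finally show ?thesis .
  qed
  then show ?thesis unfolding pb_def by blast
qed

lemma pb_Suc: "pb f \<Longrightarrow> pb (\<lambda>n. Suc (f n))"
  using pb_add[OF _ pb_const[of 1]] by simp

lemma pb_power: "pb f \<Longrightarrow> pb (\<lambda>n. f n ^ k)"
  by (induction k) (auto intro: pb_mult pb_const)

lemma pb_poly: "pb (poly p)"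
proof (induction p)
  case 0
  then show ?case using pb_const[of 0] by (simp add: pb_def)
next
  case (pCons a p)
  have "pb (\<lambda>n. a + n * poly p n)" by (intro pb_add pb_const pb_mult pb_id pCons.IH)
  then show ?case by (simp add: pb_def)
qed

lemmas pb_intros = pb_const pb_id pb_mult pb_add pb_Suc pb_power pb_poly

lemma pb_bound_poly: "pb f \<Longrightarrow> \<exists>p. \<forall>n. f n \<le> poly p n"
proof -
  assume "pb f"
  then obtain k where "\<forall>n. f n \<le> (n + 2) ^ k" unfolding pb_def by blast
  then have "\<forall>n. f n \<le> poly ([:2, 1:] ^ k) n" by (simp add: add.commute)
  then show ?thesis by blast
qed

lemma poly_mono_nat: "m \<le> n \<Longrightarrow> poly p (m :: nat) \<le> poly p n"
  by (induction p) (auto intro: add_mono mult_mono)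

section \<open>Commands that compute functions on strings\<close>

definition st :: "bool list \<Rightarrow> bool list \<Rightarrow> bool list \<Rightarrow> bool list \<Rightarrow> regs" where
  "st a b c d = (\<lambda>r. if r = 0 then a else if r = 1 then b else if r = 2 then c else
     if r = 3 then d else [])"

lemma st_simps [simp]:
  "st a b c d 0 = a" "st a b c d (Suc 0) = b" "st a b c d 2 = c" "st a b c d 3 = d"
  "(st a b c d)(0 := x) = st x b c d" "(st a b c d)(Suc 0 := x) = st a x c d"
  "(st a b c d)(2 := x) = st a b x d" "(st a b c d)(3 := x) = st a b c x"
  by (auto simp: st_def fun_eq_iff)

lemma poly_time_of_cmd:
  assumes c: "creg c" and p: "pb p"
    and run: "\<And>x. big c (st x [] [] []) (p (length x)) (st (f x) [] [] [])"
  shows "poly_time f"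
proof -
  define P where "P = comp 0 c"
  have reg: "\<forall>i \<in> set P. ireg i < 4" unfolding P_def using ireg_comp[OF c] .
  obtain q where q: "\<forall>n. 2 * p n \<le> poly q n" using pb_bound_poly[OF pb_mult[OF pb_const p]] by blast
  have "computes_within (machine_of P) f (poly q)"
    unfolding computes_within_def
  proof
    fix x
    have "code_at P 0 (comp 0 c)" by (auto simp: code_at_def P_def)
    from comp_correct[OF run this, of x]
    have reach: "reach P (p (length x)) (0, st x [] [] []) (length P, st (f x) [] [] [])"
      by (simp add: P_def)
    have ini: "initial (machine_of P) x = (2 * min 0 (length P), input_tape x # replicate 3 (\<lambda>_. 0, 0))"
      by (simp add: initial_def machine_of_def)
    have "rep (input_tape x # replicate 3 (\<lambda>_. 0, 0)) (st x [] [] [])"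
    proof -
      have "outputs ((input_tape x # replicate 3 (\<lambda>_. 0, 0)) ! r) (st x [] [] [] r)" if "r < 4" for r
      proof (cases r)
        case 0
        then show ?thesis by (simp add: input_tape_def)
      next
        case (Suc r')
        then have "r' < 3" using that by simp
        then show ?thesis using Suc by (auto simp: st_def)
      qed
      then show ?thesis by (simp add: rep_def)
    qed
    from reach_sim[OF reg this reach] obtain j tps where j: "j \<le> 2 * p (length x)"
      "(step (machine_of P) ^^ j) (2 * min 0 (length P), input_tape x # replicate 3 (\<lambda>_. 0, 0)) =
       (2 * min (length P) (length P), tps)" "rep tps (st (f x) [] [] [])" by blast
    have "outputs (tps ! 0) (f x)" using j(3) unfolding rep_def by (metis st_simps(1) zero_less_numeral)
    then show "\<exists>t \<le> poly q (length x). case (step (machine_of P) ^^ t) (initial (machine_of P) x) of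
        (q, tps) \<Rightarrow> q = state_count (machine_of P) \<and> outputs (tps ! 0) (f x)"
      using j q unfolding ini by (intro exI[of _ j]) (auto simp: machine_of_def intro: le_trans)
  qed
  then show ?thesis using turing_machine_of[OF reg] unfolding poly_time_def by blast
qed

subsection \<open>Polynomial-time functions on encoded data\<close>

datatype tree = Leaf | Node tree tree

text \<open>The preorder code is prefix-free, so a tree can lie on a stack directly above arbitrary
  other data and its end is still recognisable.\<close>

fun code :: "tree \<Rightarrow> bool list" where
  "code Leaf = [False]"
| "code (Node a b) = True # code a @ code b"

lemma code_inj': "code a @ l = code b @ m \<Longrightarrow> a = b \<and> l = m"
proof (induction a arbitrary: b l m)
  case Leaf
  then show ?case by (cases b) auto
next
  case (Node a1 a2)
  from Node.prems obtain b1 b2 where b: "b = Node b1 b2" by (cases b) auto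
  with Node.prems have "code a1 @ (code a2 @ l) = code b1 @ (code b2 @ m)" by simp
  from Node.IH(1)[OF this] have 1: "a1 = b1" "code a2 @ l = code b2 @ m" by simp_all
  from Node.IH(2)[OF 1(2)] show ?case unfolding b 1(1) by simp
qed

lemma code_inj: "code a = code b \<longleftrightarrow> a = b"
  using code_inj'[of a "[]" b "[]"] by auto

abbreviation nonempty :: "bool option \<Rightarrow> bool" where
  "nonempty x \<equiv> x \<noteq> None"

abbreviation is_true :: "bool option \<Rightarrow> bool" where
  "is_true x \<equiv> x = Some True"

fun loop_free :: "cmd \<Rightarrow> bool" where
  "loop_free (c ;; d) = (loop_free c \<and> loop_free d)"
| "loop_free (If r B c d) = (loop_free c \<and> loop_free d)"
| "loop_free (While r B c) = False"
| "loop_free _ = True"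

fun eff :: "cmd \<Rightarrow> regs \<Rightarrow> regs" where
  "eff (Push r b) s = s(r := b # s r)"
| "eff (Pop r) s = s(r := tl (s r))"
| "eff (c ;; d) s = eff d (eff c s)"
| "eff (If r B c d) s = (if B (first (s r)) then eff c s else eff d s)"
| "eff (While r B c) s = s"

lemma big_mono: "big c s t s' \<Longrightarrow> t \<le> u \<Longrightarrow> big c s u s'"
  by (cases c s t s' rule: big.cases) (auto intro: big.intros)

text \<open>Loop-free code executes each of its instructions at most once, so a run is obtained by
  evaluating \<open>eff\<close>; only loops need derivations by hand. The value of
  \<open>eff\<close> on \<open>While\<close> is a dummy.\<close>

lemma big_loop_free: "loop_free c \<Longrightarrow> big c s (clen c) (eff c s)"
proof (induction c arbitrary: s)
  case (If r B c d)
  then show ?case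
    by (cases "B (first (s r))") (auto intro: big.IfT[of B s r c "clen c"] big.IfF[of B s r d "clen d"])
qed (auto intro: big.intros)

lemma big_loop_freeI:
  "loop_free c \<Longrightarrow> s' = eff c s \<Longrightarrow> clen c \<le> t \<Longrightarrow> big c s t s'"
  using big_loop_free big_mono by blast

lemma big_while_step:
  "eff c s = s1 \<Longrightarrow> big (While r B c) s1 u s' \<Longrightarrow> B (first (s r)) \<Longrightarrow> loop_free c \<Longrightarrow>
   clen c + u + 2 \<le> v \<Longrightarrow> big (While r B c) s v s'"
  using big.WhileT big_loop_free by blast

section \<open>Moving, copying and comparing coded trees\<close>

definition move_loop :: "nat \<Rightarrow> cmd" where
  "move_loop d = While 3 nonempty
     (If 0 is_true (Pop 0 ;; Push d True ;; Push 3 True) (Pop 0 ;; Push d False ;; Pop 3))"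

text \<open>Register 3 counts, in unary, the trees that are still to be read.\<close>

definition move_tree :: "nat \<Rightarrow> cmd" where
  "move_tree d = Push 3 True ;; move_loop d"

text \<open>Stated in continuation style: a run from the state after the tree is extended to one
  from before it. At a node the hypothesis for the right subtree is therefore applied first and
  feeds the one for the left. Each bit costs one round, eight steps for the body and two for the
  loop.\<close>

lemma move_loop:
  assumes d: "d = 1 \<or> d = 2"
  shows "big (move_loop d) (s(0 := l, d := rev (code t) @ s d, 3 := e)) u s' \<Longrightarrow>
    s 0 = code t @ l \<Longrightarrow> s 3 = True # e \<Longrightarrow> big (move_loop d) s (u + 10 * length (code t)) s'"
proof (induction t arbitrary: s l e u)
  case Leaf
  have "eff (If 0 is_true (Pop 0 ;; Push d True ;; Push 3 True) (Pop 0 ;; Push d False ;; Pop 3)) s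
      = s(0 := l, d := rev (code Leaf) @ s d, 3 := e)"
    using Leaf(2,3) d by (auto simp: fun_eq_iff)
  from big_while_step[OF this Leaf(1)[unfolded move_loop_def]] show ?case
    unfolding move_loop_def using Leaf(3) by simp
next
  case (Node a b)
  let ?s1 = "s(0 := code a @ code b @ l, d := True # s d, 3 := True # True # e)"
  let ?s2 = "?s1(0 := code b @ l, d := rev (code a) @ ?s1 d, 3 := True # e)"
  have 0: "eff (If 0 is_true (Pop 0 ;; Push d True ;; Push 3 True) (Pop 0 ;; Push d False ;; Pop 3)) s = ?s1"
    using Node.prems(2,3) d by (auto simp: fun_eq_iff)
  have 2: "s(0 := l, d := rev (code (Node a b)) @ s d, 3 := e) = ?s2(0 := l, d := rev (code b) @ ?s2 d, 3 := e)"
    using d by (auto simp: fun_eq_iff)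
  have "big (move_loop d) ?s2 (u + 10 * length (code b)) s'"
    by (rule Node.IH(2)[OF Node.prems(1)[unfolded 2]]) (use d in auto)
  then have "big (move_loop d) ?s1 (u + 10 * length (code b) + 10 * length (code a)) s'"
    by (rule Node.IH(1)) (use d in auto)
  from big_while_step[OF 0 this[unfolded move_loop_def]] show ?case
    unfolding move_loop_def using Node.prems(3) by simp
qed

lemma move_tree:
  assumes d: "d = 1 \<or> d = 2" and s: "s 0 = code t @ l" "s 3 = []"
  shows "big (move_tree d) s (10 * length (code t) + 2) (s(0 := l, d := rev (code t) @ s d))"
proof -
  let ?s = "s(3 := [True])"
  have "s(0 := l, d := rev (code t) @ s d) = ?s(0 := l, d := rev (code t) @ ?s d, 3 := [])"
    using s(2) d by (auto simp: fun_eq_iff)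
  moreover have "big (move_loop d) (s(0 := l, d := rev (code t) @ s d)) 1 (s(0 := l, d := rev (code t) @ s d))"
    unfolding move_loop_def by (rule big.WhileF) (use s(2) d in auto)
  ultimately have "big (move_loop d) ?s (1 + 10 * length (code t)) (s(0 := l, d := rev (code t) @ s d))"
    using s(1) by (intro move_loop[OF d]) auto
  moreover have "big (Push 3 True) s 1 ?s" by (rule big_loop_freeI) (use s(2) in auto)
  ultimately show ?thesis unfolding move_tree_def using big.Seq[of "Push 3 True" s 1 ?s] by simp
qed

definition pour :: "nat \<Rightarrow> nat \<Rightarrow> cmd" where
  "pour i j = While i nonempty (If i is_true (Pop i ;; Push j True) (Pop i ;; Push j False))"

lemma pour:
  "i \<noteq> j \<Longrightarrow> s i = xs \<Longrightarrow> big (pour i j) s (8 * length xs + 1) (s(i := [], j := rev xs @ s j))"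
proof (induction xs arbitrary: s)
  case Nil
  then show ?case unfolding pour_def using big.WhileF[of nonempty s i 1] by (simp add: fun_upd_idem)
next
  case (Cons x xs)
  let ?s = "s(i := xs, j := x # s j)"
  have 1: "eff (If i is_true (Pop i ;; Push j True) (Pop i ;; Push j False)) s = ?s"
    using Cons.prems by (auto simp: fun_eq_iff)
  have 2: "?s(i := [], j := rev xs @ ?s j) = s(i := [], j := rev (x # xs) @ s j)"
    using Cons.prems by (auto simp: fun_eq_iff)
  have "big (pour i j) ?s (8 * length xs + 1) (?s(i := [], j := rev xs @ ?s j))"
    using Cons.prems(1) by (intro Cons.IH) auto
  then have 3: "big (pour i j) ?s (8 * length xs + 1) (s(i := [], j := rev (x # xs) @ s j))"
    unfolding 2 .
  show ?case unfolding pour_def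
    by (rule big_while_step[OF 1 3[unfolded pour_def]]) (use Cons.prems in auto)
qed

definition pour_both :: cmd where
  "pour_both = While 1 nonempty (If 1 is_true (Pop 1 ;; Push 0 True ;; Push 2 True)
     (Pop 1 ;; Push 0 False ;; Push 2 False))"

lemma pour_both:
  "big pour_both (st a xs c d) (10 * length xs + 1) (st (rev xs @ a) [] (rev xs @ c) d)"
proof (induction xs arbitrary: a c)
  case Nil
  then show ?case unfolding pour_both_def by (auto intro: big.WhileF)
next
  case (Cons x xs)
  have "eff (If 1 is_true (Pop 1 ;; Push 0 True ;; Push 2 True) (Pop 1 ;; Push 0 False ;; Push 2 False))
      (st a (x # xs) c d) = st (x # a) xs (x # c) d"
    by auto
  from big_while_step[OF this Cons.IH[unfolded pour_both_def]] show ?case unfolding pour_both_def by simp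
qed

definition clear :: "nat \<Rightarrow> cmd" where
  "clear i = While i nonempty (Pop i)"

lemma clear: "s i = xs \<Longrightarrow> big (clear i) s (3 * length xs + 1) (s(i := []))"
proof (induction xs arbitrary: s)
  case Nil
  then show ?case unfolding clear_def using big.WhileF[of nonempty s i 1] by (simp add: fun_upd_idem)
next
  case (Cons x xs)
  have "eff (Pop i) s = s(i := xs)" using Cons.prems by (auto simp: fun_eq_iff)
  moreover have "big (While i nonempty (Pop i)) (s(i := xs)) (3 * length xs + 1) (s(i := []))"
    using Cons.IH[of "s(i := xs)", unfolded clear_def fun_upd_upd] by (simp del: fun_upd_apply add: fun_upd_same)
  ultimately show ?case unfolding clear_def by (rule big_while_step) (use Cons.prems in auto)
qed

definition dup :: cmd where
  "dup = move_tree 1 ;; pour_both ;; pour 2 1 ;; pour 1 0"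

lemma dup:
  "big dup (st (code t @ l) [] [] []) (40 * length (code t) + 10) (st (code t @ code t @ l) [] [] [])"
proof -
  have 1: "big (move_tree 1) (st (code t @ l) [] [] []) (10 * length (code t) + 2) (st l (rev (code t)) [] [])"
    using move_tree[of 1 "st (code t @ l) [] [] []" t l] by simp
  have 2: "big pour_both (st l (rev (code t)) [] []) (10 * length (code t) + 1) (st (code t @ l) [] (code t) [])"
    using pour_both[of l "rev (code t)" "[]" "[]"] by simp
  have 3: "big (pour 2 1) (st (code t @ l) [] (code t) []) (8 * length (code t) + 1) (st (code t @ l) (rev (code t)) [] [])"
    using pour[of 2 1 "st (code t @ l) [] (code t) []"] by simp
  have 4: "big (pour 1 0) (st (code t @ l) (rev (code t)) [] []) (8 * length (code t) + 1) (st (code t @ code t @ l) [] [] [])"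
    using pour[of 1 0 "st (code t @ l) (rev (code t)) [] []"] by simp
  show ?thesis unfolding dup_def
    by (rule big.Seq[OF 1 big.Seq[OF 2 big.Seq[OF 3 4 order_refl] order_refl]]) simp
qed

definition drop_tree :: cmd where
  "drop_tree = move_tree 1 ;; clear 1"

lemma drop_tree:
  "big drop_tree (st (code t @ l) [] [] []) (13 * length (code t) + 3) (st l [] [] [])"
proof -
  have 1: "big (move_tree 1) (st (code t @ l) [] [] []) (10 * length (code t) + 2) (st l (rev (code t)) [] [])"
    using move_tree[of 1 "st (code t @ l) [] [] []" t l] by simp
  have 2: "big (clear 1) (st l (rev (code t)) [] []) (3 * length (code t) + 1) (st l [] [] [])"
    using clear[of "st l (rev (code t)) [] []" 1 "rev (code t)"] by simp
  show ?thesis unfolding drop_tree_def by (rule big.Seq[OF 1 2]) simp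
qed

definition swap :: cmd where
  "swap = (move_tree 1 ;; move_tree 2) ;; pour 1 0 ;; pour 2 0"

lemma move_two:
  "big (move_tree 1 ;; move_tree 2) (st (code a @ code b @ l) [] [] [])
     (10 * length (code a) + 10 * length (code b) + 4) (st l (rev (code a)) (rev (code b)) [])"
proof -
  have 1: "big (move_tree 1) (st (code a @ code b @ l) [] [] []) (10 * length (code a) + 2)
      (st (code b @ l) (rev (code a)) [] [])"
    using move_tree[of 1 "st (code a @ code b @ l) [] [] []" a] by simp
  have 2: "big (move_tree 2) (st (code b @ l) (rev (code a)) [] []) (10 * length (code b) + 2)
      (st l (rev (code a)) (rev (code b)) [])"
    using move_tree[of 2 "st (code b @ l) (rev (code a)) [] []" b] by simp
  show ?thesis by (rule big.Seq[OF 1 2]) simp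
qed

lemma swap:
  "big swap (st (code a @ code b @ l) [] [] []) (20 * length (code a) + 20 * length (code b) + 10)
     (st (code b @ code a @ l) [] [] [])"
proof -
  have 3: "big (pour 1 0) (st l (rev (code a)) (rev (code b)) []) (8 * length (code a) + 1)
      (st (code a @ l) [] (rev (code b)) [])"
    using pour[of 1 0 "st l (rev (code a)) (rev (code b)) []"] by simp
  have 4: "big (pour 2 0) (st (code a @ l) [] (rev (code b)) []) (8 * length (code b) + 1)
      (st (code b @ code a @ l) [] [] [])"
    using pour[of 2 0 "st (code a @ l) [] (rev (code b)) []"] by simp
  show ?thesis unfolding swap_def
    by (rule big.Seq[OF move_two big.Seq[OF 3 4 order_refl]]) simp
qed

text \<open>A comparison that never stops early, so that register 1 always ends up empty: each
  disagreement leaves a mark in the third argument, and a remainder of the second string shows that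
  it was longer.\<close>

fun cmp :: "bool list \<Rightarrow> bool list \<Rightarrow> bool list \<Rightarrow> bool list \<times> bool list" where
  "cmp [] ys f = (ys, f)"
| "cmp (x # xs) ys f = cmp xs (tl ys) (if first ys = Some x then f else True # f)"

lemma cmp_Nil: "cmp xs ys f = ([], []) \<longleftrightarrow> xs = ys \<and> f = []"
proof (induction xs arbitrary: ys f)
  case (Cons x xs)
  then show ?case by (cases ys) auto
qed auto

lemma cmp_length: "cmp xs ys f = (ys', f') \<Longrightarrow> length ys' \<le> length ys \<and> length f' \<le> length f + length xs"
proof (induction xs arbitrary: ys f)
  case (Cons x xs)
  from Cons.IH[of "tl ys" "if first ys = Some x then f else True # f"] Cons.prems
  show ?case by (auto split: if_splits)
qed auto

abbreviation skip :: cmd where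
  "skip \<equiv> Push 0 True ;; Pop 0"

definition cmp_loop :: cmd where
  "cmp_loop = While 1 nonempty
     (If 1 is_true (If 2 is_true skip (Push 3 True)) (If 2 (\<lambda>x. x = Some False) skip (Push 3 True)) ;;
      Pop 1 ;; Pop 2)"

lemma cmp_loop:
  "big cmp_loop (st l xs ys f) (20 * length xs + 1) (st l [] (fst (cmp xs ys f)) (snd (cmp xs ys f)))"
proof (induction xs arbitrary: ys f)
  case Nil
  then show ?case unfolding cmp_loop_def by (auto intro: big.WhileF)
next
  case (Cons x xs)
  have "eff (If 1 is_true (If 2 is_true skip (Push 3 True)) (If 2 (\<lambda>x. x = Some False) skip (Push 3 True)) ;;
      Pop 1 ;; Pop 2) (st l (x # xs) ys f) = st l xs (tl ys) (if first ys = Some x then f else True # f)"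
    by (cases x) auto
  from big_while_step[OF this Cons.IH[unfolded cmp_loop_def]] show ?case unfolding cmp_loop_def by simp
qed

definition eq_test :: cmd where
  "eq_test = (move_tree 1 ;; move_tree 2) ;; cmp_loop ;;
     If 2 nonempty (Push 3 True) skip ;; clear 2 ;;
     If 3 nonempty (Push 0 False) (Push 0 False ;; Push 0 False ;; Push 0 True) ;; clear 3"

section \<open>Data types as trees, and the functions computable in polynomial time\<close>

class enc =
  fixes enc :: "'a \<Rightarrow> tree"
  assumes enc_inj: "enc x = enc y \<Longrightarrow> x = y"

instantiation tree :: enc
begin
definition enc_tree :: "tree \<Rightarrow> tree" where "enc_tree t = t"
instance by standard (simp add: enc_tree_def)
end

instantiation bool :: enc
begin
definition enc_bool :: "bool \<Rightarrow> tree" where "enc_bool b = (if b then Node Leaf Leaf else Leaf)"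
instance by standard (simp add: enc_bool_def split: if_splits)
end

instantiation prod :: (enc, enc) enc
begin
definition enc_prod :: "'a \<times> 'b \<Rightarrow> tree" where "enc_prod p = Node (enc (fst p)) (enc (snd p))"
instance by standard (auto simp: enc_prod_def prod_eq_iff dest: enc_inj)
end

instantiation list :: (enc) enc
begin
primrec enc_list :: "'a list \<Rightarrow> tree" where
  "enc_list [] = Leaf"
| "enc_list (x # xs) = Node (enc x) (enc_list xs)"
instance
proof
  fix x y :: "'a list"
  show "enc x = enc y \<Longrightarrow> x = y"
  proof (induction x arbitrary: y)
    case Nil
    then show ?case by (cases y) auto
  next
    case (Cons a x)
    then show ?case by (cases y) (auto dest: enc_inj)
  qed
qed
end

fun val :: "bool list \<Rightarrow> nat" where
  "val [] = 0"
| "val (b # bs) = of_bool b + 2 * val bs"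

lemma val_bits [simp]: "val (bits n) = n"
proof (induction n rule: bits.induct)
  case (1 n)
  then show ?case by (subst bits.simps) auto
qed

instantiation nat :: enc
begin
definition enc_nat :: "nat \<Rightarrow> tree" where "enc_nat n = enc (bits n)"
instance by standard (metis enc_nat_def enc_inj val_bits)
end

definition sz :: "'a::enc \<Rightarrow> nat" where
  "sz x = length (code (enc x))"

lemma sz_simps [simp]:
  "sz (a, b) = Suc (sz a + sz b)" "sz [] = 1" "sz (x # xs) = Suc (sz x + sz xs)"
  "sz True = 3" "sz False = 1"
  by (auto simp: sz_def enc_prod_def enc_bool_def)

lemma sz_pair: "sz p = Suc (sz (fst p) + sz (snd p))"
  by (cases p) simp

lemma sz_bool_le: "sz (b :: bool) \<le> 3"
  by (cases b) auto

text \<open>The arbitrary remainder \<open>l\<close> is a frame: it lets a program run while other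
  data wait below on the stack. The bound on the size of the result is carried along because the
  running time of whatever is applied next depends on it.\<close>

definition fp :: "('a::enc \<Rightarrow> 'b::enc) \<Rightarrow> bool" where
  "fp f \<longleftrightarrow> (\<exists>c k. creg c \<and> (\<forall>x. sz (f x) \<le> (sz x + 2) ^ k \<and>
     (\<forall>l. big c (st (code (enc x) @ l) [] [] []) ((sz x + 2) ^ k) (st (code (enc (f x)) @ l) [] [] []))))"

lemma fpI:
  assumes "creg c" "pb p" "pb q" "\<And>x. sz (f x) \<le> q (sz x)"
    "\<And>x l. big c (st (code (enc x) @ l) [] [] []) (p (sz x)) (st (code (enc (f x)) @ l) [] [] [])"
  shows "fp f"
proof -
  obtain k where k: "\<forall>n. p n + q n \<le> (n + 2) ^ k"
    using pb_add[OF assms(2,3)] unfolding pb_def by blast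
  have "p n \<le> (n + 2) ^ k \<and> q n \<le> (n + 2) ^ k" for n using spec[OF k, of n] by linarith
  then show ?thesis unfolding fp_def
    using assms(1,4,5) by (intro exI[of _ c] exI[of _ k]) (meson big_mono le_trans)
qed

lemma fpE:
  assumes "fp f"
  obtains c k where "creg c" "\<And>x. sz (f x) \<le> (sz x + 2) ^ k"
    "\<And>x l. big c (st (code (enc x) @ l) [] [] []) ((sz x + 2) ^ k) (st (code (enc (f x)) @ l) [] [] [])"
  using assms unfolding fp_def by blast

lemma fp_sz: "fp f \<Longrightarrow> \<exists>q. pb q \<and> (\<forall>x. sz (f x) \<le> q (sz x))"
proof -
  assume "fp f"
  then obtain k where "\<forall>x. sz (f x) \<le> (sz x + 2) ^ k" unfolding fp_def by blast
  moreover have "pb (\<lambda>n. (n + 2) ^ k)" by (intro pb_intros)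
  ultimately show ?thesis by blast
qed

text \<open>Values with equal codes are the same data on the tape, so changes of view, such as from
  a number to its bits or from a pair to a nonempty list, cost nothing.\<close>

lemma fp_recode:
  assumes "fp f" "\<And>x. enc (g x) = enc (f x)"
  shows "fp g"
  using assms unfolding fp_def sz_def by simp

lemma fp_comp:
  assumes "fp g" "fp f"
  shows "fp (\<lambda>x. g (f x))"
proof -
  obtain c j where c: "creg c" "\<And>x. sz (f x) \<le> (sz x + 2) ^ j"
    "\<And>x l. big c (st (code (enc x) @ l) [] [] []) ((sz x + 2) ^ j) (st (code (enc (f x)) @ l) [] [] [])"
    using fpE[OF assms(2)] by blast
  obtain d k where d: "creg d" "\<And>x. sz (g x) \<le> (sz x + 2) ^ k"
    "\<And>x l. big d (st (code (enc x) @ l) [] [] []) ((sz x + 2) ^ k) (st (code (enc (g x)) @ l) [] [] [])"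
    using fpE[OF assms(1)] by blast
  show ?thesis
  proof (rule fpI)
    show "creg (c ;; d)" using c d by simp
    show "pb (\<lambda>n. (n + 2) ^ j + ((n + 2) ^ j + 2) ^ k)" by (intro pb_intros)
    show "pb (\<lambda>n. ((n + 2) ^ j + 2) ^ k)" by (intro pb_intros)
    fix x l
    have m: "(sz (f x) + 2) ^ k \<le> ((sz x + 2) ^ j + 2) ^ k"
      using c(2)[of x] by (intro power_mono) auto
    then show "sz (g (f x)) \<le> ((sz x + 2) ^ j + 2) ^ k" using d(2) le_trans by blast
    show "big (c ;; d) (st (code (enc x) @ l) [] [] []) ((sz x + 2) ^ j + ((sz x + 2) ^ j + 2) ^ k)
        (st (code (enc (g (f x))) @ l) [] [] [])"
      using m by (intro big.Seq[OF c(3) d(3)]) auto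
  qed
qed

lemma fp_id: "fp (\<lambda>x. x)"
  by (rule fpI[where c = skip and p = "\<lambda>n. 2" and q = "\<lambda>n. n"])
    (auto intro!: pb_intros big_loop_freeI)

fun pushes :: "bool list \<Rightarrow> cmd" where
  "pushes [] = skip"
| "pushes (b # bs) = pushes bs ;; Push 0 b"

lemma pushes:
  "creg (pushes bs) \<and> loop_free (pushes bs) \<and> eff (pushes bs) (st l x y z) = st (bs @ l) x y z"
  by (induction bs) auto

text \<open>The constant is hard-wired into the program; this is how the transition table of a fixed
  machine enters the reduction.\<close>

lemma fp_const: "fp (\<lambda>x. c)"
proof (rule fpI)
  let ?c = "pushes (code (enc c))"
  show "creg (drop_tree ;; ?c)"
    using pushes[of "code (enc c)"] by (simp add: drop_tree_def move_tree_def move_loop_def clear_def)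
  show "pb (\<lambda>n. (13 * n + 3) + clen ?c)" "pb (\<lambda>n. sz c)" by (intro pb_intros)+
  show "sz c \<le> sz c" ..
  fix x :: 'a and l
  show "big (drop_tree ;; ?c) (st (code (enc x) @ l) [] [] []) ((13 * sz x + 3) + clen ?c)
    (st (code (enc c) @ l) [] [] [])"
    by (rule big.Seq[OF drop_tree big_loop_freeI]) (auto simp: sz_def pushes)
qed

lemma creg_prims: "creg dup" "creg swap" "creg drop_tree" "creg eq_test"
  by (auto simp: dup_def swap_def drop_tree_def move_tree_def move_loop_def clear_def pour_def
      pour_both_def eq_test_def cmp_loop_def)

lemma fp_pair:
  assumes "fp f" "fp g"
  shows "fp (\<lambda>x. (f x, g x))"
proof -
  obtain c j where c: "creg c" "\<And>x. sz (f x) \<le> (sz x + 2) ^ j"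
    "\<And>x l. big c (st (code (enc x) @ l) [] [] []) ((sz x + 2) ^ j) (st (code (enc (f x)) @ l) [] [] [])"
    using fpE[OF assms(1)] by blast
  obtain d k where d: "creg d" "\<And>x. sz (g x) \<le> (sz x + 2) ^ k"
    "\<And>x l. big d (st (code (enc x) @ l) [] [] []) ((sz x + 2) ^ k) (st (code (enc (g x)) @ l) [] [] [])"
    using fpE[OF assms(2)] by blast
  show ?thesis
  proof (rule fpI)
    show "creg (dup ;; d ;; swap ;; c ;; Push 0 True)" using c d creg_prims by simp
    let ?p = "\<lambda>n. (40 * n + 10) + ((n + 2) ^ k + ((20 * (n + 2) ^ k + 20 * n + 10) + ((n + 2) ^ j + 1)))"
    show "pb ?p" by (intro pb_intros)
    show "pb (\<lambda>n. Suc ((n + 2) ^ j + (n + 2) ^ k))" by (intro pb_intros)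
    fix x l
    show "sz (f x, g x) \<le> Suc ((sz x + 2) ^ j + (sz x + 2) ^ k)" using c(2)[of x] d(2)[of x] by simp
    have 1: "big dup (st (code (enc x) @ l) [] [] []) (40 * sz x + 10) (st (code (enc x) @ code (enc x) @ l) [] [] [])"
      using dup unfolding sz_def .
    have 2: "big d (st (code (enc x) @ code (enc x) @ l) [] [] []) ((sz x + 2) ^ k)
        (st (code (enc (g x)) @ code (enc x) @ l) [] [] [])" by (rule d(3))
    have 3: "big swap (st (code (enc (g x)) @ code (enc x) @ l) [] [] []) (20 * (sz x + 2) ^ k + 20 * sz x + 10)
        (st (code (enc x) @ code (enc (g x)) @ l) [] [] [])"
      by (rule big_mono[OF swap]) (use d(2)[of x] in \<open>simp add: sz_def\<close>)
    have 4: "big c (st (code (enc x) @ code (enc (g x)) @ l) [] [] []) ((sz x + 2) ^ j)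
        (st (code (enc (f x)) @ code (enc (g x)) @ l) [] [] [])" by (rule c(3))
    have 5: "big (Push 0 True) (st (code (enc (f x)) @ code (enc (g x)) @ l) [] [] []) 1
        (st (code (enc (f x, g x)) @ l) [] [] [])"
      by (rule big_loop_freeI) (auto simp: enc_prod_def)
    show "big (dup ;; d ;; swap ;; c ;; Push 0 True) (st (code (enc x) @ l) [] [] []) (?p (sz x))
        (st (code (enc (f x, g x)) @ l) [] [] [])"
      by (rule big.Seq[OF 1 big.Seq[OF 2 big.Seq[OF 3 big.Seq[OF 4 5 order_refl] order_refl] order_refl] order_refl])
  qed
qed

lemma fp_fst': "fp fst"
proof (rule fpI)
  show "creg (Pop 0 ;; swap ;; drop_tree)" using creg_prims by simp
  let ?p = "\<lambda>n. 1 + ((20 * n + 20 * n + 10) + (13 * n + 3)) :: nat"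
  show "pb ?p" "pb (\<lambda>n. n)" by (intro pb_intros)+
  fix x :: "'a \<times> 'b" and l
  show "sz (fst x) \<le> sz x" by (simp add: sz_pair)
  have 1: "big (Pop 0) (st (code (enc x) @ l) [] [] []) 1 (st (code (enc (fst x)) @ code (enc (snd x)) @ l) [] [] [])"
    by (rule big_loop_freeI) (auto simp: enc_prod_def)
  have 2: "big swap (st (code (enc (fst x)) @ code (enc (snd x)) @ l) [] [] []) (20 * sz x + 20 * sz x + 10)
      (st (code (enc (snd x)) @ code (enc (fst x)) @ l) [] [] [])"
    by (rule big_mono[OF swap]) (simp add: sz_pair[of x] flip: sz_def)
  have 3: "big drop_tree (st (code (enc (snd x)) @ code (enc (fst x)) @ l) [] [] []) (13 * sz x + 3)
      (st (code (enc (fst x)) @ l) [] [] [])"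
    by (rule big_mono[OF drop_tree]) (simp add: sz_pair[of x] flip: sz_def)
  show "big (Pop 0 ;; swap ;; drop_tree) (st (code (enc x) @ l) [] [] []) (?p (sz x)) (st (code (enc (fst x)) @ l) [] [] [])"
    by (rule big.Seq[OF 1 big.Seq[OF 2 3 order_refl] order_refl])
qed

lemma fp_snd': "fp snd"
proof (rule fpI)
  show "creg (Pop 0 ;; drop_tree)" using creg_prims by simp
  let ?p = "\<lambda>n. 1 + (13 * n + 3) :: nat"
  show "pb ?p" "pb (\<lambda>n. n)" by (intro pb_intros)+
  fix x :: "'a \<times> 'b" and l
  show "sz (snd x) \<le> sz x" by (simp add: sz_pair)
  have 1: "big (Pop 0) (st (code (enc x) @ l) [] [] []) 1 (st (code (enc (fst x)) @ code (enc (snd x)) @ l) [] [] [])"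
    by (rule big_loop_freeI) (auto simp: enc_prod_def)
  have 3: "big drop_tree (st (code (enc (fst x)) @ code (enc (snd x)) @ l) [] [] []) (13 * sz x + 3)
      (st (code (enc (snd x)) @ l) [] [] [])"
    by (rule big_mono[OF drop_tree]) (simp add: sz_pair[of x] flip: sz_def)
  show "big (Pop 0 ;; drop_tree) (st (code (enc x) @ l) [] [] []) (?p (sz x)) (st (code (enc (snd x)) @ l) [] [] [])"
    by (rule big.Seq[OF 1 3 order_refl])
qed

lemmas fp_fst = fp_comp[OF fp_fst'] and fp_snd = fp_comp[OF fp_snd']

lemma fp_if:
  assumes "fp P" "fp f" "fp g"
  shows "fp (\<lambda>x. if P x then f x else g x)"
proof -
  obtain p i where p: "creg p" "\<And>x. sz (P x) \<le> (sz x + 2) ^ i"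
    "\<And>x l. big p (st (code (enc x) @ l) [] [] []) ((sz x + 2) ^ i) (st (code (enc (P x)) @ l) [] [] [])"
    using fpE[OF assms(1)] by blast
  obtain c j where c: "creg c" "\<And>x. sz (f x) \<le> (sz x + 2) ^ j"
    "\<And>x l. big c (st (code (enc x) @ l) [] [] []) ((sz x + 2) ^ j) (st (code (enc (f x)) @ l) [] [] [])"
    using fpE[OF assms(2)] by blast
  obtain d k where d: "creg d" "\<And>x. sz (g x) \<le> (sz x + 2) ^ k"
    "\<And>x l. big d (st (code (enc x) @ l) [] [] []) ((sz x + 2) ^ k) (st (code (enc (g x)) @ l) [] [] [])"
    using fpE[OF assms(3)] by blast
  let ?pops = "Pop 0 ;; Pop 0 ;; Pop 0"
  let ?e = "dup ;; p ;; If 0 is_true (?pops ;; c) (Pop 0 ;; d)"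
  show ?thesis
  proof (rule fpI)
    show "creg ?e" using p c d creg_prims by simp
    let ?p = "\<lambda>n. (40 * n + 10) + ((n + 2) ^ i + (((3 + (n + 2) ^ j) + (1 + (n + 2) ^ k)) + 2)) :: nat"
    show "pb ?p" by (intro pb_intros)
    show "pb (\<lambda>n. (n + 2) ^ j + (n + 2) ^ k)" by (intro pb_intros)
    fix x l
    show "sz (if P x then f x else g x) \<le> (sz x + 2) ^ j + (sz x + 2) ^ k"
      using c(2)[of x] d(2)[of x] by simp
    have 1: "big dup (st (code (enc x) @ l) [] [] []) (40 * sz x + 10) (st (code (enc x) @ code (enc x) @ l) [] [] [])"
      using dup unfolding sz_def .
    have 2: "big p (st (code (enc x) @ code (enc x) @ l) [] [] []) ((sz x + 2) ^ i)
        (st (code (enc (P x)) @ code (enc x) @ l) [] [] [])" by (rule p(3))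
    have 3: "big (If 0 is_true (?pops ;; c) (Pop 0 ;; d)) (st (code (enc (P x)) @ code (enc x) @ l) [] [] [])
        (((3 + (sz x + 2) ^ j) + (1 + (sz x + 2) ^ k)) + 2) (st (code (enc (if P x then f x else g x)) @ l) [] [] [])"
    proof (cases "P x")
      case True
      have "big ?pops (st (code (enc (P x)) @ code (enc x) @ l) [] [] []) 3 (st (code (enc x) @ l) [] [] [])"
        using True by (intro big_loop_freeI) (auto simp: enc_bool_def)
      from big.Seq[OF this c(3) order_refl] show ?thesis using True
        by (intro big.IfT) (auto simp: enc_bool_def)
    next
      case False
      have "big (Pop 0) (st (code (enc (P x)) @ code (enc x) @ l) [] [] []) 1 (st (code (enc x) @ l) [] [] [])"
        using False by (intro big_loop_freeI) (auto simp: enc_bool_def)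
      from big.Seq[OF this d(3) order_refl] show ?thesis using False
        by (intro big.IfF) (auto simp: enc_bool_def)
    qed
    show "big ?e (st (code (enc x) @ l) [] [] []) (?p (sz x)) (st (code (enc (if P x then f x else g x)) @ l) [] [] [])"
      by (rule big.Seq[OF 1 big.Seq[OF 2 3 order_refl] order_refl])
  qed
qed

lemma eq_test:
  "big eq_test (st (code a @ code b @ l) [] [] []) (40 * length (code a) + 40 * length (code b) + 40)
     (st (code (enc (a = b)) @ l) [] [] [])"
proof -
  let ?xs = "rev (code a)" and ?ys = "rev (code b)"
  obtain ys' f where c: "cmp ?xs ?ys [] = (ys', f)" by fastforce
  have len: "length ys' \<le> length (code b)" "length f \<le> length (code a)" using cmp_length[OF c] by auto
  define g where "g = (if ys' = [] then f else True # f)"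
  have g: "g = [] \<longleftrightarrow> a = b" using cmp_Nil[of ?xs ?ys "[]"] c by (auto simp: g_def code_inj)
  have leng: "length g \<le> length (code a) + 1" using len by (auto simp: g_def)
  have 1: "big cmp_loop (st l ?xs ?ys []) (20 * length (code a) + 1) (st l [] ys' f)"
    using cmp_loop[of l ?xs ?ys "[]"] c by simp
  have 2: "big (If 2 nonempty (Push 3 True) skip) (st l [] ys' f) 5 (st l [] ys' g)"
    by (rule big_loop_freeI) (cases ys'; auto simp: g_def)+
  have 3: "big (clear 2) (st l [] ys' g) (3 * length ys' + 1) (st l [] [] g)"
    using clear[of "st l [] ys' g" 2 ys'] by simp
  have 4: "big (If 3 nonempty (Push 0 False) (Push 0 False ;; Push 0 False ;; Push 0 True)) (st l [] [] g) 6
      (st (code (enc (a = b)) @ l) [] [] g)"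
    by (rule big_loop_freeI) (use g in \<open>cases g; auto simp: enc_bool_def\<close>)+
  have 5: "big (clear 3) (st (code (enc (a = b)) @ l) [] [] g) (3 * length g + 1) (st (code (enc (a = b)) @ l) [] [] [])"
    using clear[of "st (code (enc (a = b)) @ l) [] [] g" 3 g] by simp
  show ?thesis unfolding eq_test_def
    by (rule big.Seq[OF move_two big.Seq[OF 1 big.Seq[OF 2 big.Seq[OF 3 big.Seq[OF 4 5 order_refl] order_refl]
      order_refl] order_refl]]) (use len leng in simp)
qed

lemma fp_eq:
  assumes "fp f" "fp g"
  shows "fp (\<lambda>x. f x = g x)"
proof -
  have "fp (\<lambda>p :: 'b \<times> 'b. fst p = snd p)"
  proof (rule fpI)
    show "creg (Pop 0 ;; eq_test)" using creg_prims by simp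
    let ?p = "\<lambda>n. 1 + (40 * n + 40 * n + 40) :: nat"
    show "pb ?p" "pb (\<lambda>n. 3)" by (intro pb_intros)+
    fix x :: "'b \<times> 'b" and l
    show "sz (fst x = snd x) \<le> 3" by (rule sz_bool_le)
    have 1: "big (Pop 0) (st (code (enc x) @ l) [] [] []) 1 (st (code (enc (fst x)) @ code (enc (snd x)) @ l) [] [] [])"
      by (rule big_loop_freeI) (auto simp: enc_prod_def)
    have e: "(enc (fst x) = enc (snd x)) = (fst x = snd x)" using enc_inj by auto
    have 2: "big eq_test (st (code (enc (fst x)) @ code (enc (snd x)) @ l) [] [] []) (40 * sz x + 40 * sz x + 40)
        (st (code (enc (fst x = snd x)) @ l) [] [] [])"
      by (rule big_mono[OF eq_test[of "enc (fst x)" "enc (snd x)" l, unfolded e]])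
        (simp add: sz_pair[of x] flip: sz_def)
    show "big (Pop 0 ;; eq_test) (st (code (enc x) @ l) [] [] []) (?p (sz x)) (st (code (enc (fst x = snd x)) @ l) [] [] [])"
      by (rule big.Seq[OF 1 2 order_refl])
  qed
  from fp_comp[OF this fp_pair[OF assms]] show ?thesis by simp
qed

lemma fp_Cons: "fp f \<Longrightarrow> fp g \<Longrightarrow> fp (\<lambda>x. f x # g x)"
  by (rule fp_recode[OF fp_pair[of f g]]) (auto simp: enc_prod_def)

lemma fp_tl': "fp (tl :: 'a::enc list \<Rightarrow> _)"
proof (rule fpI)
  let ?c = "If 0 is_true (Pop 0 ;; drop_tree) skip"
  show "creg ?c" using creg_prims by simp
  let ?p = "\<lambda>n. 1 + (13 * n + 3) + 4 :: nat"
  show "pb ?p" "pb (\<lambda>n. n)" by (intro pb_intros)+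
  fix x :: "'a list" and l
  show "sz (tl x) \<le> sz x" by (cases x) auto
  show "big ?c (st (code (enc x) @ l) [] [] []) (?p (sz x)) (st (code (enc (tl x)) @ l) [] [] [])"
  proof (cases x)
    case Nil
    then show ?thesis by (intro big.IfF[where t = 2] big_loop_freeI) auto
  next
    case (Cons a y)
    have 1: "big (Pop 0) (st (code (enc x) @ l) [] [] []) 1 (st (code (enc a) @ code (enc y) @ l) [] [] [])"
      by (rule big_loop_freeI) (auto simp: Cons)
    have 2: "big drop_tree (st (code (enc a) @ code (enc y) @ l) [] [] []) (13 * sz x + 3)
        (st (code (enc (tl x)) @ l) [] [] [])"
      using big_mono[OF drop_tree[of "enc a" "code (enc y) @ l"], of "13 * sz x + 3"]
      by (simp add: Cons sz_def)
    show ?thesis by (rule big.IfT[OF _ big.Seq[OF 1 2 order_refl]]) (auto simp: Cons)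
  qed
qed

lemma fp_hd': "fp (hd :: 'a::enc list \<Rightarrow> _)"
proof (rule fpI)
  \<comment> \<open>The value of \<open>hd []\<close> is unspecified but fixed, so its code can be
    hard-wired.\<close>
  let ?k = "hd [] :: 'a" let ?d = "Pop 0 ;; pushes (code (enc ?k))"
  let ?c = "If 0 is_true (Pop 0 ;; swap ;; drop_tree) ?d"
  show "creg ?c" using creg_prims pushes[of "code (enc ?k)"] by simp
  let ?p = "\<lambda>n. (1 + ((20 * n + 20 * n + 10) + (13 * n + 3))) + clen ?d + 2 :: nat"
  show "pb ?p" "pb (\<lambda>n. n + sz ?k)" by (intro pb_intros)+
  fix x :: "'a list" and l
  show "sz (hd x) \<le> sz x + sz ?k" by (cases x) auto
  show "big ?c (st (code (enc x) @ l) [] [] []) (?p (sz x)) (st (code (enc (hd x)) @ l) [] [] [])"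
  proof (cases x)
    case Nil
    have "big ?d (st (code (enc x) @ l) [] [] []) (clen ?d) (st (code (enc (hd x)) @ l) [] [] [])"
      using pushes[of "code (enc ?k)" l "[]" "[]" "[]"] Nil by (intro big_loop_freeI) auto
    then show ?thesis using Nil by (intro big.IfF[where t = "clen ?d"]) auto
  next
    case (Cons a y)
    have 1: "big (Pop 0) (st (code (enc x) @ l) [] [] []) 1 (st (code (enc a) @ code (enc y) @ l) [] [] [])"
      by (rule big_loop_freeI) (auto simp: Cons)
    have 2: "big swap (st (code (enc a) @ code (enc y) @ l) [] [] []) (20 * sz x + 20 * sz x + 10)
        (st (code (enc y) @ code (enc a) @ l) [] [] [])"
      by (rule big_mono[OF swap]) (simp add: Cons flip: sz_def)
    have 3: "big drop_tree (st (code (enc y) @ code (enc a) @ l) [] [] []) (13 * sz x + 3)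
        (st (code (enc (hd x)) @ l) [] [] [])"
      using big_mono[OF drop_tree[of "enc y" "code (enc a) @ l"], of "13 * sz x + 3"]
      by (simp add: Cons sz_def)
    from big.Seq[OF 1 big.Seq[OF 2 3 order_refl] order_refl] show ?thesis using Cons
      by (intro big.IfT) auto
  qed
qed

lemmas fp_hd = fp_comp[OF fp_hd'] and fp_tl = fp_comp[OF fp_tl']

lemma length_le_sz: "length xs \<le> sz xs"
  by (induction xs) auto

lemma sz_member: "a \<in> set xs \<Longrightarrow> sz a \<le> sz xs"
  by (induction xs) auto

text \<open>Iterating a polynomial-time step may double the accumulator in each round, hence the
  premise that bounds all intermediate accumulators.\<close>

lemma fp_foldl:
  fixes L :: "'c::enc \<Rightarrow> 'a::enc list" and init :: "'c \<Rightarrow> 'b::enc"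
  assumes L: "fp L" and init: "fp init"
    and g: "fp (\<lambda>q :: 'c \<times> 'a \<times> 'b. g (fst q) (fst (snd q)) (snd (snd q)))"
    and q: "pb q" and bound: "\<And>x i. sz (foldl (\<lambda>acc a. g x a acc) (init x) (take i (L x))) \<le> q (sz x)"
  shows "fp (\<lambda>x. foldl (\<lambda>acc a. g x a acc) (init x) (L x))"
proof -
  let ?S = "\<lambda>p :: 'a list \<times> ('c \<times> 'b). (tl (fst p), (fst (snd p), g (fst (snd p)) (hd (fst p)) (snd (snd p))))"
  have g': "fp (\<lambda>p :: 'a list \<times> ('c \<times> 'b). g (fst (snd p)) (hd (fst p)) (snd (snd p)))"
    using fp_comp[OF g, of "\<lambda>p. (fst (snd p), hd (fst p), snd (snd p))"]
    by (simp add: fp_pair fp_fst fp_snd fp_hd fp_id)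
  have "fp ?S" by (intro fp_pair fp_tl fp_fst fp_snd fp_id g')
  then obtain c k where c: "creg c"
    "\<And>x l. big c (st (code (enc x) @ l) [] [] []) ((sz x + 2) ^ k) (st (code (enc (?S x)) @ l) [] [] [])"
    unfolding fp_def by blast
  have "fp (\<lambda>x. (L x, (x, init x)))" by (intro fp_pair fp_id assms)
  then obtain d j where d: "creg d" "\<And>x. sz (L x, (x, init x)) \<le> (sz x + 2) ^ j"
    "\<And>x l. big d (st (code (enc x) @ l) [] [] []) ((sz x + 2) ^ j) (st (code (enc (L x, (x, init x))) @ l) [] [] [])"
    unfolding fp_def by blast
  \<comment> \<open>The leading bit of the remaining list says whether an element is left, so the
    bit of the enclosing pair is stripped between rounds and restored for the body.\<close>
  let ?W = "While 0 is_true (Push 0 True ;; c ;; Pop 0)"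
  have loop: "big ?W (st (code (enc ls) @ code (enc (x, acc)) @ l) [] [] [])
      (length ls * ((A + (sz x + B) + 4) ^ k + 4) + 1)
      (st (False # code (enc (x, foldl (\<lambda>acc a. g x a acc) acc ls)) @ l) [] [] [])"
    if "\<And>i. sz (foldl (\<lambda>acc a. g x a acc) acc (take i ls)) \<le> B" "sz ls \<le> A" for ls x acc A B l
    using that
  proof (induction ls arbitrary: acc)
    case Nil
    then show ?case by (auto intro!: big.WhileF)
  next
    case (Cons a ls)
    let ?acc = "g x a acc" and ?T = "(A + (sz x + B) + 4) ^ k"
    have 1: "big (Push 0 True) (st (code (enc (a # ls)) @ code (enc (x, acc)) @ l) [] [] []) 1
        (st (code (enc (a # ls, (x, acc))) @ l) [] [] [])"
      by (rule big_loop_freeI) (auto simp: enc_prod_def)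
    have "sz acc \<le> B" using Cons.prems(1)[of 0] by simp
    then have "sz (a # ls, (x, acc)) + 2 \<le> A + (sz x + B) + 4" using Cons.prems(2) by simp
    then have T: "(sz (a # ls, (x, acc)) + 2) ^ k \<le> ?T" by (rule power_mono) simp
    have 2: "big c (st (code (enc (a # ls, (x, acc))) @ l) [] [] []) ?T (st (code (enc (ls, (x, ?acc))) @ l) [] [] [])"
      using big_mono[OF c(2)[of "(a # ls, (x, acc))" l] T] by simp
    have 3: "big (Pop 0) (st (code (enc (ls, (x, ?acc))) @ l) [] [] []) 1
        (st (code (enc ls) @ code (enc (x, ?acc)) @ l) [] [] [])"
      by (rule big_loop_freeI) (auto simp: enc_prod_def)
    have body: "big (Push 0 True ;; c ;; Pop 0) (st (code (enc (a # ls)) @ code (enc (x, acc)) @ l) [] [] [])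
        (1 + (?T + 1)) (st (code (enc ls) @ code (enc (x, ?acc)) @ l) [] [] [])"
      by (rule big.Seq[OF 1 big.Seq[OF 2 3 order_refl] order_refl])
    have "sz (foldl (\<lambda>acc a. g x a acc) ?acc (take i ls)) \<le> B" for i
      using Cons.prems(1)[of "Suc i"] by simp
    from Cons.IH[of ?acc, OF this] Cons.prems(2)
    have "big ?W (st (code (enc ls) @ code (enc (x, ?acc)) @ l) [] [] []) (length ls * (?T + 4) + 1)
      (st (False # code (enc (x, foldl (\<lambda>acc a. g x a acc) acc (a # ls))) @ l) [] [] [])" by simp
    then show ?case by (intro big.WhileT[OF _ body]) auto
  qed
  have "fp (\<lambda>x. (x, foldl (\<lambda>acc a. g x a acc) (init x) (L x)))"
  proof (rule fpI)
    show "creg (d ;; Pop 0 ;; ?W ;; Pop 0)" using c d by simp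
    let ?A = "\<lambda>n. (n + 2) ^ j"
    let ?p = "\<lambda>n. (n + 2) ^ j + (1 + ((?A n * ((?A n + (n + q n) + 4) ^ k + 4) + 1) + 1)) :: nat"
    show "pb ?p" by (intro pb_intros q)
    show "pb (\<lambda>n. Suc (n + q n))" by (intro pb_intros q)
    fix x l
    let ?r = "foldl (\<lambda>acc a. g x a acc) (init x) (L x)"
    show "sz (x, ?r) \<le> Suc (sz x + q (sz x))" using bound[of x "length (L x)"] by simp
    have 1: "big (Pop 0) (st (code (enc (L x, (x, init x))) @ l) [] [] []) 1
        (st (code (enc (L x)) @ code (enc (x, init x)) @ l) [] [] [])"
      by (rule big_loop_freeI) (auto simp: enc_prod_def)
    have A: "sz (L x) \<le> ?A (sz x)" using d(2)[of x] by simp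
    then have "length (L x) \<le> ?A (sz x)" using length_le_sz le_trans by blast
    then have 2: "big ?W (st (code (enc (L x)) @ code (enc (x, init x)) @ l) [] [] [])
        (?A (sz x) * ((?A (sz x) + (sz x + q (sz x)) + 4) ^ k + 4) + 1)
        (st (False # code (enc (x, ?r)) @ l) [] [] [])"
      by (intro big_mono[OF loop[OF bound A]]) auto
    have 3: "big (Pop 0) (st (False # code (enc (x, ?r)) @ l) [] [] []) 1 (st (code (enc (x, ?r)) @ l) [] [] [])"
      by (rule big_loop_freeI) auto
    show "big (d ;; Pop 0 ;; ?W ;; Pop 0) (st (code (enc x) @ l) [] [] []) (?p (sz x)) (st (code (enc (x, ?r)) @ l) [] [] [])"
      by (rule big.Seq[OF d(3) big.Seq[OF 1 big.Seq[OF 2 3 order_refl] order_refl] order_refl])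
  qed
  from fp_snd[OF this] show ?thesis by simp
qed

text \<open>The increment per round depends on the input but not on the accumulator, so sizes stay
  below the initial one plus length times increment.\<close>

lemma fp_foldl_grow:
  fixes L :: "'c::enc \<Rightarrow> 'a::enc list" and init :: "'c \<Rightarrow> 'b::enc"
  assumes L: "fp L" and init: "fp init"
    and g: "fp (\<lambda>q :: 'c \<times> 'a \<times> 'b. g (fst q) (fst (snd q)) (snd (snd q)))"
    and r: "pb r" and grow: "\<And>x a acc. a \<in> set (L x) \<Longrightarrow> sz (g x a acc) \<le> sz acc + r (sz x)"
  shows "fp (\<lambda>x. foldl (\<lambda>acc a. g x a acc) (init x) (L x))"
proof -
  obtain p where p: "pb p" "\<And>x. sz (L x) \<le> p (sz x)" using fp_sz[OF L] by blast
  obtain u where u: "pb u" "\<And>x. sz (init x) \<le> u (sz x)" using fp_sz[OF init] by blast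
  have *: "sz (foldl (\<lambda>acc a. g x a acc) acc ls) \<le> sz acc + length ls * r (sz x)"
    if "set ls \<subseteq> set (L x)" for x acc ls
    using that
  proof (induction ls arbitrary: acc)
    case (Cons a ls)
    then have "sz (foldl (\<lambda>acc a. g x a acc) (g x a acc) ls) \<le> sz (g x a acc) + length ls * r (sz x)" by simp
    moreover have "sz (g x a acc) \<le> sz acc + r (sz x)" using Cons.prems grow by simp
    ultimately show ?case by simp
  qed simp
  show ?thesis
  proof (rule fp_foldl[OF L init g])
    show "pb (\<lambda>n. u n + p n * r n)" by (intro pb_intros p u r)
    fix x i
    have "length (take i (L x)) \<le> p (sz x)"
      using length_le_sz[of "L x"] p(2)[of x] by simp
    then have "length (take i (L x)) * r (sz x) \<le> p (sz x) * r (sz x)" by (rule mult_right_mono) simp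
    then show "sz (foldl (\<lambda>acc a. g x a acc) (init x) (take i (L x))) \<le> u (sz x) + p (sz x) * r (sz x)"
      using *[of "take i (L x)" x "init x"] u(2)[of x] set_take_subset[of i "L x"] by linarith
  qed
qed

subsection \<open>Boolean operations and lists\<close>

lemma fp_conj: "fp P \<Longrightarrow> fp Q \<Longrightarrow> fp (\<lambda>x. P x \<and> Q x)"
  by (rule fp_recode[OF fp_if[of P Q "\<lambda>x. False"]]) (auto intro: fp_const)

lemma fp_disj: "fp P \<Longrightarrow> fp Q \<Longrightarrow> fp (\<lambda>x. P x \<or> Q x)"
  by (rule fp_recode[OF fp_if[of P "\<lambda>x. True" Q]]) (auto intro: fp_const)

lemma fp_not: "fp P \<Longrightarrow> fp (\<lambda>x. \<not> P x)"
  by (rule fp_recode[OF fp_if[of P "\<lambda>x. False" "\<lambda>x. True"]]) (auto intro: fp_const)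

lemma fp_imp: "fp P \<Longrightarrow> fp Q \<Longrightarrow> fp (\<lambda>x. P x \<longrightarrow> Q x)"
  by (rule fp_recode[OF fp_if[of P Q "\<lambda>x. True"]]) (auto intro: fp_const)

lemma foldl_Cons: "foldl (\<lambda>acc a. f a # acc) ys xs = rev (map f xs) @ ys"
  by (induction xs arbitrary: ys) auto

lemma sz_append: "Suc (sz (xs @ ys)) = sz xs + sz ys"
  by (induction xs) auto

lemma sz_rev: "sz (rev xs) = sz xs"
proof (induction xs)
  case (Cons a xs)
  then show ?case using sz_append[of "rev xs" "[a]"] by simp
qed simp

lemma sz_fst: "sz (fst p) < sz p" and sz_snd: "sz (snd p) < sz p"
  by (auto simp: sz_pair[of p])

lemma fp_rev: "fp L \<Longrightarrow> fp (\<lambda>x. rev (L x))"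
proof -
  have "fp (\<lambda>x :: 'b list. foldl (\<lambda>acc a. a # acc) [] x)"
    by (rule fp_foldl_grow[where r = "\<lambda>n. Suc n"])
      (auto intro!: fp_id fp_const fp_Cons fp_fst fp_snd pb_intros dest: sz_member)
  then have "fp (rev :: 'b list \<Rightarrow> _)" by (rule fp_recode) (simp add: foldl_Cons[of "\<lambda>a. a", simplified])
  then show "fp L \<Longrightarrow> fp (\<lambda>x. rev (L x))" by (rule fp_comp)
qed

lemma fp_append: "fp L \<Longrightarrow> fp K \<Longrightarrow> fp (\<lambda>x. L x @ K x)"
proof -
  assume L: "fp L" "fp K"
  have "fp (\<lambda>p :: 'b list \<times> 'b list. foldl (\<lambda>acc a. a # acc) (snd p) (rev (fst p)))"
  proof (rule fp_foldl_grow[where r = "\<lambda>n. Suc n"])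
    fix x :: "'b list \<times> 'b list" and a acc
    assume "a \<in> set (rev (fst x))"
    then have "sz a \<le> sz (rev (fst x))" by (rule sz_member)
    then show "sz (a # acc) \<le> sz acc + Suc (sz x)" using sz_fst[of x] by (simp add: sz_rev)
  qed (intro fp_id fp_const fp_Cons fp_fst fp_snd fp_rev pb_intros)+
  then have "fp (\<lambda>p :: 'b list \<times> 'b list. fst p @ snd p)"
    by (rule fp_recode) (simp add: foldl_Cons[of "\<lambda>a. a", simplified])
  from fp_comp[OF this fp_pair[OF L]] show ?thesis by simp
qed

lemma fp_map:
  fixes L :: "'c::enc \<Rightarrow> 'a::enc list" and g :: "'c \<Rightarrow> 'a \<Rightarrow> 'b::enc"
  assumes L: "fp L" and g: "fp (\<lambda>q. g (fst q) (snd q))"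
  shows "fp (\<lambda>x. map (g x) (L x))"
proof -
  obtain p where p: "pb p" "\<And>x. sz (L x) \<le> p (sz x)" using fp_sz[OF L] by blast
  obtain k where k: "\<And>q. sz (g (fst q) (snd q)) \<le> (sz q + 2) ^ k" using g unfolding fp_def by blast
  have "fp (\<lambda>x. foldl (\<lambda>acc a. g x a # acc) [] (L x))"
  proof (rule fp_foldl_grow[where r = "\<lambda>n. Suc ((Suc (n + p n) + 2) ^ k)"])
    have "fp (\<lambda>q :: 'c \<times> 'a \<times> 'b list. g (fst q) (fst (snd q)))"
      using fp_comp[OF g fp_pair[OF fp_fst[OF fp_id] fp_fst[OF fp_snd[OF fp_id]]]] by simp
    then show "fp (\<lambda>q :: 'c \<times> 'a \<times> 'b list. g (fst q) (fst (snd q)) # snd (snd q))"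
      by (intro fp_Cons fp_snd fp_id)
    show "pb (\<lambda>n. Suc ((Suc (n + p n) + 2) ^ k))" by (intro pb_intros p)
    fix x a and acc :: "'b list"
    assume "a \<in> set (L x)"
    then have "sz a \<le> p (sz x)" using sz_member p(2) le_trans by blast
    then have "(sz (x, a) + 2) ^ k \<le> (Suc (sz x + p (sz x)) + 2) ^ k" by (intro power_mono) auto
    then show "sz (g x a # acc) \<le> sz acc + Suc ((Suc (sz x + p (sz x)) + 2) ^ k)"
      using k[of "(x, a)"] by simp
  qed (intro L fp_const)+
  from fp_rev[OF this] show ?thesis by (simp add: foldl_Cons)
qed

lemma fp_concat: "fp L \<Longrightarrow> fp (\<lambda>x. concat (L x))"
proof -
  have *: "foldl (\<lambda>acc a. acc @ a) ys xs = ys @ concat xs" for ys and xs :: "'b list list"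
    by (induction xs arbitrary: ys) auto
  have "fp (\<lambda>x :: 'b list list. foldl (\<lambda>acc a. acc @ a) [] x)"
  proof (rule fp_foldl_grow[where r = "\<lambda>n. n"])
    fix x :: "'b list list" and a acc
    assume "a \<in> set x"
    then show "sz (acc @ a) \<le> sz acc + sz x" using sz_member[of a x] sz_append[of acc a] by simp
  qed (intro fp_id fp_const fp_append fp_fst fp_snd pb_intros)+
  then have "fp (concat :: 'b list list \<Rightarrow> _)" by (rule fp_recode) (simp add: *)
  then show "fp L \<Longrightarrow> fp (\<lambda>x. concat (L x))" by (rule fp_comp)
qed

lemma fp_filter:
  assumes "fp L" "fp (\<lambda>q. P (fst q) (snd q))"
  shows "fp (\<lambda>x. filter (P x) (L x))"
proof -
  have "filter Q xs = concat (map (\<lambda>a. if Q a then [a] else []) xs)" for Q and xs :: "'b list"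
    by (induction xs) auto
  then show ?thesis
    by (simp only:) (intro fp_concat fp_map fp_if assms fp_Cons fp_snd fp_id fp_const)
qed

lemma fp_ball:
  assumes "fp L" "fp (\<lambda>q. P (fst q) (snd q))"
  shows "fp (\<lambda>x. \<forall>a \<in> set (L x). P x a)"
proof -
  have *: "foldl (\<lambda>acc a. acc \<and> Q a) b xs \<longleftrightarrow> b \<and> (\<forall>a \<in> set xs. Q a)" for Q b and xs :: "'b list"
    by (induction xs arbitrary: b) auto
  have "fp (\<lambda>x. foldl (\<lambda>acc a. acc \<and> P x a) True (L x))"
  proof (rule fp_foldl_grow[where r = "\<lambda>n. 3"])
    show "fp (\<lambda>q :: 'a \<times> 'b \<times> bool. snd (snd q) \<and> P (fst q) (fst (snd q)))"
      using fp_conj[OF fp_snd[OF fp_snd[OF fp_id]]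
          fp_comp[OF assms(2) fp_pair[OF fp_fst[OF fp_id] fp_fst[OF fp_snd[OF fp_id]]]]] by simp
    show "sz (acc \<and> P x a) \<le> sz acc + 3" for x a acc using sz_bool_le trans_le_add2 by blast
  qed (intro assms fp_const pb_intros)+
  then show ?thesis by (simp add: *)
qed

lemma fp_bex:
  assumes "fp L" "fp (\<lambda>q. P (fst q) (snd q))"
  shows "fp (\<lambda>x. \<exists>a \<in> set (L x). P x a)"
proof -
  have "fp (\<lambda>x. \<not> (\<forall>a \<in> set (L x). \<not> P x a))" by (intro fp_not fp_ball assms)
  then show ?thesis by simp
qed

lemma fp_member: "fp f \<Longrightarrow> fp L \<Longrightarrow> fp (\<lambda>x. f x \<in> set (L x))"
proof -
  assume *: "fp f" "fp L"
  have "fp (\<lambda>x. \<exists>a \<in> set (L x). a = f x)"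
    by (intro fp_bex fp_eq fp_snd fp_id * fp_comp[OF *(1) fp_fst[OF fp_id]])
  then show ?thesis by (rule fp_recode) (auto simp: Bex_def)
qed

lemma fp_zip: "fp L \<Longrightarrow> fp K \<Longrightarrow> fp (\<lambda>x. zip (L x) (K x))"
proof -
  assume L: "fp L" "fp K"
  let ?g = "\<lambda>a acc :: 'c list \<times> ('b \<times> 'c) list.
    if fst acc = [] then acc else (tl (fst acc), (a, hd (fst acc)) # snd acc)"
  have *: "snd (foldl (\<lambda>acc a. ?g a acc) (ys, zs) xs) = rev (zip xs ys) @ zs" for xs ys zs
  proof (induction xs arbitrary: ys zs)
    case (Cons x xs)
    show ?case
    proof (cases ys)
      case Nil
      then show ?thesis using Cons.IH[of "[]" zs] by simp
    next
      case (Cons y ys')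
      then show ?thesis using Cons.IH[of ys' "(x, y) # zs"] by simp
    qed
  qed simp
  have "fp (\<lambda>p :: 'b list \<times> 'c list. foldl (\<lambda>acc a. ?g a acc) (snd p, []) (fst p))"
  proof (rule fp_foldl_grow[where r = "\<lambda>n. n + 2" and g = "\<lambda>x. ?g"])
    fix x :: "'b list \<times> 'c list" and a and acc :: "'c list \<times> ('b \<times> 'c) list"
    assume "a \<in> set (fst x)"
    then have "sz a \<le> sz x" using sz_member[of a "fst x"] sz_fst[of x] by simp
    then show "sz (?g a acc) \<le> sz acc + (sz x + 2)"
      by (cases acc; cases "fst acc") auto
  qed (intro fp_id fp_const fp_if fp_eq fp_pair fp_Cons fp_tl fp_hd fp_fst fp_snd pb_intros)+
  then have "fp (\<lambda>p :: 'b list \<times> 'c list. rev (snd (foldl (\<lambda>acc a. ?g a acc) (snd p, []) (fst p))))"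
    by (intro fp_rev fp_snd)
  then have "fp (\<lambda>p :: 'b list \<times> 'c list. zip (fst p) (snd p))" unfolding * by simp
  from fp_comp[OF this fp_pair[OF L]] show ?thesis by simp
qed

lemma fp_drop_length: "fp L \<Longrightarrow> fp K \<Longrightarrow> fp (\<lambda>x. drop (length (K x)) (L x))"
proof -
  assume L: "fp L" "fp K"
  have *: "foldl (\<lambda>acc a. tl acc) ys xs = drop (length xs) ys" for ys :: "'b list" and xs :: "'c list"
    by (induction xs arbitrary: ys) (auto simp: drop_Suc)
  have "fp (\<lambda>x. foldl (\<lambda>acc a. tl acc) (L x) (K x))"
  proof (rule fp_foldl_grow[where r = "\<lambda>n. 0" and g = "\<lambda>x a. tl"])
    show "sz (tl acc) \<le> sz acc + 0" for acc :: "'b list" by (cases acc) auto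
  qed (intro L fp_tl fp_snd fp_id pb_intros)+
  then show ?thesis by (simp add: *)
qed

subsection \<open>Binary arithmetic\<close>

lemma bits_0 [simp]: "bits 0 = []"
  by (subst bits.simps) simp

lemma bits_pos: "n \<noteq> 0 \<Longrightarrow> bits n = odd n # bits (n div 2)"
  by (subst bits.simps) simp

lemma bits_eq_Nil [simp]: "bits n = [] \<longleftrightarrow> n = 0"
  by (subst bits.simps) simp

definition snoc_bit :: "nat \<Rightarrow> bool \<Rightarrow> nat" where
  "snoc_bit n b = 2 * n + of_bool b"

lemma bits_snoc_bit: "bits (snoc_bit n b) = (if n = 0 \<and> \<not> b then [] else b # bits n)"
  by (cases b) (auto simp: snoc_bit_def bits_pos)

lemma sz_nat: "sz (n :: nat) = sz (bits n)"
  by (simp add: sz_def enc_nat_def)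

lemma fp_bits: "fp f \<Longrightarrow> fp (\<lambda>x. bits (f x))"
  by (rule fp_recode[of f]) (auto simp: enc_nat_def)

lemma fp_of_bits: "fp (\<lambda>x. bits (f x)) \<Longrightarrow> fp f"
  by (rule fp_recode[of "\<lambda>x. bits (f x)"]) (auto simp: enc_nat_def)

lemma fp_odd: "fp f \<Longrightarrow> fp (\<lambda>x. odd (f x :: nat))"
proof -
  assume f: "fp f"
  have "fp (\<lambda>x. f x \<noteq> 0 \<and> hd (bits (f x)))"
    by (intro fp_conj fp_not fp_eq fp_hd fp_bits f fp_const)
  moreover have "odd n \<longleftrightarrow> n \<noteq> 0 \<and> hd (bits n)" for n by (cases "n = 0") (auto simp: bits_pos)
  ultimately show ?thesis by simp
qed

lemma fp_div2: "fp f \<Longrightarrow> fp (\<lambda>x. f x div 2 :: nat)"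
proof -
  assume f: "fp f"
  have "bits (n div 2) = tl (bits n)" for n by (cases "n = 0") (auto simp: bits_pos)
  then show ?thesis using f by (intro fp_of_bits) (auto intro: fp_tl fp_bits)
qed

lemma fp_snoc_bit: "fp f \<Longrightarrow> fp P \<Longrightarrow> fp (\<lambda>x. snoc_bit (f x) (P x))"
proof (rule fp_of_bits)
  assume *: "fp f" "fp P"
  show "fp (\<lambda>x. bits (snoc_bit (f x) (P x)))"
    unfolding bits_snoc_bit by (intro fp_if fp_conj fp_eq fp_const fp_not fp_Cons fp_bits *)
qed

lemma sz_snoc_bit: "sz (snoc_bit n b) \<le> sz n + 4"
  unfolding sz_nat bits_snoc_bit using sz_bool_le[of b] by auto

lemma sz_div2: "sz (n div 2 :: nat) \<le> sz n"
  by (cases "n = 0") (auto simp: sz_nat bits_pos)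

lemma foldl_snoc_bit: "foldl snoc_bit 0 (rev bs) = val bs"
  by (induction bs) (auto simp: snoc_bit_def)

lemma fp_val: "fp f \<Longrightarrow> fp (\<lambda>x. val (f x))"
proof -
  assume f: "fp f"
  have "fp (\<lambda>x. foldl (\<lambda>acc a. snoc_bit acc a) 0 (rev (f x)))"
    by (rule fp_foldl_grow[where r = "\<lambda>n. 4" and g = "\<lambda>x a acc. snoc_bit acc a"])
      (intro fp_rev f fp_const fp_snoc_bit fp_snd fp_fst fp_id pb_intros sz_snoc_bit)+
  then show ?thesis by (simp add: foldl_snoc_bit)
qed

lemma bits_bound: "n < 2 ^ length (bits n)"
proof (induction n rule: less_induct)
  case (less n)
  show ?case
  proof (cases "n = 0")
    case False
    then have "n div 2 < 2 ^ length (bits (n div 2))" using less by simp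
    then show ?thesis using False by (simp add: bits_pos)
  qed simp
qed

lemma length_bits_le: "n < 2 ^ k \<Longrightarrow> length (bits n) \<le> k"
proof (induction k arbitrary: n)
  case (Suc k)
  show ?case
  proof (cases "n = 0")
    case False
    have "length (bits (n div 2)) \<le> k" using Suc by (intro Suc.IH) auto
    then show ?thesis using False by (simp add: bits_pos)
  qed simp
qed simp

lemma sz_bools_le: "sz (bs :: bool list) \<le> 4 * length bs + 1"
proof (induction bs)
  case (Cons b bs)
  then show ?case using sz_bool_le[of b] by simp
qed simp

lemma sz_nat_le: "n < 2 ^ k \<Longrightarrow> sz n \<le> 4 * k + 1" for n :: nat
  using sz_bools_le[of "bits n"] length_bits_le[of n k] by (simp add: sz_nat)

lemma sz_nat_le_self: "sz n \<le> 4 * n + 1" for n :: nat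
  by (rule sz_nat_le) (rule less_exp)

lemma less_sz: "n < 2 ^ sz n" for n :: nat
  using bits_bound[of n] length_le_sz[of "bits n"]
  by (metis less_le_trans one_le_numeral power_increasing sz_nat)

type_synonym add_state = "nat \<times> nat \<times> bool \<times> bool list"

text \<open>School addition from the lowest bit: what is left of the two numbers, the carry, and the
  digits found so far, latest first.\<close>

definition add_step :: "add_state \<Rightarrow> add_state" where
  "add_step = (\<lambda>(m, n, c, out). (m div 2, n div 2, (odd m \<and> odd n) \<or> (c \<and> (odd m \<or> odd n)),
     ((odd m \<noteq> odd n) \<noteq> c) # out))"

definition sum_of :: "add_state \<Rightarrow> nat" where
  "sum_of = (\<lambda>(m, n, c, out). m + n + of_bool c)"

lemma sum_of_add_step: "sum_of (add_step s) = sum_of s div 2"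
proof -
  obtain m n c out where s: "s = (m, n, c, out)" by (cases s) auto
  have "m = 2 * (m div 2) + of_bool (odd m)" "n = 2 * (n div 2) + of_bool (odd n)" by simp_all
  then obtain m' n' a b where mn: "m = 2 * m' + of_bool a" "n = 2 * n' + of_bool b" by blast
  show ?thesis unfolding s mn by (cases a; cases b; cases c) (auto simp: add_step_def sum_of_def)
qed

lemma snd_add_step: "snd (snd (snd (add_step s))) = odd (sum_of s) # snd (snd (snd s))"
  by (cases s) (auto simp: add_step_def sum_of_def)

text \<open>Invariant of the addition: putting the emitted digits back below what remains to be
  added restores the original sum.\<close>

lemma add_iterate:
  "foldl snoc_bit (sum_of ((add_step ^^ i) s)) (snd (snd (snd ((add_step ^^ i) s)))) =
   foldl snoc_bit (sum_of s) (snd (snd (snd s)))"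
proof (induction i)
  case (Suc i)
  have "snoc_bit (n div 2) (odd n) = n" for n by (simp add: snoc_bit_def)
  then show ?case using Suc by (simp add: sum_of_add_step snd_add_step)
qed simp

lemma sum_of_iterate: "sum_of ((add_step ^^ i) s) = sum_of s div 2 ^ i"
  by (induction i) (auto simp: sum_of_add_step div_mult2_eq[symmetric] mult.commute)

lemma foldl_const: "foldl (\<lambda>acc a. f acc) s xs = (f ^^ length xs) s"
  by (induction xs arbitrary: s) (auto simp: funpow_swap1)

text \<open>The list serves as a clock for the loops below: after as many rounds every bit of both
  numbers and of their sum has been shifted out.\<close>

lemma sum_lt_pow: "m + n < 2 ^ length (True # bits m @ bits n)"
proof -
  have "m < 2 ^ (length (bits m) + length (bits n))" "n < 2 ^ (length (bits m) + length (bits n))"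
    using bits_bound[of m] bits_bound[of n]
    by (meson le_add1 le_add2 less_le_trans one_le_numeral power_increasing)+
  then show ?thesis by simp
qed

lemma fp_add:
  assumes "fp f" "fp g" shows "fp (\<lambda>x. f x + g x :: nat)"
proof -
  let ?L = "\<lambda>p :: nat \<times> nat. True # bits (fst p) @ bits (snd p)"
  let ?F = "\<lambda>p :: nat \<times> nat. foldl (\<lambda>acc a. add_step acc) (fst p, snd p, False, []) (?L p)"
  have "fp ?F"
  proof (rule fp_foldl_grow[where r = "\<lambda>n. 20" and g = "\<lambda>x a acc. add_step acc"])
    show "fp (\<lambda>q :: (nat \<times> nat) \<times> bool \<times> add_state. add_step (snd (snd q)))"
      unfolding add_step_def case_prod_beta
      by (intro fp_pair fp_div2 fp_disj fp_conj fp_not fp_Cons fp_eq fp_odd fp_fst fp_snd fp_id)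
    fix acc :: add_state
    obtain m n c out where acc: "acc = (m, n, c, out)" by (cases acc) auto
    show "sz (add_step acc) \<le> sz acc + 20" unfolding acc add_step_def
      using sz_div2[of m] sz_div2[of n] sz_bool_le[of "(odd m \<and> odd n) \<or> (c \<and> (odd m \<or> odd n))"]
        sz_bool_le[of "(odd m \<noteq> odd n) \<noteq> c"] by simp
  qed (intro fp_pair fp_const fp_Cons fp_append fp_bits fp_fst fp_snd fp_id pb_intros)+
  then have "fp (\<lambda>p. val (rev (snd (snd (snd (?F p))))))" by (intro fp_val fp_rev fp_snd)
  moreover have "val (rev (snd (snd (snd (?F p))))) = fst p + snd p" for p
  proof -
    let ?s = "(fst p, snd p, False, []) :: add_state" and ?i = "length (?L p)"
    have "sum_of ((add_step ^^ ?i) ?s) = 0"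
      using sum_lt_pow[of "fst p" "snd p"] unfolding sum_of_iterate by (simp add: sum_of_def)
    then have "foldl snoc_bit 0 (snd (snd (snd ((add_step ^^ ?i) ?s)))) = fst p + snd p"
      using add_iterate[of ?i ?s] by (simp add: sum_of_def)
    then show ?thesis by (simp only: foldl_const foldl_snoc_bit[symmetric] rev_rev_ident)
  qed
  ultimately have "fp (\<lambda>p :: nat \<times> nat. fst p + snd p)" by simp
  from fp_comp[OF this fp_pair[OF assms]] show ?thesis by simp
qed

text \<open>Comparison from the lowest bit upwards: the flag is the verdict on the bits already
  removed and is overruled by any later difference.\<close>

definition le_step :: "nat \<times> nat \<times> bool \<Rightarrow> nat \<times> nat \<times> bool" where
  "le_step = (\<lambda>(m, n, r). (m div 2, n div 2, if odd m = odd n then r else odd n))"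

definition le_of :: "nat \<times> nat \<times> bool \<Rightarrow> bool" where
  "le_of = (\<lambda>(m, n, r). m < n \<or> m = n \<and> r)"

lemma le_of_step: "le_of (le_step s) = le_of s"
proof -
  obtain m n r where s: "s = (m, n, r)" by (cases s) auto
  have "m = 2 * (m div 2) + of_bool (odd m)" "n = 2 * (n div 2) + of_bool (odd n)" by simp_all
  then obtain m' n' a b where mn: "m = 2 * m' + of_bool a" "n = 2 * n' + of_bool b" by blast
  show ?thesis unfolding s mn by (cases a; cases b) (auto simp: le_step_def le_of_def)
qed

lemma le_of_iterate: "le_of ((le_step ^^ i) s) = le_of s"
  by (induction i) (auto simp: le_of_step)

lemma le_step_iterate: "fst ((le_step ^^ i) s) = fst s div 2 ^ i \<and> fst (snd ((le_step ^^ i) s)) = fst (snd s) div 2 ^ i"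
proof (induction i)
  case (Suc i)
  then show ?case
    by (cases "(le_step ^^ i) s") (auto simp: le_step_def div_mult2_eq[symmetric] mult.commute)
qed simp

lemma fp_le:
  assumes "fp f" "fp g" shows "fp (\<lambda>x. f x \<le> (g x :: nat))"
proof -
  let ?L = "\<lambda>p :: nat \<times> nat. True # bits (fst p) @ bits (snd p)"
  let ?F = "\<lambda>p :: nat \<times> nat. foldl (\<lambda>acc a. le_step acc) (fst p, snd p, True) (?L p)"
  have "fp ?F"
  proof (rule fp_foldl_grow[where r = "\<lambda>n. 20" and g = "\<lambda>x a acc. le_step acc"])
    show "fp (\<lambda>q :: (nat \<times> nat) \<times> bool \<times> nat \<times> nat \<times> bool. le_step (snd (snd q)))"
      unfolding le_step_def case_prod_beta
      by (intro fp_pair fp_div2 fp_if fp_eq fp_odd fp_fst fp_snd fp_id)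
    fix acc :: "nat \<times> nat \<times> bool"
    obtain m n c where acc: "acc = (m, n, c)" by (cases acc) auto
    show "sz (le_step acc) \<le> sz acc + 20" unfolding acc le_step_def
      using sz_div2[of m] sz_div2[of n] sz_bool_le[of "if odd m = odd n then c else odd n"] by simp
  qed (intro fp_pair fp_const fp_Cons fp_append fp_bits fp_fst fp_snd fp_id pb_intros)+
  then have "fp (\<lambda>p. snd (snd (?F p)))" by (intro fp_snd)
  moreover have "snd (snd (?F p)) = (fst p \<le> snd p)" for p
  proof -
    let ?s = "(fst p, snd p, True)" and ?i = "length (?L p)"
    have "fst ((le_step ^^ ?i) ?s) = 0" "fst (snd ((le_step ^^ ?i) ?s)) = 0"
      using le_step_iterate[of ?i ?s] sum_lt_pow[of "fst p" "snd p"] by (auto intro!: div_less)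
    then have "le_of ((le_step ^^ ?i) ?s) = snd (snd ((le_step ^^ ?i) ?s))"
      by (cases "(le_step ^^ ?i) ?s") (auto simp: le_of_def)
    then show ?thesis unfolding foldl_const le_of_iterate by (auto simp: le_of_def)
  qed
  ultimately have "fp (\<lambda>p :: nat \<times> nat. fst p \<le> snd p)" by simp
  from fp_comp[OF this fp_pair[OF assms]] show ?thesis by simp
qed

lemma fp_less: "fp f \<Longrightarrow> fp g \<Longrightarrow> fp (\<lambda>x. f x < (g x :: nat))"
  unfolding not_le[symmetric] by (intro fp_not fp_le)

lemma fp_Suc: "fp f \<Longrightarrow> fp (\<lambda>x. Suc (f x))"
  unfolding Suc_eq_plus1 by (intro fp_add fp_const)

lemma val_drop_le: "val (drop i bs) \<le> val bs"
proof (induction bs arbitrary: i)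
  case (Cons b bs)
  then show ?case by (cases i) (auto intro: le_trans[OF Cons.IH])
qed simp

text \<open>Horner's scheme from the highest bit. Each partial result is a leading part of the first
  factor times the second, hence at most the full product, and this bounds its number of
  digits.\<close>

lemma fp_mult:
  assumes "fp f" "fp g" shows "fp (\<lambda>x. f x * g x :: nat)"
proof -
  let ?g = "\<lambda>n b acc. snoc_bit acc False + (if b then n else 0)"
  have *: "foldl (\<lambda>acc b. ?g n b acc) 0 (rev bs) = val bs * n" for n bs
    by (induction bs) (auto simp: snoc_bit_def algebra_simps)
  have "fp (\<lambda>p :: nat \<times> nat. foldl (\<lambda>acc b. ?g (snd p) b acc) 0 (rev (bits (fst p))))"
  proof (rule fp_foldl[where q = "\<lambda>n. 4 * (n + n) + 1" and g = "\<lambda>p b acc. ?g (snd p) b acc"])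
    fix p :: "nat \<times> nat" and i
    let ?bs = "drop (length (bits (fst p)) - i) (bits (fst p))"
    have "take i (rev (bits (fst p))) = rev ?bs" by (simp add: take_rev)
    then have "foldl (\<lambda>acc b. ?g (snd p) b acc) 0 (take i (rev (bits (fst p)))) = val ?bs * snd p"
      using * by simp
    also have "\<dots> \<le> fst p * snd p"
      using val_drop_le[of _ "bits (fst p)"] by (simp add: mult_le_mono1)
    also have "\<dots> < 2 ^ sz (fst p) * 2 ^ sz (snd p)"
      using less_sz[of "fst p"] less_sz[of "snd p"] by (intro mult_strict_mono) auto
    also have "\<dots> \<le> 2 ^ (sz p + sz p)"
      unfolding power_add[symmetric] using sz_fst[of p] sz_snd[of p] by (intro power_increasing) auto
    finally show "sz (foldl (\<lambda>acc b. ?g (snd p) b acc) 0 (take i (rev (bits (fst p))))) \<le> 4 * (sz p + sz p) + 1"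
      by (rule sz_nat_le)
  qed (intro fp_rev fp_bits fp_fst fp_snd fp_id fp_const fp_add fp_if fp_snoc_bit pb_intros)+
  then have "fp (\<lambda>p :: nat \<times> nat. fst p * snd p)" by (simp add: *)
  from fp_comp[OF this fp_pair[OF assms]] show ?thesis by simp
qed

lemma fp_length: "fp L \<Longrightarrow> fp (\<lambda>x. length (L x))"
proof -
  have *: "foldl (\<lambda>acc a. Suc acc) n xs = n + length xs" for n and xs :: "'b list"
    by (induction xs arbitrary: n) auto
  have "fp (\<lambda>x :: 'b list. foldl (\<lambda>acc a. Suc acc) 0 x)"
  proof (rule fp_foldl[where q = "\<lambda>n. 4 * n + 1" and g = "\<lambda>x a acc. Suc acc"])
    fix x :: "'b list" and i
    have "length (take i x) \<le> sz x" using length_le_sz[of x] by simp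
    then show "sz (foldl (\<lambda>acc a. Suc acc) 0 (take i x)) \<le> 4 * sz x + 1"
      unfolding * using sz_nat_le_self[of "length (take i x)"] by simp
  qed (intro fp_id fp_const fp_Suc fp_snd pb_intros)+
  then have "fp (length :: 'b list \<Rightarrow> _)" by (simp add: * fun_eq_iff)
  then show "fp L \<Longrightarrow> fp (\<lambda>x. length (L x))" by (rule fp_comp)
qed

text \<open>A range up to a binary number can be exponentially long, a range up to the length of a
  list cannot. Hence lists of \<open>True\<close> act as unary numbers in the reduction.\<close>

lemma fp_upt_length: "fp L \<Longrightarrow> fp (\<lambda>x. [0..<length (L x)])"
proof -
  have *: "foldl (\<lambda>acc a. length acc # acc) (rev [0..<n]) xs = rev [0..<n + length xs]" for n and xs :: "'b list"
  proof (induction xs arbitrary: n)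
    case (Cons a xs)
    from Cons.IH[of "Suc n"] show ?case by simp
  qed simp
  have **: "sz (rev [0..<n]) \<le> n * (4 * n + 2) + 1" for n
  proof (induction n)
    case (Suc n)
    then show ?case using sz_nat_le_self[of n] by (simp add: algebra_simps)
  qed simp
  have "fp (\<lambda>x :: 'b list. foldl (\<lambda>acc a. length acc # acc) [] x)"
  proof (rule fp_foldl[where q = "\<lambda>n. n * (4 * n + 2) + 1" and g = "\<lambda>x a acc. length acc # acc"])
    fix x :: "'b list" and i
    let ?l = "length (take i x)"
    have l: "?l \<le> sz x" using length_le_sz[of x] by simp
    have "foldl (\<lambda>acc a. length acc # acc) [] (take i x) = rev [0..<?l]"
      using *[of 0 "take i x"] by simp
    then have "sz (foldl (\<lambda>acc a. length acc # acc) [] (take i x)) \<le> ?l * (4 * ?l + 2) + 1"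
      using **[of ?l] by simp
    also have "\<dots> \<le> sz x * (4 * sz x + 2) + 1" using l by (intro add_mono mult_mono) auto
    finally show "sz (foldl (\<lambda>acc a. length acc # acc) [] (take i x)) \<le> sz x * (4 * sz x + 2) + 1" .
  qed (intro fp_id fp_const fp_Cons fp_length fp_snd pb_intros)+
  then have "fp (\<lambda>x :: 'b list. rev (foldl (\<lambda>acc a. length acc # acc) [] x))" by (rule fp_rev)
  then have "fp (\<lambda>x :: 'b list. [0..<length x])"
    by (rule fp_recode) (use *[of 0] in simp)
  then show "fp L \<Longrightarrow> fp (\<lambda>x. [0..<length (L x)])" by (rule fp_comp)
qed

lemma fp_replicate_poly: "fp L \<Longrightarrow> fp (\<lambda>x. replicate (poly p (length (L x))) True)"
proof (induction p)
  case 0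
  then show ?case by (simp add: fp_const)
next
  case (pCons a p)
  have "replicate (poly (pCons a p) (length (L x))) True =
      replicate a True @ concat (map (\<lambda>_. replicate (poly p (length (L x))) True) (L x))" for x
  proof -
    have "concat (map (\<lambda>_. replicate m True) xs) = replicate (length xs * m) True" for m and xs :: "'b list"
      by (induction xs) (auto simp: replicate_add)
    then show ?thesis by (simp add: replicate_add)
  qed
  then show ?case
    by (simp only:) (intro fp_append fp_const fp_concat fp_map pCons.prems
        fp_comp[OF pCons.IH[OF pCons.prems] fp_fst[OF fp_id]])
qed

lemma fp_encode_list:
  assumes "fp L" "fp (\<lambda>q. e (fst q) (snd q))"
  shows "fp (\<lambda>x. encode_list (e x) (L x))"
  unfolding encode_list_def by (intro fp_append fp_concat fp_map fp_Cons fp_const assms)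

lemma fp_encode_nat: "fp f \<Longrightarrow> fp (\<lambda>x. encode_nat (f x))"
  unfolding encode_nat_def by (intro fp_encode_list fp_bits fp_Cons fp_snd fp_id fp_const)

lemmas fp_intros = fp_const fp_id fp_fst fp_snd fp_pair fp_if fp_conj fp_disj fp_not fp_imp fp_eq fp_Cons
  fp_hd fp_tl fp_rev fp_append fp_map fp_concat fp_filter fp_ball fp_bex fp_member fp_zip fp_bits
  fp_odd fp_div2 fp_val fp_add fp_le fp_less fp_Suc fp_mult fp_length fp_upt_length fp_encode_list
  fp_encode_nat

subsection \<open>From encoded data to strings\<close>

definition to_code :: cmd where
  "to_code = pour 0 1 ;; Push 0 False ;; While 1 nonempty
     (If 1 is_true (Push 0 False ;; Push 0 False ;; Push 0 True ;; Push 0 True ;; Pop 1)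
        (Push 0 False ;; Push 0 True ;; Pop 1))"

definition from_code :: cmd where
  "from_code = While 0 is_true (Pop 0 ;; If 0 is_true (Pop 0 ;; Pop 0 ;; Pop 0 ;; Push 1 True)
     (Pop 0 ;; Push 1 False)) ;; Pop 0 ;; pour 1 0"

lemma to_code: "big to_code (st x [] [] []) (30 * length x + 5) (st (code (enc x)) [] [] [])"
proof -
  let ?b = "If 1 is_true (Push 0 False ;; Push 0 False ;; Push 0 True ;; Push 0 True ;; Pop 1)
        (Push 0 False ;; Push 0 True ;; Pop 1)"
  have loop: "big (While 1 nonempty ?b) (st (code (enc ys)) xs [] []) (12 * length xs + 1)
      (st (code (enc (rev xs @ ys))) [] [] [])" for xs ys
  proof (induction xs arbitrary: ys)
    case Nil
    then show ?case by (auto intro: big.WhileF)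
  next
    case (Cons b xs)
    have "eff ?b (st (code (enc ys)) (b # xs) [] []) = st (code (enc (b # ys))) xs [] []"
      by (cases b) (auto simp: enc_bool_def)
    from big_while_step[OF this Cons.IH[of "b # ys"]] show ?case by simp
  qed
  have 1: "big (pour 0 1) (st x [] [] []) (8 * length x + 1) (st [] (rev x) [] [])"
    using pour[of 0 1 "st x [] [] []"] by simp
  have 2: "big (Push 0 False) (st [] (rev x) [] []) 1 (st (code (enc ([] :: bool list))) (rev x) [] [])"
    by (rule big_loop_freeI) auto
  show ?thesis unfolding to_code_def
    using big.Seq[OF 1 big.Seq[OF 2 loop order_refl]] by simp
qed

lemma from_code:
  "big from_code (st (code (enc (x :: bool list))) [] [] []) (30 * length x + 5) (st x [] [] [])"
proof -
  let ?b = "Pop 0 ;; If 0 is_true (Pop 0 ;; Pop 0 ;; Pop 0 ;; Push 1 True) (Pop 0 ;; Push 1 False)"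
  have loop: "big (While 0 is_true ?b) (st (code (enc xs)) ys [] []) (12 * length xs + 1)
      (st [False] (rev xs @ ys) [] [])" for xs ys
  proof (induction xs arbitrary: ys)
    case Nil
    then show ?case by (auto intro: big.WhileF)
  next
    case (Cons b xs)
    have "eff ?b (st (code (enc (b # xs))) ys [] []) = st (code (enc xs)) (b # ys) [] []"
      by (cases b) (auto simp: enc_bool_def)
    from big_while_step[OF this Cons.IH[of "b # ys"]] show ?case by simp
  qed
  have 2: "big (Pop 0) (st [False] (rev x) [] []) 1 (st [] (rev x) [] [])"
    by (rule big_loop_freeI) auto
  have 3: "big (pour 1 0) (st [] (rev x) [] []) (8 * length x + 1) (st x [] [] [])"
    using pour[of 1 0 "st [] (rev x) [] []"] by simp
  have "big (While 0 is_true ?b) (st (code (enc x)) [] [] []) (12 * length x + 1) (st [False] (rev x) [] [])"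
    using loop[of x "[]"] by simp
  from big.Seq[OF this big.Seq[OF 2 3 order_refl]] show ?thesis unfolding from_code_def by simp
qed

lemma poly_time_fp:
  assumes "fp f"
  shows "poly_time f"
proof -
  obtain c k where c: "creg c" "\<And>x. sz (f x) \<le> (sz x + 2) ^ k"
    "\<And>x l. big c (st (code (enc x) @ l) [] [] []) ((sz x + 2) ^ k) (st (code (enc (f x)) @ l) [] [] [])"
    using assms unfolding fp_def by blast
  let ?s = "\<lambda>n. 4 * n + 1 + 2 :: nat"
  let ?p = "\<lambda>n. (30 * n + 5) + (?s n ^ k + (30 * ?s n ^ k + 5))"
  show ?thesis
  proof (rule poly_time_of_cmd)
    show "creg (to_code ;; c ;; from_code)" using c(1) by (simp add: to_code_def from_code_def pour_def)
    show "pb ?p" by (intro pb_intros)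
    fix x :: "bool list"
    have s: "(sz x + 2) ^ k \<le> ?s (length x) ^ k"
      using sz_bools_le[of x] by (intro power_mono) auto
    have 2: "big c (st (code (enc x)) [] [] []) (?s (length x) ^ k) (st (code (enc (f x))) [] [] [])"
      using big_mono[OF c(3)[of x "[]"] s] by simp
    have "length (f x) \<le> ?s (length x) ^ k" using length_le_sz[of "f x"] c(2)[of x] s by linarith
    then have 3: "big from_code (st (code (enc (f x))) [] [] []) (30 * ?s (length x) ^ k + 5) (st (f x) [] [] [])"
      by (intro big_mono[OF from_code]) simp
    show "big (to_code ;; c ;; from_code) (st x [] [] []) (?p (length x)) (st (f x) [] [] [])"
      by (rule big.Seq[OF to_code big.Seq[OF 2 3 order_refl] order_refl])
  qed
qed

section \<open>Hardness\<close>

subsection \<open>Editing path temporal graphs\<close>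

lemma verts_modify [simp]: "verts (modify G \<Pi>) = verts G"
  by (simp add: modify_def Let_def)

lemma time_edges_modify: "time_edges (modify G \<Pi>) = (time_edges G - \<Pi>) \<union> (\<Pi> - time_edges G)"
  by (force simp: modify_def Let_def time_edges_def)

lemma edges_modify: "edges (modify G \<Pi>) = fst ` time_edges (modify G \<Pi>)"
  unfolding time_edges_modify by (simp add: modify_def Let_def)

lemma appearances_modify: "appearances (modify G \<Pi>) e = {t. (e, t) \<in> time_edges (modify G \<Pi>)}"
  unfolding time_edges_modify by (simp add: modify_def Let_def)

text \<open>Graphs presented by the same lists may differ in \<open>appearances\<close> outside
  their edges; modification looks only at vertices and time-edges.\<close>

lemma ETC_cong:
  assumes "verts G = verts H" "time_edges G = time_edges H"
  shows "ETC G k a b = ETC H k a b"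
proof -
  have "modify G = modify H" using assms by (simp add: modify_def fun_eq_iff)
  then show ?thesis using assms by (simp add: ETC_def)
qed

lemma dense_one: "a \<le> b \<Longrightarrow> dense G 1 e a b \<longleftrightarrow> {a..b} \<subseteq> appearances G e"
proof -
  assume "a \<le> b"
  then have *: "{int a .. max (int a) (int b - int 1 + 1)} = int ` {a..b}"
    by (simp add: image_int_atLeastAtMost)
  have "int s \<le> int t \<and> int t \<le> int s + int 1 - 1 \<longleftrightarrow> t = s" for s t by auto
  then show ?thesis unfolding dense_def * by auto
qed

definition path_graph :: "nat \<Rightarrow> (nat \<Rightarrow> nat set) \<Rightarrow> nat temporal_graph" where
  "path_graph E A =
     \<lparr>verts = {..E}, edges = (\<lambda>i. {i, Suc i}) ` {..<E}, appearances = (\<lambda>e. A (Min e))\<rparr>"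

definition slots :: "nat \<Rightarrow> (nat \<Rightarrow> nat set) \<Rightarrow> (nat \<times> nat) set" where
  "slots E A = (SIGMA i : {..<E}. A i)"

definition edge_at :: "nat \<times> nat \<Rightarrow> nat set \<times> nat" where
  "edge_at p = ({fst p, Suc (fst p)}, snd p)"

text \<open>Each chosen time-edge is to be a template of its own, on the two ends of the edge and at
  a single time. Two such vertex sets meet iff the edges are equal or consecutive, so the condition
  is independence.\<close>

definition selection :: "nat \<Rightarrow> (nat \<Rightarrow> nat set) \<Rightarrow> nat \<Rightarrow> (nat \<times> nat) set \<Rightarrow> bool" where
  "selection E A D S \<longleftrightarrow> S \<subseteq> slots E A \<and>
     (\<forall>p \<in> S. \<forall>q \<in> S. p \<noteq> q \<longrightarrow> fst p \<le> Suc (fst q) \<longrightarrow> fst q \<le> Suc (fst p) \<longrightarrow>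
        int D \<le> \<bar>int (snd p) - int (snd q)\<bar>)"

lemma pair_eq: "{i, Suc i} = {j, Suc j} \<longleftrightarrow> i = j"
  by (auto simp: doubleton_eq_iff)

lemma inj_edge_at: "inj edge_at"
  by (auto simp: inj_def edge_at_def pair_eq)

lemma time_edges_path: "time_edges (path_graph E A) = edge_at ` slots E A"
  unfolding time_edges_def path_graph_def slots_def edge_at_def by force

lemma selection_imp_ETC:
  assumes fin: "\<And>i. i < E \<Longrightarrow> finite (A i)" and odd: "\<And>i t. i < E \<Longrightarrow> t \<in> A i \<Longrightarrow> odd t"
    and S: "selection E A D S" and k: "card (slots E A) \<le> card S + k"
  shows "ETC (path_graph E A) k 1 D"
proof -
  let ?G = "path_graph E A"
  define N0 where "N0 = edge_at ` slots E A"
  have finN: "finite (slots E A)" unfolding slots_def using fin by auto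
  have SS: "S \<subseteq> slots E A" using S by (simp add: selection_def)
  have finS: "finite S" using finN SS finite_subset by blast
  define \<Pi> where "\<Pi> = N0 - edge_at ` S"
  have N0: "time_edges ?G = N0" by (simp add: time_edges_path N0_def)
  have te: "time_edges (modify ?G \<Pi>) = edge_at ` S"
    unfolding time_edges_modify N0 \<Pi>_def N0_def using SS by blast
  have sub: "\<Pi> \<subseteq> vertex_pairs (verts ?G) \<times> {1..}"
  proof
    fix x assume "x \<in> \<Pi>"
    then obtain i t where x: "x = ({i, Suc i}, t)" "i < E" "t \<in> A i"
      by (auto simp: \<Pi>_def N0_def slots_def edge_at_def)
    then show "x \<in> vertex_pairs (verts ?G) \<times> {1..}"
      using odd[of i t] by (cases t) (auto simp: vertex_pairs_def path_graph_def)
  qed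
  have "card \<Pi> = card (slots E A) - card S"
  proof -
    have "\<Pi> = edge_at ` (slots E A - S)"
      unfolding \<Pi>_def N0_def by (simp add: image_set_diff[OF inj_edge_at])
    then have "card \<Pi> = card (slots E A - S)" using card_image[OF inj_on_subset[OF inj_edge_at]] by simp
    then show ?thesis using card_Diff_subset[OF finS SS] by simp
  qed
  then have cardP: "card \<Pi> \<le> k" using k by linarith
  have finP: "finite \<Pi>" using finN by (simp add: \<Pi>_def N0_def)
  let ?C = "(\<lambda>(i, t). ({i, Suc i}, t, t)) ` S"
  have life: "t \<le> lifetime (modify ?G \<Pi>)" if "(i, t) \<in> S" for i t
  proof -
    have "t \<in> snd ` time_edges (modify ?G \<Pi>)" unfolding te using that by (force simp: edge_at_def)
    then show ?thesis unfolding lifetime_def using finS te by (intro Max_ge) auto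
  qed
  have pos: "1 \<le> t \<and> i < E" if "(i, t) \<in> S" for i t
  proof -
    have "i < E" "t \<in> A i" using that SS by (auto simp: slots_def)
    then show ?thesis using odd[of i t] by (cases t) auto
  qed
  have "realises (modify ?G \<Pi>) 1 D ?C"
    unfolding realises_def
  proof (intro conjI)
    show "\<forall>(X, a, b) \<in> ?C. X \<subseteq> verts (modify ?G \<Pi>) \<and> 1 \<le> a \<and> a \<le> b \<and> b \<le> lifetime (modify ?G \<Pi>)"
      using life pos by (fastforce simp: path_graph_def)
    show "\<forall>C \<in> ?C. \<forall>D' \<in> ?C. C \<noteq> D' \<longrightarrow> independent D C D'"
    proof (intro ballI impI)
      fix C D' assume "C \<in> ?C" "D' \<in> ?C" "C \<noteq> D'"
      then obtain i s j t where *: "C = ({i, Suc i}, s, s)" "D' = ({j, Suc j}, t, t)"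
        "(i, s) \<in> S" "(j, t) \<in> S" "(i, s) \<noteq> (j, t)" by auto
      show "independent D C D'"
      proof (cases "i \<le> Suc j \<and> j \<le> Suc i")
        case True
        then show ?thesis using S * unfolding selection_def by fastforce
      next
        case False
        then show ?thesis using * by auto
      qed
    qed
    show "\<forall>(e, t) \<in> time_edges (modify ?G \<Pi>). \<exists>(X, a, b) \<in> ?C. e \<subseteq> X \<and> t \<in> {a..b}"
      unfolding te by (force simp: edge_at_def)
    show "\<forall>(X, a, b) \<in> ?C. \<forall>x \<in> X. \<forall>y \<in> X. x \<noteq> y \<longrightarrow>
        {x, y} \<in> edges (modify ?G \<Pi>) \<and> dense (modify ?G \<Pi>) 1 {x, y} a b"
    proof clarify
      fix i t x y
      assume s: "(i, t) \<in> S" and xy: "x \<in> {i, Suc i}" "y \<in> {i, Suc i}" "x \<noteq> y"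
      then have e: "{x, y} = {i, Suc i}" by auto
      have "({i, Suc i}, t) \<in> time_edges (modify ?G \<Pi>)" unfolding te using s by (force simp: edge_at_def)
      then show "{x, y} \<in> edges (modify ?G \<Pi>) \<and> dense (modify ?G \<Pi>) 1 {x, y} t t"
        unfolding e edges_modify dense_one[OF order_refl] appearances_modify by force
    qed
  qed
  then show ?thesis unfolding ETC_def cluster_temporal_graph_def
    using sub finP cardP by blast
qed

text \<open>An exchange argument. A template with s original time-edges contains at least s - 1
  added ones, so replacing it by one of its original time-edges costs s - 1 deletions and saves at
  least as many additions. The representatives inherit independence because consecutive edges share
  a vertex.\<close>

lemma ETC_imp_selection:
  assumes fin: "\<And>i. i < E \<Longrightarrow> finite (A i)" and odd: "\<And>i t. i < E \<Longrightarrow> t \<in> A i \<Longrightarrow> odd t"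
    and D: "1 \<le> D" and ETC: "ETC (path_graph E A) k 1 D"
  shows "\<exists>S. selection E A D S \<and> card (slots E A) \<le> card S + k"
proof -
  let ?G = "path_graph E A"
  define N0 where "N0 = edge_at ` slots E A"
  have N0: "time_edges ?G = N0" by (simp add: time_edges_path N0_def)
  have finN: "finite N0" unfolding N0_def slots_def using fin by auto
  obtain \<Pi> \<C> where \<Pi>: "\<Pi> \<subseteq> vertex_pairs (verts ?G) \<times> {1..}" "finite \<Pi>" "card \<Pi> \<le> k"
    and real: "realises (modify ?G \<Pi>) 1 D \<C>"
    using ETC unfolding ETC_def cluster_temporal_graph_def by blast
  define F where "F = time_edges (modify ?G \<Pi>)"
  have F: "F = (N0 - \<Pi>) \<union> (\<Pi> - N0)" unfolding F_def time_edges_modify N0 ..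
  have finF: "finite F" unfolding F using finN \<Pi> by simp
  have ne: "e \<noteq> {}" if "(e, t) \<in> F" for e t
    using that \<Pi>(1) unfolding F N0_def by (auto simp: edge_at_def vertex_pairs_def)
  define FC where "FC = (\<lambda>(X, a, b). {p \<in> F. fst p \<subseteq> X \<and> snd p \<in> {a..b}})"
  have FCF: "FC C \<subseteq> F" for C by (auto simp: FC_def split: prod.splits)
  \<comment> \<open>A time-edge in two templates would put them at distance 0, below
    \<open>D\<close>.\<close>
  have disj: "FC C \<inter> FC C' = {}" if "C \<in> \<C>" "C' \<in> \<C>" "C \<noteq> C'" for C C'
  proof (rule ccontr)
    obtain X a b Y c d where CC: "C = (X, a, b)" "C' = (Y, c, d)" by (metis prod_cases3)
    assume "FC C \<inter> FC C' \<noteq> {}"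
    then obtain p where "p \<in> FC C" "p \<in> FC C'" by blast
    moreover obtain e t where "p = (e, t)" by fastforce
    ultimately have et: "(e, t) \<in> F" "e \<subseteq> X" "e \<subseteq> Y" "t \<in> {a..b}" "t \<in> {c..d}"
      by (auto simp: FC_def CC)
    have "independent D C C'" using real that unfolding realises_def by blast
    then have "X \<inter> Y = {} \<or> (\<forall>s \<in> {a..b}. \<forall>t \<in> {c..d}. int D \<le> \<bar>int s - int t\<bar>)"
      unfolding CC by simp
    moreover have "X \<inter> Y \<noteq> {}" using ne[OF et(1)] et(2,3) by blast
    ultimately have "int D \<le> \<bar>int t - int t\<bar>" using et(4,5) by blast
    then show False using D by simp
  qed
  have complete: "({x, y}, t) \<in> FC (X, a, b)"
    if "(X, a, b) \<in> \<C>" "x \<in> X" "y \<in> X" "x \<noteq> y" "t \<in> {a..b}" for X a b x y t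
  proof -
    have r1: "\<forall>(X, a, b) \<in> \<C>. X \<subseteq> verts (modify ?G \<Pi>) \<and> 1 \<le> a \<and> a \<le> b \<and> b \<le> lifetime (modify ?G \<Pi>)"
      and r4: "\<forall>(X, a, b) \<in> \<C>. \<forall>x \<in> X. \<forall>y \<in> X. x \<noteq> y \<longrightarrow>
        {x, y} \<in> edges (modify ?G \<Pi>) \<and> dense (modify ?G \<Pi>) 1 {x, y} a b"
      by (rule real[unfolded realises_def, THEN conjunct1],
        rule real[unfolded realises_def, THEN conjunct2, THEN conjunct2, THEN conjunct2])
    have ab: "a \<le> b" using bspec[OF r1 that(1)] by simp
    have d: "dense (modify ?G \<Pi>) 1 {x, y} a b" using bspec[OF r4 that(1)] that(2-4) by simp
    have "t \<in> appearances (modify ?G \<Pi>) {x, y}" using d[unfolded dense_one[OF ab]] that(5) by blast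
    then have "({x, y}, t) \<in> F" by (simp add: appearances_modify F_def)
    then show ?thesis using that by (simp add: FC_def)
  qed
  have N0D: "\<exists>i. e = {i, Suc i} \<and> i < E \<and> t \<in> A i \<and> odd t" if "(e, t) \<in> N0" for e t
    using that odd unfolding N0_def edge_at_def slots_def by auto
  text \<open>
    All times in \<open>N0\<close> are odd, so besides an original time-edge of a template at time \<open>t\<close> the
    template contains an added one at time \<open>t - 1\<close>; at the first time of the template, the chord
    to the end of the last original edge is used instead.
  \<close>
  have half: "card (FC C \<inter> N0) \<le> Suc (card (FC C - N0))" if C: "C \<in> \<C>" for C
  proof -
    obtain X a b where X: "C = (X, a, b)" by (metis prod_cases3)
    define I where "I = {i. ({i, Suc i}, a) \<in> FC C \<inter> N0}"
    define m where "m = Max I"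
    define \<phi> where "\<phi> = (\<lambda>(e :: nat set, t). if a < t then (e, t - 1) else ({Min e, Suc m}, a))"
    have finI: "finite I"
    proof (rule finite_subset)
      show "I \<subseteq> {..<E}"
      proof
        fix i assume "i \<in> I"
        then obtain j where "{i, Suc i} = {j, Suc j}" "j < E" using N0D unfolding I_def by blast
        then show "i \<in> {..<E}" by (simp add: pair_eq)
      qed
    qed simp
    have mI: "m \<in> I" "i \<le> m" if "i \<in> I" for i
      using that finI unfolding m_def by (auto intro: Max_in)
    let ?A = "FC C \<inter> N0 - {({m, Suc m}, a)}"
    have char: "\<exists>i. e = {i, Suc i} \<and> i \<in> X \<and> Suc i \<in> X \<and> odd t \<and> t \<in> {a..b} \<and>
        (a < t \<or> t = a \<and> i < m \<and> Suc m \<in> X)" if et: "(e, t) \<in> ?A" for e t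
    proof -
      obtain i where i: "e = {i, Suc i}" "odd t" using N0D et by blast
      have t: "t \<in> {a..b}" "i \<in> X" "Suc i \<in> X" using et i by (auto simp: FC_def X)
      show ?thesis
      proof (cases "a < t")
        case False
        then have ta: "t = a" using t by simp
        then have "i \<in> I" using et i by (simp add: I_def)
        then have "m \<in> I" "i \<le> m" "i \<noteq> m" using mI et i ta by auto
        then have "i < m" "Suc m \<in> X" by (auto simp: I_def FC_def X)
        then show ?thesis using i t ta by blast
      qed (use i t in blast)
    qed
    have "inj_on \<phi> ?A"
    proof (rule inj_onI)
      fix p q assume p: "p \<in> ?A" and q: "q \<in> ?A" and eq: "\<phi> p = \<phi> q"
      obtain e t f s where pq: "p = (e, t)" "q = (f, s)" by fastforce
      obtain i where i: "e = {i, Suc i}" "a \<le> t" "a < t \<or> t = a \<and> i < m" using char p pq by fastforce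
      obtain j where j: "f = {j, Suc j}" "a \<le> s" "a < s \<or> s = a \<and> j < m" using char q pq by fastforce
      have mn: "Min e = i" "Min f = j" using i j by auto
      show "p = q"
      proof (cases "a < t"; cases "a < s")
        assume "a < t" "a < s" then show ?thesis using eq by (auto simp: pq \<phi>_def)
      next
        assume "a < t" "\<not> a < s"
        then have "{i, Suc i} = {j, Suc m}" "j < m" using eq i j mn by (auto simp: pq \<phi>_def)
        then show ?thesis by (auto simp: doubleton_eq_iff)
      next
        assume "\<not> a < t" "a < s"
        then have "{j, Suc j} = {i, Suc m}" "i < m" using eq i j mn by (auto simp: pq \<phi>_def)
        then show ?thesis by (auto simp: doubleton_eq_iff)
      next
        assume "\<not> a < t" "\<not> a < s"
        then have "{i, Suc m} = {j, Suc m}" "i < m" "j < m" "t = a" "s = a"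
          using eq i j mn by (auto simp: pq \<phi>_def)
        then show ?thesis using i j by (auto simp: pq doubleton_eq_iff)
      qed
    qed
    moreover have "\<phi> ` ?A \<subseteq> FC C - N0"
    proof
      fix z assume "z \<in> \<phi> ` ?A"
      then obtain e t where z: "z = \<phi> (e, t)" "(e, t) \<in> ?A" by auto
      obtain i where i: "e = {i, Suc i}" "i \<in> X" "Suc i \<in> X" "odd t" "t \<in> {a..b}"
        "a < t \<or> t = a \<and> i < m \<and> Suc m \<in> X" using char[OF z(2)] by blast
      show "z \<in> FC C - N0"
      proof (cases "a < t")
        case True
        then have "t - 1 \<in> {a..b}" using i(5) by auto
        then have "(e, t - 1) \<in> FC C" using complete[of X a b i "Suc i" "t - 1"] C i(1-3) by (simp add: X)
        moreover have "(e, t - 1) \<notin> N0" using N0D[of e "t - 1"] i(4) by auto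
        ultimately show ?thesis using True by (simp add: z \<phi>_def)
      next
        case False
        then have im: "t = a" "i < m" "Suc m \<in> X" using i by auto
        have "({i, Suc m}, a) \<in> FC C" using complete[of X a b i "Suc m" a] C i im by (simp add: X)
        moreover have "({i, Suc m}, a) \<notin> N0"
        proof
          assume "({i, Suc m}, a) \<in> N0"
          then obtain j where "{i, Suc m} = {j, Suc j}" using N0D by blast
          then show False using im(2) by (auto simp: doubleton_eq_iff)
        qed
        ultimately show ?thesis using False i by (simp add: z \<phi>_def)
      qed
    qed
    moreover have "finite (FC C - N0)" using finF FCF finite_subset by blast
    ultimately have "card ?A \<le> card (FC C - N0)" using card_inj_on_le by blast
    moreover have "card (FC C \<inter> N0) \<le> Suc (card ?A)"
      using finN by (metis card_Diff_singleton_if card_Suc_Diff1 diff_le_self finite_Int le_SucI order_refl)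
    ultimately show ?thesis by simp
  qed
  define \<C>' where "\<C>' = {C \<in> \<C>. FC C \<inter> N0 \<noteq> {}}"
  define r where "r = (\<lambda>C. SOME p. p \<in> slots E A \<and> edge_at p \<in> FC C)"
  have r: "r C \<in> slots E A \<and> edge_at (r C) \<in> FC C" if "C \<in> \<C>'" for C
  proof -
    have "\<exists>p. p \<in> slots E A \<and> edge_at p \<in> FC C" using that unfolding \<C>'_def N0_def by blast
    then show ?thesis unfolding r_def by (rule someI_ex)
  qed
  have inj: "inj_on r \<C>'"
  proof (rule inj_onI, rule ccontr)
    fix C C' assume *: "C \<in> \<C>'" "C' \<in> \<C>'" "r C = r C'" "C \<noteq> C'"
    then have "edge_at (r C) \<in> FC C \<inter> FC C'" using r by fastforce
    then show False using disj * unfolding \<C>'_def by blast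
  qed
  have finSl: "finite (slots E A)" unfolding slots_def using fin by auto
  have finC: "finite \<C>'"
    using inj finSl r by (metis finite_imageD finite_subset image_subsetI)
  have sel: "selection E A D (r ` \<C>')"
    unfolding selection_def
  proof (intro conjI ballI impI)
    show "r ` \<C>' \<subseteq> slots E A" using r by blast
    fix p q assume "p \<in> r ` \<C>'" "q \<in> r ` \<C>'" "p \<noteq> q"
      and near: "fst p \<le> Suc (fst q)" "fst q \<le> Suc (fst p)"
    then obtain C C' where C: "C \<in> \<C>'" "C' \<in> \<C>'" "p = r C" "q = r C'" "C \<noteq> C'" by blast
    obtain X a b Y c d where XY: "C = (X, a, b)" "C' = (Y, c, d)" by (metis prod_cases3)
    have p: "{fst p, Suc (fst p)} \<subseteq> X" "snd p \<in> {a..b}" and q: "{fst q, Suc (fst q)} \<subseteq> Y" "snd q \<in> {c..d}"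
      using r[OF C(1)] r[OF C(2)] C XY by (auto simp: FC_def edge_at_def)
    have "fst p = fst q \<or> fst p = Suc (fst q) \<or> Suc (fst p) = fst q" using near by linarith
    then have "X \<inter> Y \<noteq> {}" using p(1) q(1) by auto
    moreover have "independent D C C'" using real C unfolding realises_def \<C>'_def by blast
    ultimately show "int D \<le> \<bar>int (snd p) - int (snd q)\<bar>" using p(2) q(2) unfolding XY by simp
  qed
  have cover: "N0 \<inter> F \<subseteq> (\<Union>C \<in> \<C>'. FC C \<inter> N0)"
  proof
    fix p assume p: "p \<in> N0 \<inter> F"
    obtain e t where et: "p = (e, t)" by fastforce
    have "\<exists>(X, a, b) \<in> \<C>. e \<subseteq> X \<and> t \<in> {a..b}" using real p et unfolding realises_def F_def by fast
    then obtain C where "C \<in> \<C>" "p \<in> FC C" using p et unfolding FC_def by fastforce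
    then show "p \<in> (\<Union>C \<in> \<C>'. FC C \<inter> N0)" using p unfolding \<C>'_def by blast
  qed
  \<comment> \<open>Surviving original time-edges are counted template by template with
    \<open>half\<close>; added ones are counted once because the templates are disjoint.\<close>
  have "card (N0 \<inter> F) \<le> card (\<Union>C \<in> \<C>'. FC C \<inter> N0)"
    using cover finC finN by (intro card_mono) auto
  also have "\<dots> \<le> (\<Sum>C \<in> \<C>'. card (FC C \<inter> N0))" using finC by (rule card_UN_le)
  also have "\<dots> \<le> (\<Sum>C \<in> \<C>'. Suc (card (FC C - N0)))" using half unfolding \<C>'_def by (intro sum_mono) auto
  also have "\<dots> = card \<C>' + (\<Sum>C \<in> \<C>'. card (FC C - N0))" by (simp add: sum_Suc)
  also have "(\<Sum>C \<in> \<C>'. card (FC C - N0)) = card (\<Union>C \<in> \<C>'. FC C - N0)"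
  proof (rule card_UN_disjoint[symmetric])
    show "\<forall>C \<in> \<C>'. finite (FC C - N0)" using finF FCF finite_subset by blast
    show "\<forall>C \<in> \<C>'. \<forall>C' \<in> \<C>'. C \<noteq> C' \<longrightarrow> (FC C - N0) \<inter> (FC C' - N0) = {}"
      using disj unfolding \<C>'_def by blast
  qed (rule finC)
  also have "\<dots> \<le> card (F - N0)" using finF FCF by (intro card_mono) auto
  finally have 1: "card (N0 \<inter> F) \<le> card \<C>' + card (F - N0)" by simp
  have "card (N0 - F) + card (F - N0) = card ((N0 - F) \<union> (F - N0))"
    using finN finF by (intro card_Un_disjoint[symmetric]) auto
  also have "\<dots> \<le> card \<Pi>" using \<Pi>(2) unfolding F by (intro card_mono) auto
  finally have 2: "card (N0 - F) + card (F - N0) \<le> k" using \<Pi>(3) by simp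
  have "card N0 = card (N0 \<inter> F) + card (N0 - F)"
    using finN by (metis card_Int_Diff)
  moreover have "card N0 = card (slots E A)"
    unfolding N0_def using card_image[OF inj_on_subset[OF inj_edge_at]] by simp
  ultimately have "card (slots E A) \<le> card (r ` \<C>') + k" using 1 2 card_image[OF inj] by simp
  then show ?thesis using sel by blast
qed

subsection \<open>Monotone satisfiability as a selection problem\<close>

text \<open>Clause \<open>j\<close> consists of the variables in \<open>C j\<close>, all positive if
  \<open>sgn j\<close> and all negative otherwise. With the positive clauses first, a horizontal
  shift 1 forced by a positive clause is inherited by every negative one.\<close>

locale monotone_sat =
  fixes m R :: nat and C :: "nat \<Rightarrow> nat set" and sgn :: "nat \<Rightarrow> bool"
  assumes R: "1 \<le> R" and C: "\<And>j. j < m \<Longrightarrow> C j \<subseteq> {..<R}"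
    and sorted: "\<And>i j. i < j \<Longrightarrow> sgn j \<Longrightarrow> sgn i"
begin

text \<open>Written as \<open>2 * x + 1\<close>, times must differ by \<open>R\<close> in
  \<open>x\<close>. Row \<open>r\<close> offers a lower rectangle starting at
  \<open>2 * r * R\<close> plus any shift and an upper one starting \<open>R\<close> later, whose
  shift is a member of the clause. The upper one carries the information: at shift \<open>r\<close>
  in row \<open>r\<close> only the edge matching the sign is offered. The lower one hands the
  vertical shift on from row to row.\<close>

definition main_times :: "nat \<Rightarrow> nat \<Rightarrow> nat set" where
  "main_times j h =
     {2 * (2 * r * R + v) + 1 | r v. r < R \<and> v < R} \<union>
     {2 * (2 * r * R + R + v) + 1 | r v. r < R \<and> v \<in> C j \<and> (v = r \<longrightarrow> (h = 1) = sgn j)}"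

text \<open>Spacers lie between the clauses. They collide with the upper rectangles of their own row
  at every vertical shift and so pass on the horizontal shift, they never collide with upper
  rectangles of another row, and they keep the vertical shifts of different clauses apart.\<close>

definition spacer_times :: "nat set" where
  "spacer_times = {2 * (2 * r * R + R) + 1 | r. r < R}"

definition times :: "nat \<Rightarrow> nat set" where
  "times i = (if i mod 4 < 2 then main_times (i div 4) (i mod 4) else spacer_times)"

lemma times_main: "h \<le> 1 \<Longrightarrow> times (4 * j + h) = main_times j h"
  by (simp add: times_def)

lemma times_spacer: "h \<le> 1 \<Longrightarrow> times (4 * j + 2 + h) = spacer_times"
proof -
  assume "h \<le> 1"
  then have "(4 * j + 2 + h) mod 4 = 2 + h" by presburger
  then show ?thesis by (simp add: times_def)
qed

fun offset :: "(nat \<Rightarrow> nat) \<Rightarrow> nat \<Rightarrow> nat \<Rightarrow> nat" where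
  "offset v j k = (if k = 0 then v j else if k = 1 then R + v j else R)"

text \<open>All main rectangles of clause \<open>j\<close> get the same vertical shift, a variable
  that satisfies the clause, and all rectangles of row \<open>r\<close> the same horizontal shift,
  the truth value of \<open>r\<close>.\<close>

lemma sat_imp_selection:
  assumes sat: "\<And>j. j < m \<Longrightarrow> \<exists>v \<in> C j. \<alpha> v = sgn j"
  shows "\<exists>S. selection (4 * m) times (2 * R) S \<and> card S = 3 * m * R"
proof -
  obtain v where v: "\<And>j. j < m \<Longrightarrow> v j \<in> C j \<and> \<alpha> (v j) = sgn j" using sat by metis
  have vR: "v j < R" if "j < m" for j using v C that by blast
  define h where "h = (\<lambda>r. of_bool (\<alpha> r) :: nat)"
  have h1: "h r \<le> 1" for r by (simp add: h_def)
  define base where "base = (\<lambda>j (k :: nat). if k = 2 then 4 * j + 2 else 4 * j :: nat)"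
  define pt where "pt = (\<lambda>(j, r, k). (base j k + h r, 2 * (2 * r * R + offset v j k) + 1))"
  let ?I = "{..<m} \<times> {..<R} \<times> {..<3 :: nat}"
  have off: "offset v j k < 2 * R" if "j < m" for j k using vR[OF that] R by simp
  have far: "int (2 * R) \<le> \<bar>int (snd (pt (j, r, k))) - int (snd (pt (j', r', k')))\<bar>"
    if "(j, r, k) \<in> ?I" "(j', r', k') \<in> ?I" "(j, r, k) \<noteq> (j', r', k')" "r \<le> r'"
      and near: "base j k + h r \<le> Suc (base j' k' + h r')" "base j' k' + h r' \<le> Suc (base j k + h r)"
    for j r k j' r' k'
  proof -
    let ?x = "2 * r * R + offset v j k" and ?y = "2 * r' * R + offset v j' k'"
    have jm: "j < m" "j' < m" "k < 3" "k' < 3" using that by auto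
    have "R \<le> ?y - ?x \<and> ?x \<le> ?y \<or> R \<le> ?x - ?y \<and> ?y \<le> ?x"
    proof (cases "r = r'")
      case True
      have "base j k = base j' k'"
        using near unfolding True base_def by (auto split: if_splits) presburger+
      then have "j = j'" "(k = 2) = (k' = 2)" by (auto simp: base_def split: if_splits; presburger)+
      then have "k \<noteq> k'" "k < 2" "k' < 2" using that True jm by auto
      then have "k = 0 \<and> k' = 1 \<or> k = 1 \<and> k' = 0" by auto
      then show ?thesis using True \<open>j = j'\<close> by auto
    next
      case False
      then have rr: "r < r'" using that by simp
      \<comment> \<open>The only critical case is an upper rectangle against a lower one of the next
        row with a smaller shift. Within a clause the shifts agree, and different clauses are at
        least three edges apart.\<close>
      have "offset v j k \<le> R + offset v j' k' \<or> Suc r < r'"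
      proof (rule ccontr)
        assume *: "\<not> ?thesis"
        then have "r' = Suc r" using rr by simp
        have "k = 1" "v j > offset v j' k'" using * vR[OF jm(1)] by (auto split: if_splits)
        then have "k' = 0" using vR[OF jm(1)] by (auto split: if_splits)
        then have "j \<noteq> j'" using \<open>v j > offset v j' k'\<close> by auto
        then show False using near h1[of r] h1[of r'] \<open>k = 1\<close> \<open>k' = 0\<close> unfolding base_def by auto
      qed
      then show ?thesis
      proof
        assume a: "offset v j k \<le> R + offset v j' k'"
        have "2 * Suc r * R \<le> 2 * r' * R" using rr by (intro mult_right_mono) auto
        then have "2 * r * R + 2 * R \<le> 2 * r' * R" by (simp add: algebra_simps)
        then show ?thesis using a by linarith
      next
        assume "Suc r < r'"
        then have "2 * Suc (Suc r) * R \<le> 2 * r' * R" by (intro mult_right_mono) auto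
        then have "2 * r * R + 4 * R \<le> 2 * r' * R" by (simp add: algebra_simps)
        then show ?thesis using off[OF jm(1), of k] by linarith
      qed
    qed
    moreover have "snd (pt (j, r, k)) = 2 * ?x + 1" "snd (pt (j', r', k')) = 2 * ?y + 1"
      by (simp_all add: pt_def)
    moreover have "int (2 * R) \<le> \<bar>int (2 * x + 1) - int (2 * y + 1)\<bar>"
      if "R \<le> y - x \<and> x \<le> y \<or> R \<le> x - y \<and> y \<le> x" for x y
      using that by auto
    ultimately show ?thesis by metis
  qed
  have far': "int (2 * R) \<le> \<bar>int (snd (pt i)) - int (snd (pt i'))\<bar>"
    if I: "i \<in> ?I" "i' \<in> ?I" "i \<noteq> i'" and near: "fst (pt i) \<le> Suc (fst (pt i'))" "fst (pt i') \<le> Suc (fst (pt i))" for i i'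
  proof -
    obtain j r k j' r' k' where i: "i = (j, r, k)" "i' = (j', r', k')" by (metis prod_cases3)
    show ?thesis
    proof (cases "r \<le> r'")
      case True
      then show ?thesis using far[of j r k j' r' k'] I near unfolding i by (simp add: pt_def)
    next
      case False
      then show ?thesis using far[of j' r' k' j r k] I near unfolding i
        by (simp add: pt_def abs_minus_commute)
    qed
  qed
  have inj: "inj_on pt ?I"
  proof (rule inj_onI, rule ccontr)
    fix i i' assume "i \<in> ?I" "i' \<in> ?I" "pt i = pt i'" "i \<noteq> i'"
    then have "int (2 * R) \<le> 0" using far'[of i i'] by simp
    then show False using R by simp
  qed
  have "pt ` ?I \<subseteq> slots (4 * m) times"
  proof
    fix p assume "p \<in> pt ` ?I"
    then obtain j r k where p: "p = pt (j, r, k)" "j < m" "r < R" "k < 3" by auto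
    have hs: "(v j = r \<longrightarrow> (h r = 1) = sgn j)" using v[OF p(2)] by (auto simp: h_def)
    consider "k = 0" | "k = 1" | "k = 2" using p(4) by linarith
    then show "p \<in> slots (4 * m) times"
    proof cases
      case 1
      then show ?thesis using p h1[of r] vR[OF p(2)]
        by (auto simp: slots_def pt_def base_def times_main main_times_def)
    next
      case 2
      then have "snd p \<in> main_times j (h r)" using p hs v[OF p(2)]
        unfolding main_times_def by (auto simp: pt_def algebra_simps)
      then show ?thesis using 2 p h1[of r] by (auto simp: slots_def pt_def base_def times_main)
    next
      case 3
      then show ?thesis using p h1[of r] times_spacer[of "h r" j]
        by (auto simp: slots_def pt_def base_def spacer_times_def)
    qed
  qed
  moreover have "int (2 * R) \<le> \<bar>int (snd p) - int (snd q)\<bar>"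
    if pq: "p \<in> pt ` ?I" "q \<in> pt ` ?I" "p \<noteq> q" and near: "fst p \<le> Suc (fst q)" "fst q \<le> Suc (fst p)" for p q
  proof -
    obtain i where i: "i \<in> ?I" "p = pt i" using pq(1) by (rule imageE)
    obtain i' where i': "i' \<in> ?I" "q = pt i'" using pq(2) by (rule imageE)
    have "i \<noteq> i'" using pq(3) i(2) i'(2) by blast
    from far'[OF i(1) i'(1) this] near show ?thesis unfolding i(2) i'(2) by blast
  qed
  ultimately have "selection (4 * m) times (2 * R) (pt ` ?I)"
    unfolding selection_def by blast
  moreover have "card (pt ` ?I) = 3 * m * R" using card_image[OF inj] by (simp add: card_cartesian_product)
  ultimately show ?thesis by blast
qed

text \<open>Pigeonholes: for each clause and row, the lower half and the upper half of the main
  edges, and the spacer edges. Two points of one cell are on equal or adjacent edges and less than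
  \<open>R\<close> apart in \<open>x\<close>, so a selection has at most one of them, and one of
  size \<open>3 * m * R\<close> has exactly one in every cell.\<close>

definition cell :: "nat \<times> nat \<Rightarrow> nat \<times> nat \<times> nat" where
  "cell p = (fst p div 4, (snd p div 2) div (2 * R),
     if fst p mod 4 < 2 then (snd p div 2) mod (2 * R) div R else 2)"

text \<open>The least \<open>r\<close> with \<open>f r \<le> r\<close> is fixed: otherwise
  \<open>f r\<close> would be a smaller one, by monotonicity.\<close>

lemma monotone_fixed_point:
  fixes f :: "nat \<Rightarrow> nat"
  assumes "\<And>r. r < n \<Longrightarrow> f r < n" "\<And>r. Suc r < n \<Longrightarrow> f r \<le> f (Suc r)" "1 \<le> n"
  shows "\<exists>r < n. f r = r"
proof -
  have mono: "f r \<le> f s" if "r \<le> s" "s < n" for r s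
    using that
  proof (induction s)
    case (Suc s)
    show ?case
    proof (cases "r = Suc s")
      case False
      then have "f r \<le> f s" using Suc by auto
      then show ?thesis using assms(2)[of s] Suc.prems by simp
    qed simp
  qed simp
  define r where "r = (LEAST r. f r \<le> r \<and> r < n)"
  have a: "f (n - 1) \<le> n - 1 \<and> n - 1 < n" using assms(1)[of "n - 1"] assms(3) by simp
  have r: "f r \<le> r \<and> r < n"
    unfolding r_def by (rule LeastI[of "\<lambda>r. f r \<le> r \<and> r < n", OF a])
  have "f r = r"
  proof (rule ccontr)
    assume "f r \<noteq> r"
    then have l: "f r < r" using r by simp
    then have "f (f r) \<le> f r \<and> f r < n" using mono[of "f r" r] r by simp
    then have "r \<le> f r" unfolding r_def by (rule Least_le)
    then show False using l by simp
  qed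
  then show ?thesis using r by blast
qed

text \<open>Fullness gives a lower, an upper and a spacer rectangle for each clause and row, with
  horizontal shifts \<open>hl\<close>, \<open>hm\<close>, \<open>hs\<close> and vertical shifts
  \<open>vl\<close>, \<open>vm\<close>. Separation becomes inequalities: \<open>hm\<close> is
  nondecreasing in the clause and \<open>vm\<close> in the row, and a fixed point of
  \<open>vm j\<close> is a literal that satisfies clause \<open>j\<close>.\<close>

lemma selection_imp_sat:
  assumes S: "selection (4 * m) times (2 * R) S" and card: "3 * m * R \<le> card S"
  shows "\<exists>\<alpha>. \<forall>j < m. \<exists>v \<in> C j. \<alpha> v = sgn j"
proof -
  have SS: "S \<subseteq> slots (4 * m) times" using S by (simp add: selection_def)
  have apart: "R \<le> x' - x \<or> R \<le> x - x'"
    if "(i, 2 * x + 1) \<in> S" "(i', 2 * x' + 1) \<in> S" "i \<le> Suc i'" "i' \<le> Suc i" "(i, x) \<noteq> (i', x')" for i i' x x'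
  proof -
    have "int (2 * R) \<le> \<bar>int (2 * x + 1) - int (2 * x' + 1)\<bar>"
      using S that unfolding selection_def by fastforce
    then show ?thesis by linarith
  qed
  have form: "i < 4 * m \<and> (\<exists>x. t = 2 * x + 1 \<and> x div (2 * R) < R \<and>
      (i mod 4 < 2 \<longrightarrow> x mod (2 * R) < R \<or>
         (\<exists>v \<in> C (i div 4). x mod (2 * R) = R + v \<and> (v = x div (2 * R) \<longrightarrow> (i mod 4 = 1) = sgn (i div 4)))) \<and>
      (\<not> i mod 4 < 2 \<longrightarrow> x mod (2 * R) = R))" if "(i, t) \<in> S" for i t
  proof -
    have it: "i < 4 * m" "t \<in> times i" using that SS by (auto simp: slots_def)
    have dm: "(2 * r * R + w) div (2 * R) = r" "(2 * r * R + w) mod (2 * R) = w" if "w < 2 * R" for r w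
    proof -
      have e: "2 * r * R + w = w + r * (2 * R)" by simp
      show "(2 * r * R + w) div (2 * R) = r" "(2 * r * R + w) mod (2 * R) = w"
        unfolding e using that R by auto
    qed
    show ?thesis
    proof (cases "i mod 4 < 2")
      case True
      then have "t \<in> main_times (i div 4) (i mod 4)" using it by (simp add: times_def)
      then consider (a) r v where "t = 2 * (2 * r * R + v) + 1" "r < R" "v < R"
        | (b) r v where "t = 2 * (2 * r * R + (R + v)) + 1" "r < R" "v \<in> C (i div 4)"
            "v = r \<longrightarrow> (i mod 4 = 1) = sgn (i div 4)"
        unfolding main_times_def by (auto simp: add.assoc)
      then show ?thesis
      proof cases
        case a
        then show ?thesis using True it(1) dm[of v r] by (intro conjI exI[of _ "2 * r * R + v"]) auto
      next
        case b
        have "i div 4 < m" using it(1) by auto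
        then have "v < R" using C b(3) by auto
        then show ?thesis using b True it(1) dm[of "R + v" r]
          by (intro conjI exI[of _ "2 * r * R + (R + v)"]) auto
      qed
    next
      case False
      then have "t \<in> spacer_times" using it by (simp add: times_def)
      then obtain r where "t = 2 * (2 * r * R + R) + 1" "r < R" unfolding spacer_times_def by auto
      then show ?thesis using False it(1) dm[of R r] R by (intro conjI exI[of _ "2 * r * R + R"]) auto
    qed
  qed
  have inj: "inj_on cell S"
  proof (rule inj_onI, rule ccontr)
    fix p q assume pq: "p \<in> S" "q \<in> S" and eq: "cell p = cell q" "p \<noteq> q"
    obtain i t i' t' where p: "p = (i, t)" "q = (i', t')" by fastforce
    obtain x where x: "t = 2 * x + 1" using form[of i t] pq p by auto
    obtain x' where x': "t' = 2 * x' + 1" using form[of i' t'] pq p by auto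
    have d: "i div 4 = i' div 4" "x div (2 * R) = x' div (2 * R)" "(i mod 4 < 2) = (i' mod 4 < 2)"
      using eq(1) unfolding cell_def p x x'
      by (auto split: if_splits)
        (metis R div_less_iff_less_mult gr0I less_mult_imp_div_less mod_less_divisor mult_is_0 nat_less_le not_one_le_zero zero_neq_numeral)+
    have b: "x mod (2 * R) div R = x' mod (2 * R) div R"
    proof (cases "i mod 4 < 2")
      case True
      then show ?thesis using eq(1) d(3) unfolding cell_def p x x' by simp
    next
      case False
      then show ?thesis using form[of i t] form[of i' t'] pq d(3) unfolding p x x' by auto
    qed
    have "x = x div (2 * R) * (2 * R) + (x mod (2 * R) div R * R + x mod (2 * R) mod R)"
      by (simp only: div_mult_mod_eq)
    moreover have "x' = x div (2 * R) * (2 * R) + (x mod (2 * R) div R * R + x' mod (2 * R) mod R)"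
      unfolding b d(2) by (simp only: div_mult_mod_eq)
    moreover have "x mod (2 * R) mod R < R" "x' mod (2 * R) mod R < R" using R by auto
    ultimately obtain u w w' where "x = u + w" "x' = u + w'" "w < R" "w' < R"
      by (metis add.assoc)
    then have "\<not> R \<le> x' - x" "\<not> R \<le> x - x'" by auto
    moreover have "i \<le> Suc i'" "i' \<le> Suc i"
    proof -
      have "i = i div 4 * 4 + i mod 4" "i' = i div 4 * 4 + i' mod 4" "i mod 4 < 4" "i' mod 4 < 4"
        using div_mult_mod_eq[of i 4] div_mult_mod_eq[of i' 4] d(1) by simp_all
      then show "i \<le> Suc i'" "i' \<le> Suc i" using d(3) by linarith+
    qed
    moreover have "(i, 2 * x + 1) \<in> S" "(i', 2 * x' + 1) \<in> S" "(i, x) \<noteq> (i', x')"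
      using pq eq(2) unfolding p x x' by auto
    ultimately show False using apart by blast
  qed
  have sub: "cell ` S \<subseteq> {..<m} \<times> {..<R} \<times> {..<3}"
  proof
    fix c assume "c \<in> cell ` S"
    then obtain i t where it: "(i, t) \<in> S" "c = cell (i, t)" by auto
    obtain x where x: "t = 2 * x + 1" "x div (2 * R) < R" "i < 4 * m" using form[OF it(1)] by auto
    have "x mod (2 * R) div R < 2" using R by (simp add: div_less_iff_less_mult mult.commute)
    then show "c \<in> {..<m} \<times> {..<R} \<times> {..<3}" using x by (auto simp: it(2) cell_def)
  qed
  have onto: "cell ` S = {..<m} \<times> {..<R} \<times> {..<3}"
  proof (rule card_subset_eq[OF _ sub])
    have "card (cell ` S) \<le> 3 * m * R"
      using card_mono[OF _ sub] by (simp add: card_cartesian_product)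
    then show "card (cell ` S) = card ({..<m} \<times> {..<R} \<times> {..<3 :: nat})"
      using card card_image[OF inj] by (simp add: card_cartesian_product)
  qed simp
  have get: "\<exists>i x. (i, 2 * x + 1) \<in> S \<and> i div 4 = j \<and> x div (2 * R) = r \<and>
      (if i mod 4 < 2 then x mod (2 * R) div R else 2) = k" if "j < m" "r < R" "k < 3" for j r k
  proof -
    have "(j, r, k) \<in> cell ` S" using onto that by simp
    then obtain i t where "(i, t) \<in> S" "cell (i, t) = (j, r, k)" by force
    moreover then obtain x where "t = 2 * x + 1" using form by blast
    ultimately show ?thesis by (intro exI[of _ i] exI[of _ x]) (auto simp: cell_def)
  qed
  have split4: "i = 4 * (i div 4) + i mod 4" "x = 2 * (x div (2 * R)) * R + x mod (2 * R)" for i x :: nat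
  proof -
    have "2 * d * R = 2 * R * d" for d by simp
    then show "x = 2 * (x div (2 * R)) * R + x mod (2 * R)" by (simp only: mult_div_mod_eq)
  qed simp
  have "\<exists>h v. h \<le> 1 \<and> v < R \<and> (4 * j + h, 2 * (2 * r * R + v) + 1) \<in> S" if "j < m" "r < R" for j r
  proof -
    obtain i x where *: "(i, 2 * x + 1) \<in> S" "i div 4 = j" "x div (2 * R) = r"
      "(if i mod 4 < 2 then x mod (2 * R) div R else 2) = 0" using get[OF \<open>j < m\<close> \<open>r < R\<close>, of 0] by auto
    then have "i mod 4 \<le> 1" "x mod (2 * R) < R" using R by (auto split: if_splits simp: div_eq_0_iff)
    moreover have "i = 4 * j + i mod 4" "x = 2 * r * R + x mod (2 * R)" using split4(1)[of i] split4(2)[of x] * by auto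
    ultimately show ?thesis using *(1) by (intro exI[of _ "i mod 4"] exI[of _ "x mod (2 * R)"]) auto
  qed
  then obtain hl vl where l: "\<And>j r. j < m \<Longrightarrow> r < R \<Longrightarrow> hl j r \<le> 1 \<and> vl j r < R \<and>
      (4 * j + hl j r, 2 * (2 * r * R + vl j r) + 1) \<in> S" by metis
  have "\<exists>h v. h \<le> 1 \<and> v \<in> C j \<and> (v = r \<longrightarrow> (h = 1) = sgn j) \<and>
      (4 * j + h, 2 * (2 * r * R + (R + v)) + 1) \<in> S" if "j < m" "r < R" for j r
  proof -
    obtain i x where *: "(i, 2 * x + 1) \<in> S" "i div 4 = j" "x div (2 * R) = r"
      "(if i mod 4 < 2 then x mod (2 * R) div R else 2) = 1" using get[OF \<open>j < m\<close> \<open>r < R\<close>, of 1] by auto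
    then have i: "i mod 4 \<le> 1" "\<not> x mod (2 * R) < R" by (auto split: if_splits)
    then obtain v where v: "v \<in> C j" "x mod (2 * R) = R + v" "v = r \<longrightarrow> (i mod 4 = 1) = sgn j"
      using form[OF *(1)] * by auto
    moreover have "i = 4 * j + i mod 4" "x = 2 * r * R + x mod (2 * R)" using split4(1)[of i] split4(2)[of x] * by auto
    ultimately show ?thesis using *(1) i by (intro exI[of _ "i mod 4"] exI[of _ v]) auto
  qed
  then obtain hm vm where mn: "\<And>j r. j < m \<Longrightarrow> r < R \<Longrightarrow> hm j r \<le> 1 \<and> vm j r \<in> C j \<and>
      (vm j r = r \<longrightarrow> (hm j r = 1) = sgn j) \<and>
      (4 * j + hm j r, 2 * (2 * r * R + (R + vm j r)) + 1) \<in> S" by metis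
  have "\<exists>h. h \<le> 1 \<and> (4 * j + 2 + h, 2 * (2 * r * R + R) + 1) \<in> S" if "j < m" "r < R" for j r
  proof -
    obtain i x where *: "(i, 2 * x + 1) \<in> S" "i div 4 = j" "x div (2 * R) = r"
      "(if i mod 4 < 2 then x mod (2 * R) div R else 2) = 2" using get[OF \<open>j < m\<close> \<open>r < R\<close>, of 2] by auto
    have "x mod (2 * R) div R < 2" using R by (simp add: div_less_iff_less_mult mult.commute)
    then have i: "\<not> i mod 4 < 2" using *(4) by (auto split: if_splits)
    then have "x mod (2 * R) = R" using form[OF *(1)] by auto
    moreover have "i = 4 * j + i mod 4" "x = 2 * r * R + x mod (2 * R)" using split4(1)[of i] split4(2)[of x] * by auto
    moreover have "i mod 4 - 2 \<le> 1" "i mod 4 = 2 + (i mod 4 - 2)" using i by presburger+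
    ultimately show ?thesis using *(1) by (intro exI[of _ "i mod 4 - 2"]) (metis add.assoc)
  qed
  then obtain hs where s: "\<And>j r. j < m \<Longrightarrow> r < R \<Longrightarrow> hs j r \<le> 1 \<and>
      (4 * j + 2 + hs j r, 2 * (2 * r * R + R) + 1) \<in> S" by metis
  have vmR: "vm j r < R" if "j < m" "r < R" for j r using mn[OF that] C[OF that(1)] by auto
  \<comment> \<open>Edges \<open>4 * j + 1\<close> and \<open>4 * j + 2\<close> are adjacent and the
    two times are less than \<open>R\<close> apart in \<open>x\<close>, so a clause shifted to the
    right pushes its spacer; \<open>hor2\<close> is the same at the next boundary.\<close>
  have hor1: "hm j r \<le> hs j r" if "j < m" "r < R" for j r
  proof (rule ccontr)
    assume "\<not> ?thesis"
    then have "hm j r = 1" "hs j r = 0" using mn[OF that] by auto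
    then have "(4 * j + 1, 2 * (2 * r * R + (R + vm j r)) + 1) \<in> S" "(4 * j + 2, 2 * (2 * r * R + R) + 1) \<in> S"
      using mn[OF that] s[OF that] by auto
    from apart[OF this] show False using vmR[OF that] R by auto
  qed
  have hor2: "hs j r \<le> hm (Suc j) r" if "Suc j < m" "r < R" for j r
  proof (rule ccontr)
    assume "\<not> ?thesis"
    then have "hm (Suc j) r = 0" "hs j r = 1" using s[of j r] that by auto
    then have "(4 * Suc j, 2 * (2 * r * R + (R + vm (Suc j) r)) + 1) \<in> S" "(4 * j + 3, 2 * (2 * r * R + R) + 1) \<in> S"
      using mn[OF that] s[of j r] that by (auto simp: eval_nat_numeral)
    from apart[OF this] show False using vmR[OF that] R by auto
  qed
  have hor: "hm i r \<le> hm j r" if "i \<le> j" "j < m" "r < R" for i j r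
    using that
  proof (induction j)
    case (Suc j)
    show ?case
    proof (cases "i = Suc j")
      case False
      then have "hm i r \<le> hm j r" using Suc by auto
      then show ?thesis using hor1[of j r] hor2[of j r] Suc.prems by simp
    qed simp
  qed simp
  \<comment> \<open>The two edges of a clause are adjacent, so its rectangles are stacked whatever
    their horizontal shifts.\<close>
  have ver1: "vl j r \<le> vm j r" if "j < m" "r < R" for j r
  proof -
    have "R \<le> 2 * r * R + (R + vm j r) - (2 * r * R + vl j r) \<or> R \<le> 2 * r * R + vl j r - (2 * r * R + (R + vm j r))"
      by (rule apart[of "4 * j + hl j r" _ "4 * j + hm j r"]) (use l[OF that] mn[OF that] in auto)
    then show ?thesis using l[OF that] by auto
  qed
  have ver2: "vm j r \<le> vl j (Suc r)" if "j < m" "Suc r < R" for j r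
  proof -
    have r: "r < R" using that by simp
    have "R \<le> 2 * Suc r * R + vl j (Suc r) - (2 * r * R + (R + vm j r)) \<or>
        R \<le> 2 * r * R + (R + vm j r) - (2 * Suc r * R + vl j (Suc r))"
      by (rule apart[of "4 * j + hm j r" _ "4 * j + hl j (Suc r)"])
        (use mn[OF that(1) r] l[OF that] vmR[OF that(1) r] in auto)
    then show ?thesis using vmR[OF that(1) r] by auto
  qed
  \<comment> \<open>A variable is true iff it is a fixed point of some positive clause. A negative
    clause with the same fixed point has horizontal shift 0 in that row, against the 1 inherited
    from the positive clause on its left.\<close>
  define \<alpha> where "\<alpha> = (\<lambda>r. \<exists>j < m. sgn j \<and> r < R \<and> vm j r = r)"
  have "\<exists>v \<in> C j. \<alpha> v = sgn j" if j: "j < m" for j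
  proof -
    have "\<exists>r < R. vm j r = r"
    proof (rule monotone_fixed_point)
      fix r assume "Suc r < R"
      then show "vm j r \<le> vm j (Suc r)" using ver2[OF j] ver1[OF j, of "Suc r"] le_trans by blast
    qed (use vmR[OF j] R in auto)
    then obtain r where r: "r < R" "vm j r = r" by blast
    have "\<alpha> r = sgn j"
    proof (cases "sgn j")
      case True
      then show ?thesis using j r unfolding \<alpha>_def by blast
    next
      case False
      have "\<not> \<alpha> r"
      proof
        assume "\<alpha> r"
        then obtain i where i: "i < m" "sgn i" "vm i r = r" unfolding \<alpha>_def by blast
        then have "i < j" using sorted[of j i] False by (metis linorder_neqE_nat)
        then have "hm i r \<le> hm j r" using hor j r by simp
        moreover have "hm i r = 1" using mn[OF i(1) r(1)] i by simp
        moreover have "hm j r \<noteq> 1" using mn[OF j r(1)] r False by simp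
        ultimately show False using mn[OF j r(1)] by simp
      qed
      then show ?thesis using False by simp
    qed
    moreover have "r \<in> C j" using mn[OF j r(1)] r by simp
    ultimately show ?thesis by blast
  qed
  then show ?thesis by blast
qed

end

subsection \<open>Unique readability of the encoding\<close>

definition prefix_free :: "('a \<Rightarrow> bool list) \<Rightarrow> bool" where
  "prefix_free e \<longleftrightarrow> (\<forall>x y r s. e x @ r = e y @ s \<longrightarrow> x = y \<and> r = s)"

lemma prefix_freeD: "prefix_free e \<Longrightarrow> e x @ r = e y @ s \<Longrightarrow> x = y \<and> r = s"
  unfolding prefix_free_def by blast

lemma encode_list_simps:
  "encode_list e [] = [False]" "encode_list e (x # xs) = True # e x @ encode_list e xs"
  by (auto simp: encode_list_def)

lemma prefix_free_list:
  assumes "prefix_free e"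
  shows "prefix_free (encode_list e)"
proof -
  have "encode_list e xs @ r = encode_list e ys @ s \<Longrightarrow> xs = ys \<and> r = s" for xs ys r s
  proof (induction xs arbitrary: ys)
    case Nil
    then show ?case by (cases ys) (auto simp: encode_list_simps)
  next
    case (Cons x xs)
    then obtain y ys' where ys: "ys = y # ys'" by (cases ys) (auto simp: encode_list_simps)
    with Cons.prems have "e x @ (encode_list e xs @ r) = e y @ (encode_list e ys' @ s)"
      by (simp add: encode_list_simps)
    from prefix_freeD[OF assms this] Cons.IH show ?case unfolding ys by blast
  qed
  then show ?thesis unfolding prefix_free_def by blast
qed

lemma prefix_free_nat: "prefix_free encode_nat"
proof -
  have "prefix_free (\<lambda>b. [b])" by (auto simp: prefix_free_def)
  from prefix_free_list[OF this] show ?thesis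
    unfolding prefix_free_def encode_nat_def by (metis val_bits)
qed

lemma prefix_free_entry: "prefix_free encode_edge_entry"
  unfolding prefix_free_def
proof (intro allI impI)
  fix x y :: edge_entry and r s
  obtain u v ts where x: "x = ((u, v), ts)" by (metis prod.collapse)
  obtain u' v' ts' where y: "y = ((u', v'), ts')" by (metis prod.collapse)
  assume "encode_edge_entry x @ r = encode_edge_entry y @ s"
  then have "encode_nat u @ (encode_nat v @ (encode_list encode_nat ts @ r)) =
      encode_nat u' @ (encode_nat v' @ (encode_list encode_nat ts' @ s))"
    by (simp add: x y encode_edge_entry_def)
  note 1 = prefix_freeD[OF prefix_free_nat this]
  note 2 = prefix_freeD[OF prefix_free_nat conjunct2[OF 1]]
  note 3 = prefix_freeD[OF prefix_free_list[OF prefix_free_nat] conjunct2[OF 2]]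
  show "x = y \<and> r = s" using 1 2 3 by (simp add: x y)
qed

lemma encode_input_inj:
  assumes "encode_input vs es k a b = encode_input vs' es' k' a' b'"
  shows "vs = vs' \<and> es = es' \<and> k = k' \<and> a = a' \<and> b = b'"
proof -
  note 1 = prefix_freeD[OF prefix_free_list[OF prefix_free_nat] assms[unfolded encode_input_def]]
  note 2 = prefix_freeD[OF prefix_free_list[OF prefix_free_entry] conjunct2[OF 1]]
  note 3 = prefix_freeD[OF prefix_free_nat conjunct2[OF 2]]
  note 4 = prefix_freeD[OF prefix_free_nat conjunct2[OF 3]]
  have 5: "encode_nat b @ [] = encode_nat b' @ []" using 4 by simp
  note 5 = prefix_freeD[OF prefix_free_nat 5]
  show ?thesis using 1 2 3 4 5 by blast
qed

lemma presents_time_edges: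
  assumes "presents vs es G"
  shows "time_edges G = {(e, t). \<exists>u v ts. ((u, v), ts) \<in> set es \<and> e = {u, v} \<and> t \<in> set ts}"
proof -
  have e: "edges G = (\<lambda>((u, v), ts). {u, v}) ` set es" and
    a: "\<And>u v ts. ((u, v), ts) \<in> set es \<Longrightarrow> set ts = appearances G {u, v}"
    using assms unfolding presents_def by (simp, blast)
  show ?thesis
  proof (intro set_eqI iffI)
    fix p assume p: "p \<in> time_edges G"
    then obtain f t where p': "p = (f, t)" "f \<in> edges G" "t \<in> appearances G f" by (auto simp: time_edges_def)
    then obtain u v ts where uv: "((u, v), ts) \<in> set es" "f = {u, v}" unfolding e by auto
    then have "t \<in> set ts" using a p' by simp
    then show "p \<in> {(e, t). \<exists>u v ts. ((u, v), ts) \<in> set es \<and> e = {u, v} \<and> t \<in> set ts}"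
      using uv p'(1) by blast
  next
    fix p assume "p \<in> {(e, t). \<exists>u v ts. ((u, v), ts) \<in> set es \<and> e = {u, v} \<and> t \<in> set ts}"
    then obtain u v ts t where "p = ({u, v}, t)" "((u, v), ts) \<in> set es" "t \<in> set ts" by auto
    then show "p \<in> time_edges G" using a unfolding time_edges_def e by force
  qed
qed

lemma presents_ETC:
  assumes "presents vs es G" "presents vs es H"
  shows "ETC G k a b = ETC H k a b"
  using assms by (intro ETC_cong) (simp_all add: presents_time_edges, auto simp: presents_def)

lemma underlying_path_path_graph: "underlying_path (path_graph E A)"
  unfolding underlying_path_def path_graph_def
proof (intro exI[of _ "[0..<Suc E]"] conjI)
  show "edges \<lparr>verts = {..E}, edges = (\<lambda>i. {i, Suc i}) ` {..<E}, appearances = \<lambda>e. A (Min e)\<rparr> =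
      {{[0..<Suc E] ! i, [0..<Suc E] ! Suc i} | i. Suc i < length [0..<Suc E]}"
  proof -
    have "{[0..<Suc E] ! i, [0..<Suc E] ! Suc i} = {i, Suc i}" if "i < E" for i
      using that by (simp del: upt_Suc)
    then have "(\<lambda>i. {i, Suc i}) ` {..<E} = (\<lambda>i. {[0..<Suc E] ! i, [0..<Suc E] ! Suc i}) ` {..<E}"
      by (intro image_cong) auto
    also have "\<dots> = {{[0..<Suc E] ! i, [0..<Suc E] ! Suc i} | i. Suc i < length [0..<Suc E]}"
      by (auto simp del: upt_Suc nth_upt)
    finally show ?thesis by simp
  qed
qed auto

subsection \<open>Reducing monotone satisfiability to editing paths\<close>

definition dedup :: "'a list \<Rightarrow> 'a list" where
  "dedup xs = foldl (\<lambda>acc a. if a \<in> set acc then acc else a # acc) [] xs"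

lemma dedup: "set (dedup xs) = set xs" "distinct (dedup xs)"
proof -
  have "set (foldl (\<lambda>acc a. if a \<in> set acc then acc else a # acc) ys xs) = set ys \<union> set xs \<and>
      (distinct ys \<longrightarrow> distinct (foldl (\<lambda>acc a. if a \<in> set acc then acc else a # acc) ys xs))" for ys
    by (induction xs arbitrary: ys) (auto split: if_splits)
  from this[of "[]"] show "set (dedup xs) = set xs" "distinct (dedup xs)" by (auto simp: dedup_def)
qed

lemma fp_dedup: "fp L \<Longrightarrow> fp (\<lambda>x. dedup (L x))"
proof -
  have "fp (\<lambda>x :: 'b list. foldl (\<lambda>acc a. if a \<in> set acc then acc else a # acc) [] x)"
  proof (rule fp_foldl_grow[where r = "\<lambda>n. Suc n" and g = "\<lambda>x a acc. if a \<in> set acc then acc else a # acc"])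
    show "sz (if a \<in> set acc then acc else a # acc) \<le> sz acc + Suc (sz x)" if "a \<in> set x"
      for x :: "'b list" and a acc using sz_member[OF that] by simp
  qed (intro fp_intros pb_intros)+
  then have "fp (dedup :: 'b list \<Rightarrow> _)" by (rule fp_recode) (simp add: dedup_def)
  then show "fp L \<Longrightarrow> fp (\<lambda>x. dedup (L x))" by (rule fp_comp)
qed

text \<open>Rows are positions in \<open>vars\<close>. \<open>dedup\<close> supplies the
  distinctness that \<open>presents\<close> requires of appearance times.\<close>

definition main_list :: "'v list \<Rightarrow> bool \<Rightarrow> 'v list \<Rightarrow> bool \<Rightarrow> nat list" where
  "main_list vars s C h = dedup (concat (map (\<lambda>r.
     map (\<lambda>v. 2 * (2 * r * length vars + v) + 1) [0..<length vars] @
     map (\<lambda>p. 2 * (2 * r * length vars + length vars + fst p) + 1)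
       (filter (\<lambda>p. snd p \<in> set C \<and> (fst p = r \<longrightarrow> h = s)) (zip [0..<length vars] vars)))
     [0..<length vars]))"

definition spacer_list :: "'v list \<Rightarrow> nat list" where
  "spacer_list vars = dedup (map (\<lambda>r. 2 * (2 * r * length vars + length vars) + 1) [0..<length vars])"

definition clauses :: "'v list list \<times> 'v list list \<Rightarrow> (bool \<times> 'v list) list" where
  "clauses I = map (Pair True) (fst I) @ map (Pair False) (snd I)"

definition variables :: "'v list list \<times> 'v list list \<Rightarrow> 'v list" where
  "variables I = dedup (concat (fst I @ snd I))"

definition entries :: "'v list \<Rightarrow> (bool \<times> 'v list) list \<Rightarrow> edge_entry list" where
  "entries vars cs = concat (map (\<lambda>(j, s, C).
     [((4 * j, Suc (4 * j)), main_list vars s C False),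
      ((Suc (4 * j), Suc (Suc (4 * j))), main_list vars s C True),
      ((Suc (Suc (4 * j)), Suc (Suc (Suc (4 * j)))), spacer_list vars),
      ((Suc (Suc (Suc (4 * j))), Suc (Suc (Suc (Suc (4 * j))))), spacer_list vars)])
     (zip [0..<length cs] cs))"

text \<open>Everything outside a full packing is to be deleted. The subtraction is done in unary, by
  \<open>drop\<close>, on the list of all times.\<close>

definition budget :: "'v list \<Rightarrow> (bool \<times> 'v list) list \<Rightarrow> nat" where
  "budget vars cs = length (drop (length (concat (map (\<lambda>_. concat (map (\<lambda>_. [True, True, True]) vars)) cs)))
     (concat (map snd (entries vars cs))))"

definition path_instance :: "'v list list \<times> 'v list list \<Rightarrow> bool list" where
  "path_instance I =
     (let vars = variables I; cs = clauses I in
      encode_input [0..<length (True # concat (map (\<lambda>_. [True, True, True, True]) cs))]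
        (entries vars cs) (budget vars cs) 1 (2 * length vars))"

lemma fp_main_list:
  "fp V \<Longrightarrow> fp S \<Longrightarrow> fp C \<Longrightarrow> fp H \<Longrightarrow> fp (\<lambda>x. main_list (V x) (S x) (C x) (H x))"
proof -
  assume *: "fp V" "fp S" "fp C" "fp H"
  note c = fp_comp[OF *(1)] fp_comp[OF *(2)] fp_comp[OF *(3)] fp_comp[OF *(4)]
  show ?thesis unfolding main_list_def
    by (intro fp_dedup fp_concat fp_map fp_append fp_filter fp_conj fp_imp fp_eq fp_member fp_add fp_mult
        fp_zip fp_upt_length fp_length fp_const * c fp_fst fp_snd fp_id)
qed

lemma fp_spacer_list: "fp V \<Longrightarrow> fp (\<lambda>x. spacer_list (V x))"
proof -
  assume *: "fp V"
  note c = fp_comp[OF *]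
  show ?thesis unfolding spacer_list_def
    by (intro fp_dedup fp_map fp_add fp_mult fp_upt_length fp_length fp_const * c fp_fst fp_snd fp_id)
qed

lemma fp_entries: "fp V \<Longrightarrow> fp S \<Longrightarrow> fp (\<lambda>x. entries (V x) (S x))"
proof -
  assume *: "fp V" "fp S"
  note c = fp_comp[OF *(1)] fp_comp[OF *(2)]
  show ?thesis unfolding entries_def case_prod_beta
    by (intro fp_concat fp_map fp_Cons fp_pair fp_Suc fp_main_list fp_spacer_list fp_add fp_mult
        fp_zip fp_upt_length fp_length fp_const * c fp_fst fp_snd fp_id)
qed

lemma fp_encode_input:
  "fp vs \<Longrightarrow> fp es \<Longrightarrow> fp k \<Longrightarrow> fp a \<Longrightarrow> fp b \<Longrightarrow>
   fp (\<lambda>x. encode_input (vs x) (es x) (k x) (a x) (b x))"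
  unfolding encode_input_def encode_edge_entry_def case_prod_beta
  by (intro fp_append fp_encode_list fp_encode_nat fp_fst fp_snd fp_id)

lemma fp_clauses: "fp f \<Longrightarrow> fp (\<lambda>x. clauses (f x))"
  unfolding clauses_def by (intro fp_append fp_map fp_pair fp_const fp_fst fp_snd fp_id)

lemma fp_variables: "fp f \<Longrightarrow> fp (\<lambda>x. variables (f x))"
  unfolding variables_def by (intro fp_append fp_dedup fp_concat fp_fst fp_snd)

lemma fp_budget: "fp V \<Longrightarrow> fp S \<Longrightarrow> fp (\<lambda>x. budget (V x) (S x))"
proof -
  assume *: "fp V" "fp S"
  note c = fp_comp[OF *(1)] fp_comp[OF *(2)]
  show ?thesis unfolding budget_def
    by (intro fp_length fp_drop_length fp_concat fp_map fp_entries fp_const * c fp_fst fp_snd fp_id)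
qed

lemma fp_path_instance: "fp f \<Longrightarrow> fp (\<lambda>x. path_instance (f x))"
  unfolding path_instance_def Let_def
  by (intro fp_encode_input fp_upt_length fp_Cons fp_const fp_concat fp_map fp_clauses fp_entries
      fp_variables fp_budget fp_mult fp_length)

definition satisfiable :: "'v list list \<times> 'v list list \<Rightarrow> bool" where
  "satisfiable I \<longleftrightarrow> (\<exists>\<alpha>. (\<forall>C \<in> set (fst I). \<exists>v \<in> set C. \<alpha> v) \<and> (\<forall>C \<in> set (snd I). \<exists>v \<in> set C. \<not> \<alpha> v))"

lemma concat_four:
  "concat (map (\<lambda>j. [g (4 * j), g (Suc (4 * j)), g (Suc (Suc (4 * j))), g (Suc (Suc (Suc (4 * j))))]) [0..<m]) =
   map g [0..<4 * m]"
proof (induction m)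
  case (Suc m)
  have "4 * Suc m = Suc (Suc (Suc (Suc (4 * m))))" by simp
  then have "[0..<4 * Suc m] = [0..<4 * m] @ [4 * m, Suc (4 * m), Suc (Suc (4 * m)), Suc (Suc (Suc (4 * m)))]"
    by (simp only: upt_Suc) simp
  then show ?case using Suc by simp
qed simp

lemma zip_upt: "zip [0..<length xs] xs = map (\<lambda>j. (j, xs ! j)) [0..<length xs]"
  by (rule nth_equalityI) auto

lemma set_main_list:
  fixes vars :: "'v list"
  defines "n \<equiv> length vars"
  shows "set (main_list vars s C h) =
      {2 * (2 * r * n + v) + 1 | r v. r < n \<and> v < n} \<union>
      {2 * (2 * r * n + n + v) + 1 | r v. r < n \<and> v < n \<and> vars ! v \<in> set C \<and> (v = r \<longrightarrow> h = s)}"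
proof -
  have A: "set (map f [0..<k]) = {f v | v. v < k}" for f :: "nat \<Rightarrow> nat" and k by auto
  have B: "set (map g (filter Q (zip [0..<length vars] vars))) =
      {g (v, vars ! v) | v. v < length vars \<and> Q (v, vars ! v)}" for g :: "nat \<times> 'v \<Rightarrow> nat" and Q
    by (auto simp: zip_upt)
  have C: "set (concat (map F [0..<k])) = (\<Union>r \<in> {..<k}. set (F r))" for F :: "nat \<Rightarrow> nat list" and k
    by auto
  have D: "(\<Union>r \<in> {..<k}. {f r v | v. S r v} \<union> {g r v | v. Q r v}) =
      {f r v | r v. r < k \<and> S r v} \<union> {g r v | r v. r < k \<and> Q r v}"
    for f g :: "nat \<Rightarrow> nat \<Rightarrow> nat" and S Q and k :: nat by auto
  show ?thesis unfolding main_list_def dedup(1) C set_append A B fst_conv snd_conv n_def by (rule D)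
qed

text \<open>Leaving \<open>P\<close> open covers the unrestricted problem and the one on paths at
  once. The assumptions on \<open>I\<close> provide at least one clause and one variable.\<close>

theorem path_instance:
  assumes P: "\<And>E A. P (path_graph E A)"
    and ne: "fst I \<noteq> []" "\<And>C. C \<in> set (fst I) \<Longrightarrow> C \<noteq> []"
  shows "path_instance I \<in> ETC_language P \<longleftrightarrow> satisfiable I"
proof -
  define vars where "vars = variables I"
  define cs where "cs = clauses I"
  define R where "R = length vars"
  define m where "m = length cs"
  define C where "C = (\<lambda>j. {r. r < R \<and> vars ! r \<in> set (snd (cs ! j))})"
  \<comment> \<open>Beyond \<open>m\<close> the entry \<open>cs ! j\<close> is unspecified; the
    conjunct makes the sign false there, as the ordering assumption of the locale ranges over all
    indices.\<close>
  define sgn where "sgn = (\<lambda>j. fst (cs ! j) \<and> j < m)"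
  have dv: "distinct vars" and sv: "set vars = (\<Union>C \<in> set (fst I) \<union> set (snd I). set C)"
    unfolding vars_def variables_def by (auto simp: dedup)
  obtain C0 where C0: "C0 \<in> set (fst I)" using ne(1) by (cases "fst I") auto
  then obtain v0 where "v0 \<in> set C0" using ne(2) by (meson list.set_sel(1))
  then have "vars \<noteq> []" using C0 sv by fastforce
  then have R1: "1 \<le> R" by (simp add: R_def Suc_leI)
  have m1: "1 \<le> m" using ne(1) by (simp add: m_def cs_def clauses_def Suc_leI)
  interpret monotone_sat m R C sgn
  proof
    show "1 \<le> R" by fact
    show "C j \<subseteq> {..<R}" if "j < m" for j by (auto simp: C_def)
    show "sgn i" if "i < j" "sgn j" for i j
    proof -
      have "j < length (fst I)" using that(2) unfolding sgn_def cs_def clauses_def m_def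
        by (auto simp: nth_append split: if_splits)
      then show ?thesis using that(1) unfolding sgn_def cs_def clauses_def m_def
        by (auto simp: nth_append)
    qed
  qed
  have cs_sgn: "fst (cs ! j) = sgn j" if "j < m" for j using that by (simp add: sgn_def)
  define tlist where "tlist = (\<lambda>i. if i mod 4 < 2 then
      main_list vars (fst (cs ! (i div 4))) (snd (cs ! (i div 4))) (i mod 4 = 1) else spacer_list vars)"
  have es: "entries vars cs = map (\<lambda>i. ((i, Suc i), tlist i)) [0..<4 * m]"
  proof -
    have s: "Suc (4 * j) div 4 = j" "Suc (4 * j) mod 4 = 1" "Suc (Suc (4 * j)) mod 4 = 2"
      "Suc (Suc (Suc (4 * j))) mod 4 = 3" for j by presburger+
    show ?thesis
      unfolding entries_def zip_upt concat_four[symmetric] map_map m_def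
      by (intro arg_cong[of _ _ concat] map_cong refl) (simp add: case_prod_beta tlist_def s)
  qed
  have tset: "set (tlist i) = times i" if i: "i < 4 * m" for i
  proof (cases "i mod 4 < 2")
    case True
    have j: "i div 4 < m" using i by auto
    have h: "(i mod 4 = 1) = fst (cs ! (i div 4)) \<longleftrightarrow> (i mod 4 = 1) = sgn (i div 4)"
      using cs_sgn[OF j] by simp
    have "set (tlist i) = main_times (i div 4) (i mod 4)"
      unfolding tlist_def if_P[OF True] set_main_list h main_times_def R_def[symmetric]
      unfolding C_def mem_Collect_eq by (simp only: conj_assoc)
    then show ?thesis using True by (simp add: times_def)
  next
    case False
    then show ?thesis unfolding times_def tlist_def spacer_list_def spacer_times_def
      by (auto simp: R_def dedup(1))
  qed
  have tdist: "distinct (tlist i)" for i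
    by (simp add: tlist_def main_list_def spacer_list_def dedup)
  let ?G = "path_graph (4 * m) times"
  have fin: "finite (times i)" if "i < 4 * m" for i using tset[OF that] by (metis finite_set)
  have odd: "odd t" if "i < 4 * m" "t \<in> times i" for i t
    using that(2) by (auto simp: times_def main_times_def spacer_times_def split: if_splits)
  have cardR: "R \<le> card (times i)" if i: "i < 4 * m" for i
  proof -
    define c where "c = (if i mod 4 < 2 then 0 else R)"
    have "(\<lambda>r. 2 * (2 * r * R + c) + 1) ` {..<R} \<subseteq> times i"
      using R1 by (force simp: times_def main_times_def spacer_times_def c_def)
    moreover have "inj_on (\<lambda>r. 2 * (2 * r * R + c) + 1) {..<R}"
      using R1 by (auto simp: inj_on_def)
    ultimately have "card {..<R} \<le> card (times i)" using card_inj_on_le fin[OF i] by blast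
    then show ?thesis by simp
  qed
  have N: "length (concat (map snd (entries vars cs))) = card (slots (4 * m) times)"
  proof -
    have "length (concat (map snd (entries vars cs))) = (\<Sum>i \<leftarrow> [0..<4 * m]. length (tlist i))"
      unfolding es by (simp add: length_concat comp_def)
    also have "\<dots> = (\<Sum>i < 4 * m. length (tlist i))"
      by (simp only: interv_sum_list_conv_sum_set_nat set_upt atLeast0LessThan)
    also have "\<dots> = (\<Sum>i < 4 * m. card (times i))"
    proof (rule sum.cong[OF refl])
      show "length (tlist i) = card (times i)" if "i \<in> {..<4 * m}" for i
        using distinct_card[OF tdist[of i]] tset[of i] that by simp
    qed
    also have "\<dots> = card (slots (4 * m) times)"
      unfolding slots_def using fin by (simp add: card_SigmaI)
    finally show ?thesis .
  qed
  have k: "budget vars cs = card (slots (4 * m) times) - 3 * m * R"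
  proof -
    have "length (concat (map (\<lambda>_. concat (map (\<lambda>_. [True, True, True]) vars)) cs)) = 3 * m * R"
      by (simp add: length_concat comp_def sum_list_triv m_def R_def)
    then show ?thesis unfolding budget_def using N by simp
  qed
  \<comment> \<open>\<open>ETC_language\<close> demands a positive budget. Each of the
    \<open>4 * m\<close> edges has at least \<open>R\<close> times, which makes more than
    \<open>3 * m * R\<close> in total.\<close>
  have big: "3 * m * R < card (slots (4 * m) times)"
  proof -
    have "4 * m * R = (\<Sum>i < 4 * m. R)" by simp
    also have "\<dots> \<le> (\<Sum>i < 4 * m. card (times i))" using cardR by (intro sum_mono) auto
    also have "\<dots> = card (slots (4 * m) times)" unfolding slots_def using fin by (simp add: card_SigmaI)
    finally have "4 * (m * R) \<le> card (slots (4 * m) times)" by simp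
    moreover have "0 < m * R" using m1 R1 by simp
    ultimately show ?thesis by linarith
  qed
  define vs where "vs = [0..<length (True # concat (map (\<lambda>_. [True, True, True, True]) cs))]"
  have vs: "vs = [0..<Suc (4 * m)]"
  proof -
    have "length (True # concat (map (\<lambda>_. [True, True, True, True]) cs)) = Suc (4 * m)"
      by (simp add: length_concat comp_def sum_list_triv m_def)
    then show ?thesis unfolding vs_def by (simp only:)
  qed
  have inst: "path_instance I = encode_input vs (entries vars cs) (budget vars cs) 1 (2 * R)"
    unfolding path_instance_def Let_def vars_def[symmetric] cs_def[symmetric] vs_def[symmetric] R_def[symmetric] ..
  have pres: "presents vs (entries vars cs) ?G"
    unfolding presents_def
  proof (intro conjI)
    have m': "map (\<lambda>((u, v), ts). {u, v}) (entries vars cs) = map (\<lambda>i. {i, Suc i}) [0..<4 * m]"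
      unfolding es by simp
    show "distinct (map (\<lambda>((u, v), ts). {u, v}) (entries vars cs))"
      unfolding m' by (simp add: distinct_map inj_on_def pair_eq)
    show "set (map (\<lambda>((u, v), ts). {u, v}) (entries vars cs)) = edges ?G"
      unfolding m' by (auto simp: path_graph_def)
    show "\<forall>((u, v), ts) \<in> set (entries vars cs). distinct ts \<and> set ts = appearances ?G {u, v}"
      unfolding es using tdist tset by (auto simp: path_graph_def)
    show "set vs = verts ?G" unfolding vs by (auto simp: path_graph_def simp del: upt_Suc)
  qed (simp add: vs del: upt_Suc)
  have tg: "temporal_graph ?G"
    unfolding temporal_graph_def
  proof (intro conjI ballI)
    show "edges ?G \<subseteq> vertex_pairs (verts ?G)" by (auto simp: path_graph_def vertex_pairs_def)
    fix e assume "e \<in> edges ?G"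
    then obtain i where i: "i < 4 * m" "e = {i, Suc i}" by (auto simp: path_graph_def)
    then have a: "appearances ?G e = times i" by (simp add: path_graph_def)
    show "finite (appearances ?G e)" unfolding a using fin i by blast
    show "appearances ?G e \<noteq> {}" unfolding a using cardR[OF i(1)] R1 by auto
    show "0 \<notin> appearances ?G e" unfolding a using odd[OF i(1), of 0] by auto
  qed (simp add: path_graph_def)
  have "path_instance I \<in> ETC_language P \<longleftrightarrow> ETC ?G (budget vars cs) 1 (2 * R)"
  proof
    assume "path_instance I \<in> ETC_language P"
    then obtain vs' es' k a b G where *: "path_instance I = encode_input vs' es' k a b"
      "presents vs' es' G" "ETC G k a b" unfolding ETC_language_def by blast
    from encode_input_inj[OF *(1)[unfolded inst]] *(2,3) presents_ETC[OF _ pres]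
    show "ETC ?G (budget vars cs) 1 (2 * R)" by blast
  next
    assume "ETC ?G (budget vars cs) 1 (2 * R)"
    moreover have "1 \<le> budget vars cs" using big k by simp
    moreover have "1 \<le> 2 * R" using R1 by simp
    ultimately show "path_instance I \<in> ETC_language P"
      unfolding ETC_language_def inst using tg pres P[of "4 * m" times] by blast
  qed
  also have "\<dots> \<longleftrightarrow> (\<exists>S. selection (4 * m) times (2 * R) S \<and> 3 * m * R \<le> card S)"
  proof
    assume e: "ETC ?G (budget vars cs) 1 (2 * R)"
    have "\<exists>S. selection (4 * m) times (2 * R) S \<and> card (slots (4 * m) times) \<le> card S + budget vars cs"
    proof (rule ETC_imp_selection[OF _ _ _ e])
      show "finite (times i)" if "i < 4 * m" for i using fin[OF that] .
      show "odd t" if "i < 4 * m" "t \<in> times i" for i t using odd[OF that] .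
      show "1 \<le> 2 * R" using R1 by simp
    qed
    then obtain S where "selection (4 * m) times (2 * R) S" "card (slots (4 * m) times) \<le> card S + budget vars cs" by blast
    then show "\<exists>S. selection (4 * m) times (2 * R) S \<and> 3 * m * R \<le> card S"
      using big k by (intro exI[of _ S]) linarith
  next
    assume "\<exists>S. selection (4 * m) times (2 * R) S \<and> 3 * m * R \<le> card S"
    then obtain S where S: "selection (4 * m) times (2 * R) S" "3 * m * R \<le> card S" by blast
    have c: "card (slots (4 * m) times) \<le> card S + budget vars cs" using S(2) k by linarith
    show "ETC ?G (budget vars cs) 1 (2 * R)"
    proof (rule selection_imp_ETC[OF _ _ S(1) c])
      show "finite (times i)" if "i < 4 * m" for i using fin[OF that] .
      show "odd t" if "i < 4 * m" "t \<in> times i" for i t using odd[OF that] .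
    qed
  qed
  also have "\<dots> \<longleftrightarrow> (\<exists>\<alpha>. \<forall>j < m. \<exists>v \<in> C j. \<alpha> v = sgn j)"
  proof
    assume "\<exists>S. selection (4 * m) times (2 * R) S \<and> 3 * m * R \<le> card S"
    then show "\<exists>\<alpha>. \<forall>j < m. \<exists>v \<in> C j. \<alpha> v = sgn j" using selection_imp_sat by blast
  next
    assume "\<exists>\<alpha>. \<forall>j < m. \<exists>v \<in> C j. \<alpha> v = sgn j"
    then obtain \<alpha> where "\<And>j. j < m \<Longrightarrow> \<exists>v \<in> C j. \<alpha> v = sgn j" by blast
    from sat_imp_selection[of \<alpha>, OF this] show "\<exists>S. selection (4 * m) times (2 * R) S \<and> 3 * m * R \<le> card S"
      by (metis order_refl)
  qed
  also have "\<dots> \<longleftrightarrow> satisfiable I"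
  proof
    assume "\<exists>\<alpha>. \<forall>j < m. \<exists>v \<in> C j. \<alpha> v = sgn j"
    then obtain \<alpha> where \<alpha>: "\<And>j. j < m \<Longrightarrow> \<exists>v \<in> C j. \<alpha> v = sgn j" by blast
    define \<beta> where "\<beta> = (\<lambda>a. \<exists>r < R. vars ! r = a \<and> \<alpha> r)"
    have \<beta>: "\<beta> (vars ! r) = \<alpha> r" if "r < R" for r
      using that dv unfolding \<beta>_def R_def by (auto simp: nth_eq_iff_index_eq)
    have *: "\<exists>v \<in> set D. \<beta> v = s" if "(s, D) \<in> set cs" for s D
    proof -
      obtain j where j: "j < m" "cs ! j = (s, D)" using \<open>(s, D) \<in> set cs\<close> unfolding m_def by (metis in_set_conv_nth)
      then obtain r where "r \<in> C j" "\<alpha> r = sgn j" using \<alpha> by blast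
      then show ?thesis using j \<beta>[of r] cs_sgn[OF j(1)] by (auto simp: C_def)
    qed
    have "(\<forall>D \<in> set (fst I). \<exists>v \<in> set D. \<beta> v) \<and> (\<forall>D \<in> set (snd I). \<exists>v \<in> set D. \<not> \<beta> v)"
      using *[of True] *[of False] unfolding cs_def clauses_def by auto
    then show "satisfiable I" unfolding satisfiable_def by blast
  next
    assume "satisfiable I"
    then obtain \<beta> where \<beta>: "\<forall>D \<in> set (fst I). \<exists>v \<in> set D. \<beta> v" "\<forall>D \<in> set (snd I). \<exists>v \<in> set D. \<not> \<beta> v"
      unfolding satisfiable_def by blast
    have "\<exists>r \<in> C j. \<beta> (vars ! r) = sgn j" if j: "j < m" for j
    proof -
      obtain s D where sD: "cs ! j = (s, D)" by fastforce
      then have in_cs: "(s, D) \<in> set cs" using j unfolding m_def by (metis nth_mem)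
      then have "\<exists>v \<in> set D. \<beta> v = s" using \<beta> unfolding cs_def clauses_def by auto
      then obtain v where v: "v \<in> set D" "\<beta> v = s" by blast
      have "v \<in> set vars" using v in_cs unfolding sv cs_def clauses_def by auto
      then obtain r where "r < R" "vars ! r = v" unfolding R_def by (metis in_set_conv_nth)
      then show ?thesis using v sD cs_sgn[OF j] by (intro bexI[of _ r]) (auto simp: C_def)
    qed
    then show "\<exists>\<alpha>. \<forall>j < m. \<exists>v \<in> C j. \<alpha> v = sgn j" by (intro exI[of _ "\<lambda>r. \<beta> (vars ! r)"]) blast
  qed
  finally show ?thesis .
qed

subsection \<open>Machine runs as monotone satisfiability\<close>

text \<open>
  Tape contents are taken relative to the head, so that a step of the machine shifts a tape instead
  of moving its head. A variable \<open>(t, k, p, s)\<close> says that after \<open>t\<close> steps the cell at distance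
  \<open>p - c\<close> from the head of tape \<open>k\<close> contains \<open>s\<close>; the state is stored as an additional tape.
\<close>

type_synonym var = "nat \<times> nat \<times> nat \<times> nat"

definition cont :: "tape \<Rightarrow> int \<Rightarrow> nat" where
  "cont tp i = fst tp (snd tp + i)"

lemma cont_act: "cont (act tp (s, m)) i = (if i + head_shift m = 0 then s else cont tp (i + head_shift m))"
  by (cases tp) (auto simp: cont_def algebra_simps)

lemma scanned_cont: "scanned tp = cont tp 0"
  by (cases tp) (simp add: cont_def)

text \<open>A total transition that stands still in the halting state, so that acceptance can be
  read off at a fixed time.\<close>

definition delta :: "turing_machine \<Rightarrow> nat \<Rightarrow> nat list \<Rightarrow> nat \<times> (nat \<times> move) list" where
  "delta M q ss = (if q < state_count M then transition M q ss else (q, map (\<lambda>s. (s, Stay)) ss))"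

lemma step_delta:
  "step M (q, tps) = (fst (delta M q (map scanned tps)), map2 act tps (snd (delta M q (map scanned tps))))"
  using map2_act_same[of tps] by (auto simp: delta_def split: prod.splits)

lemma delta_bounds:
  assumes "turing_machine M" "q \<le> state_count M" "length ss = tape_count M" "set ss \<subseteq> {..<symbol_count M}"
  shows "fst (delta M q ss) \<le> state_count M" "length (snd (delta M q ss)) = tape_count M"
    "fst ` set (snd (delta M q ss)) \<subseteq> {..<symbol_count M}"
proof -
  have "fst (delta M q ss) \<le> state_count M \<and> length (snd (delta M q ss)) = tape_count M \<and>
    fst ` set (snd (delta M q ss)) \<subseteq> {..<symbol_count M}"
  proof (cases "q < state_count M")
    case True
    have "\<forall>q < state_count M. \<forall>ss. length ss = tape_count M \<and> set ss \<subseteq> {..<symbol_count M} \<longrightarrow>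
        (case transition M q ss of (q', acts) \<Rightarrow> q' \<le> state_count M \<and> length acts = tape_count M \<and>
           fst ` set acts \<subseteq> {..<symbol_count M})"
      using assms(1) unfolding turing_machine_def by (elim conjE)
    then have "case transition M q ss of (q', acts) \<Rightarrow> q' \<le> state_count M \<and> length acts = tape_count M \<and>
        fst ` set acts \<subseteq> {..<symbol_count M}"
      using assms(3,4) True by simp
    then show ?thesis using True by (simp add: delta_def case_prod_beta)
  next
    case False
    then show ?thesis using assms by (auto simp: delta_def)
  qed
  then show "fst (delta M q ss) \<le> state_count M" "length (snd (delta M q ss)) = tape_count M"
    "fst ` set (snd (delta M q ss)) \<subseteq> {..<symbol_count M}" by simp_all
qed

type_synonym table_row = "nat \<times> nat list \<times> nat \<times> (nat \<times> nat) list"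

text \<open>Moves become the numbers 0, 1, 2, so that the whole table is data of class
  \<open>enc\<close> and can be a constant of the reduction.\<close>

definition row :: "turing_machine \<Rightarrow> nat \<Rightarrow> nat list \<Rightarrow> table_row" where
  "row M q ss = (q, ss, fst (delta M q ss), map (\<lambda>a. (fst a, nat (head_shift (snd a) + 1))) (snd (delta M q ss)))"

definition rows :: "turing_machine \<Rightarrow> table_row list" where
  "rows M = concat (map (\<lambda>q. map (row M q) (List.n_lists (tape_count M) [0..<symbol_count M]))
     [0..<Suc (state_count M)])"

lemma set_rows:
  "set (rows M) = {row M q ss | q ss. q \<le> state_count M \<and> length ss = tape_count M \<and>
     set ss \<subseteq> {..<symbol_count M}}"
proof -
  have "set (rows M) = (\<Union>q \<in> {..state_count M}. row M q ` {ss. length ss = tape_count M \<and>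
      set ss \<subseteq> {..<symbol_count M}})"
    unfolding rows_def
    by (simp add: set_n_lists atLeast0LessThan lessThan_Suc_atMost del: upt_Suc)
  then show ?thesis by blast
qed

text \<open>Together these variables say that row \<open>e\<close> of the table applies at time
  \<open>t\<close>; the state is read on the additional tape \<open>K\<close>.\<close>

definition scan_vars :: "nat \<Rightarrow> nat \<Rightarrow> nat \<Rightarrow> table_row \<Rightarrow> var list" where
  "scan_vars K c t e =
     (t, K, c, fst e) # map (\<lambda>a. (t, fst a, c, snd a)) (zip [0..<length (fst (snd e))] (fst (snd e)))"

text \<open>In \<open>length TL\<close> steps only cells at distance at most
  \<open>length TL\<close> can reach the head, which sits in the middle of these positions.\<close>

definition cells :: "bool list \<Rightarrow> nat list" where
  "cells TL = [0..<length (True # TL @ TL)]"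

text \<open>Determinism as prohibition: every successor other than the right one is excluded.
  Together with a positive clause asking for some successor this forces the right one without a
  mixed clause.\<close>

definition neg_state :: "turing_machine \<Rightarrow> bool list \<Rightarrow> var list list" where
  "neg_state M TL =
     concat (map (\<lambda>t. concat (map (\<lambda>e.
       map (\<lambda>q. scan_vars (tape_count M) (length TL) t e @ [(Suc t, tape_count M, length TL, q)])
         (filter (\<lambda>q. q \<noteq> fst (snd (snd e))) [0..<Suc (state_count M)])) (rows M))) [0..<length TL])"

text \<open>Cell \<open>p\<close> after the step was cell \<open>p'\<close> before it, as the tape
  shifts against the head. If \<open>p'\<close> was under the head, the new content is the written
  symbol whatever \<open>s\<close> was.\<close>

definition neg_cell :: "turing_machine \<Rightarrow> bool list \<Rightarrow> var list list" where
  "neg_cell M TL =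
     concat (map (\<lambda>t. concat (map (\<lambda>e. concat (map (\<lambda>a. concat (map (\<lambda>p. concat (map (\<lambda>p'.
       concat (map (\<lambda>s.
         map (\<lambda>s'. scan_vars (tape_count M) (length TL) t e @ [(t, fst a, p', s), (Suc t, fst a, p, s')])
         (filter (\<lambda>s'. s' \<noteq> (if p' = length TL then fst (snd a) else s)) [0..<symbol_count M]))
       [0..<symbol_count M]))
       (filter (\<lambda>p'. Suc p' = p + snd (snd a)) (cells TL)))) (cells TL)))
       (zip [0..<length (snd (snd (snd e)))] (snd (snd (snd e)))))) (rows M))) [0..<length TL])"

text \<open>The guessed cells must hold a string followed by blanks: no symbol 1 or 2 may come after
  a blank.\<close>

definition neg_input :: "bool list \<Rightarrow> bool list \<Rightarrow> bool list \<Rightarrow> var list list" where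
  "neg_input TL u YL =
     concat (map (\<lambda>i. [[(0, 0, length TL + length u + i, 0), (0, 0, Suc (length TL + length u + i), 1)],
       [(0, 0, length TL + length u + i, 0), (0, 0, Suc (length TL + length u + i), 2)]]) [0..<length YL])"

text \<open>Blanks to the left of the head, then the fixed string, the guessed cells, and blanks
  again. For \<open>TL = SL @ u @ YL\<close> the length is \<open>2 * length TL + 1\<close>, as in
  \<open>cells\<close>.\<close>

definition input_domains :: "bool list \<Rightarrow> bool list \<Rightarrow> bool list \<Rightarrow> bool list \<Rightarrow> nat list list" where
  "input_domains TL u YL SL =
     map (\<lambda>_. [0]) TL @ map (\<lambda>b. if b then [2] else [1]) u @ map (\<lambda>_. [0, 1, 2]) YL @ map (\<lambda>_. [0]) (True # SL)"

text \<open>The unit clause at time \<open>length TL\<close> is acceptance: symbol 2 codes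
  \<open>True\<close> and is under the head of the first tape. The other clauses ask for some
  admissible value of each cell and state.\<close>

definition pos_clauses :: "turing_machine \<Rightarrow> bool list \<Rightarrow> nat list list \<Rightarrow> var list list" where
  "pos_clauses M TL doms =
     map (\<lambda>a. map (\<lambda>s. (0, 0, fst a, s)) (snd a)) (zip [0..<length doms] doms) @
     concat (map (\<lambda>k. map (\<lambda>p. [(0, k, p, 0)]) (cells TL)) [1..<tape_count M]) @
     [(0, tape_count M, length TL, 0)] # [(length TL, 0, length TL, 2)] #
     concat (map (\<lambda>t. concat (map (\<lambda>k. map (\<lambda>p. map (\<lambda>s. (Suc t, k, p, s)) [0..<symbol_count M]) (cells TL))
       [0..<tape_count M])) [0..<length TL]) @
     map (\<lambda>t. map (\<lambda>q. (Suc t, tape_count M, length TL, q)) [0..<Suc (state_count M)]) [0..<length TL]"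

text \<open>Only the length of \<open>TL\<close> matters, as time bound and radius of the tapes in
  unary. \<open>SL\<close> is there to make it at least the running time on every guess.\<close>

definition tableau :: "turing_machine \<Rightarrow> bool list \<Rightarrow> bool list \<Rightarrow> bool list \<Rightarrow> var list list \<times> var list list" where
  "tableau M u YL SL =
     (let TL = SL @ u @ YL in
      (pos_clauses M TL (input_domains TL u YL SL), neg_state M TL @ neg_cell M TL @ neg_input TL u YL))"

lemma fp_scan_vars: "fp K \<Longrightarrow> fp c \<Longrightarrow> fp t \<Longrightarrow> fp e \<Longrightarrow> fp (\<lambda>x. scan_vars (K x) (c x) (t x) (e x))"
proof -
  assume *: "fp K" "fp c" "fp t" "fp e"
  note d = fp_comp[OF *(1)] fp_comp[OF *(2)] fp_comp[OF *(3)] fp_comp[OF *(4)]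
  show ?thesis unfolding scan_vars_def
    by (intro fp_Cons fp_pair fp_map fp_zip fp_upt_length * d fp_fst fp_snd fp_id)
qed

lemma fp_cells: "fp TL \<Longrightarrow> fp (\<lambda>x. cells (TL x))"
  unfolding cells_def by (intro fp_upt_length fp_Cons fp_append fp_const)

lemma fp_neg_state: "fp TL \<Longrightarrow> fp (\<lambda>x. neg_state M (TL x))"
proof -
  assume *: "fp TL"
  note d = fp_comp[OF *]
  show ?thesis unfolding neg_state_def
    by (intro fp_concat fp_map fp_append fp_Cons fp_pair fp_filter fp_not fp_eq fp_scan_vars fp_Suc
        fp_upt_length fp_length fp_const * d fp_fst fp_snd fp_id)
qed

lemma fp_neg_cell: "fp TL \<Longrightarrow> fp (\<lambda>x. neg_cell M (TL x))"
proof -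
  assume *: "fp TL"
  note d = fp_comp[OF *]
  show ?thesis unfolding neg_cell_def
    by (intro fp_concat fp_map fp_append fp_Cons fp_pair fp_filter fp_not fp_eq fp_if fp_add fp_scan_vars
        fp_Suc fp_zip fp_cells fp_upt_length fp_length fp_const * d fp_fst fp_snd fp_id)
qed

lemma fp_neg_input: "fp TL \<Longrightarrow> fp u \<Longrightarrow> fp YL \<Longrightarrow> fp (\<lambda>x. neg_input (TL x) (u x) (YL x))"
proof -
  assume *: "fp TL" "fp u" "fp YL"
  note d = fp_comp[OF *(1)] fp_comp[OF *(2)] fp_comp[OF *(3)]
  show ?thesis unfolding neg_input_def
    by (intro fp_concat fp_map fp_Cons fp_pair fp_add fp_Suc fp_upt_length fp_length fp_const * d
        fp_fst fp_snd fp_id)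
qed

lemma fp_input_domains:
  "fp TL \<Longrightarrow> fp u \<Longrightarrow> fp YL \<Longrightarrow> fp SL \<Longrightarrow> fp (\<lambda>x. input_domains (TL x) (u x) (YL x) (SL x))"
  unfolding input_domains_def by (intro fp_append fp_map fp_if fp_Cons fp_const fp_snd fp_id)

lemma fp_pos_clauses: "fp TL \<Longrightarrow> fp D \<Longrightarrow> fp (\<lambda>x. pos_clauses M (TL x) (D x))"
proof -
  assume *: "fp TL" "fp D"
  note d = fp_comp[OF *(1)] fp_comp[OF *(2)]
  show ?thesis unfolding pos_clauses_def
    by (intro fp_append fp_concat fp_map fp_Cons fp_pair fp_zip fp_Suc fp_cells fp_upt_length fp_length
        fp_const * d fp_fst fp_snd fp_id)
qed

lemma fp_tableau: "fp u \<Longrightarrow> fp YL \<Longrightarrow> fp SL \<Longrightarrow> fp (\<lambda>x. tableau M (u x) (YL x) (SL x))"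
  unfolding tableau_def Let_def
  by (intro fp_pair fp_pos_clauses fp_input_domains fp_append fp_neg_state fp_neg_cell fp_neg_input)

lemma all_scan_vars:
  assumes "length ss = K"
  shows "(\<forall>v \<in> set (scan_vars K c t (row M q ss)). \<alpha> v) \<longleftrightarrow>
    \<alpha> (t, K, c, q) \<and> (\<forall>k < K. \<alpha> (t, k, c, ss ! k))"
  using assms by (auto simp: scan_vars_def row_def zip_upt)

lemma mem_concat_map: "x \<in> set xs \<Longrightarrow> v \<in> set (f x) \<Longrightarrow> v \<in> set (concat (map f xs))"
  by auto

lemma neg_state_member:
  assumes "t < length TL" "q \<le> state_count M" "length ss = tape_count M" "set ss \<subseteq> {..<symbol_count M}"
    "q' \<noteq> fst (delta M q ss)" "q' \<le> state_count M"
  shows "scan_vars (tape_count M) (length TL) t (row M q ss) @ [(Suc t, tape_count M, length TL, q')]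
    \<in> set (neg_state M TL)"
proof -
  have t: "t \<in> set [0..<length TL]" using assms(1) by simp
  have e: "row M q ss \<in> set (rows M)" unfolding set_rows using assms by blast
  show ?thesis unfolding neg_state_def
    by (rule mem_concat_map[OF t], rule mem_concat_map[OF e])
      (use assms(5,6) in \<open>auto simp: row_def less_Suc_eq_le simp del: upt_Suc\<close>)
qed

lemma neg_stateE:
  assumes "C \<in> set (neg_state M TL)"
  shows "\<exists>t q ss q'. length ss = tape_count M \<and> q' \<noteq> fst (delta M q ss) \<and>
    C = scan_vars (tape_count M) (length TL) t (row M q ss) @ [(Suc t, tape_count M, length TL, q')]"
proof -
  from assms obtain t e q' where *: "e \<in> set (rows M)" "q' \<noteq> fst (snd (snd e))"
    "C = scan_vars (tape_count M) (length TL) t e @ [(Suc t, tape_count M, length TL, q')]"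
    unfolding neg_state_def by (auto simp del: upt_Suc)
  from *(1) obtain q ss where "e = row M q ss" "length ss = tape_count M" unfolding set_rows by blast
  with *(2,3) show ?thesis
    by (intro exI[of _ t] exI[of _ q] exI[of _ ss] exI[of _ q']) (simp add: row_def)
qed

lemma neg_cell_member:
  assumes "t < length TL" "q \<le> state_count M" "length ss = tape_count M" "set ss \<subseteq> {..<symbol_count M}"
    and k: "k < length (snd (delta M q ss))" and a: "snd (delta M q ss) ! k = (w, m)"
    and p: "p \<le> 2 * length TL" "p' \<le> 2 * length TL" "int p' = int p + head_shift m"
    and s: "s < symbol_count M" "s' < symbol_count M" "s' \<noteq> (if p' = length TL then w else s)"
  shows "scan_vars (tape_count M) (length TL) t (row M q ss) @ [(t, k, p', s), (Suc t, k, p, s')] \<in> set (neg_cell M TL)"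
proof -
  let ?d = "nat (head_shift m + 1)" and ?e = "row M q ss"
  have d: "Suc p' = p + ?d" using p(3) by (cases m) auto
  have e: "?e \<in> set (rows M)" unfolding set_rows using assms by blast
  have ws: "(k, (w, ?d)) \<in> set (zip [0..<length (snd (snd (snd ?e)))] (snd (snd (snd ?e))))"
    unfolding zip_upt using k a by (auto simp: row_def)
  have c: "p \<in> set (cells TL)" "p' \<in> set (filter (\<lambda>p'. Suc p' = p + snd (snd (k, (w, ?d)))) (cells TL))"
    using p d by (auto simp: cells_def simp del: upt_Suc)
  have t: "t \<in> set [0..<length TL]" using assms(1) by simp
  have s0: "s \<in> set [0..<symbol_count M]" using s by simp
  have s1: "s' \<in> set (filter (\<lambda>s'. s' \<noteq> (if p' = length TL then fst (snd (k, (w, ?d))) else s)) [0..<symbol_count M])"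
    using s by auto
  have memm: "x \<in> set xs \<Longrightarrow> f x \<in> set (map f xs)" for x :: nat and xs and f :: "nat \<Rightarrow> var list" by auto
  show ?thesis unfolding neg_cell_def
    by (rule mem_concat_map[OF t], rule mem_concat_map[OF e], rule mem_concat_map[OF ws],
        rule mem_concat_map[OF c(1)], rule mem_concat_map[OF c(2)], rule mem_concat_map[OF s0])
      (use memm[OF s1, of "\<lambda>s'. scan_vars (tape_count M) (length TL) t ?e @ [(t, k, p', s), (Suc t, k, p, s')]"]
        in simp)
qed

lemma neg_cellE:
  assumes "C \<in> set (neg_cell M TL)" "turing_machine M"
  shows "\<exists>t q ss k w m p p' s s'. length ss = tape_count M \<and> k < tape_count M \<and>
    snd (delta M q ss) ! k = (w, m) \<and> int p' = int p + head_shift m \<and>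
    s' \<noteq> (if p' = length TL then w else s) \<and>
    C = scan_vars (tape_count M) (length TL) t (row M q ss) @ [(t, k, p', s), (Suc t, k, p, s')]"
proof -
  from assms(1) obtain t e a p p' s s' where *: "t < length TL" "e \<in> set (rows M)"
    "a \<in> set (zip [0..<length (snd (snd (snd e)))] (snd (snd (snd e))))" "Suc p' = p + snd (snd a)"
    "s' \<noteq> (if p' = length TL then fst (snd a) else s)"
    "C = scan_vars (tape_count M) (length TL) t e @ [(t, fst a, p', s), (Suc t, fst a, p, s')]"
    unfolding neg_cell_def by (auto simp del: upt_Suc)
  obtain q ss where e: "e = row M q ss" "q \<le> state_count M" "length ss = tape_count M"
    "set ss \<subseteq> {..<symbol_count M}" using *(2) unfolding set_rows by blast
  obtain k where k: "k < length (snd (snd (snd e)))" "a = (k, snd (snd (snd e)) ! k)"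
    using *(3) unfolding zip_upt by auto
  obtain w m where wm: "snd (delta M q ss) ! k = (w, m)" by fastforce
  have kl: "k < length (snd (delta M q ss))" using k(1) by (simp add: e(1) row_def)
  then have a: "a = (k, (w, nat (head_shift m + 1)))" using k(2) wm by (simp add: e(1) row_def)
  have pp: "int p' = int p + head_shift m" using *(4) a by (cases m) auto
  have kK: "k < tape_count M" using kl delta_bounds(2)[OF assms(2) e(2-4)] by simp
  have ss: "s' \<noteq> (if p' = length TL then w else s)" using *(5) unfolding a fst_conv snd_conv .
  have C: "C = scan_vars (tape_count M) (length TL) t (row M q ss) @ [(t, k, p', s), (Suc t, k, p, s')]"
    using *(6) unfolding a e(1) fst_conv .
  show ?thesis by (intro exI conjI, rule e(3), rule kK, rule wm, rule pp, rule ss, rule C)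
qed

text \<open>A satisfying assignment may make several symbols true in a guessed cell. One of them is
  chosen, which fixes an input; then, by induction on time, every value made true in a relevant cell
  at a later time is the one in the run on that input. Hence no clause has to say that values are
  unique.\<close>

lemma tableau_sat:
  assumes M: "turing_machine M" and dec: "computes_within M (\<lambda>z. [z \<in> R]) (poly p)"
    and SL: "length SL = poly p (length u + length YL)" and u: "u \<noteq> []"
  shows "satisfiable (tableau M u YL SL) \<longleftrightarrow> (\<exists>y. length y \<le> length YL \<and> u @ y \<in> R)"
proof -
  define K where "K = tape_count M"
  define TL where "TL = SL @ u @ YL"
  define c where "c = length TL"
  define doms where "doms = input_domains TL u YL SL"
  have K1: "1 \<le> K" and sy3: "3 \<le> symbol_count M" using M unfolding turing_machine_def K_def by auto
  have c1: "1 \<le> c" using u by (simp add: c_def TL_def Suc_leI)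
  have cells: "set (cells TL) = {..2 * c}" by (auto simp: cells_def c_def simp del: upt_Suc)
  have ldoms: "length doms = Suc (2 * c)" by (simp add: doms_def input_domains_def c_def TL_def)
  define conf where "conf = (\<lambda>z t. (step M ^^ t) (initial M z))"
  define st' where "st' = (\<lambda>z t. fst (conf z t))"
  define tp where "tp = (\<lambda>z t. snd (conf z t))"
  define V where "V = (\<lambda>z t k p. cont (tp z t ! k) (int p - int c))"
  have inv: "st' z t \<le> state_count M \<and> length (tp z t) = K \<and> (\<forall>k < K. \<forall>i. cont (tp z t ! k) i < symbol_count M)" for z t
  proof (induction t)
    case 0
    have "cont (input_tape z) i < symbol_count M" for i
      using sy3 symbol_less order_less_le_trans by (auto simp: cont_def input_tape_def)
    then show ?case using sy3 K1
      by (auto simp: st'_def tp_def conf_def initial_def K_def nth_Cons cont_def split: nat.splits)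
  next
    case (Suc t)
    let ?ss = "map scanned (tp z t)" and ?q = "st' z t"
    have "scanned x < symbol_count M" if "x \<in> set (tp z t)" for x
      using that Suc unfolding in_set_conv_nth scanned_cont by metis
    then have ss: "length ?ss = tape_count M" "set ?ss \<subseteq> {..<symbol_count M}"
      using Suc by (simp_all add: K_def image_subset_iff)
    note b = delta_bounds[OF M conjunct1[OF Suc] ss]
    have c: "conf z (Suc t) = (fst (delta M ?q ?ss), map2 act (tp z t) (snd (delta M ?q ?ss)))"
      using step_delta[of M ?q "tp z t"] by (simp add: conf_def st'_def tp_def)
    have "cont (tp z (Suc t) ! k) i < symbol_count M" if k: "k < K" for k i
    proof -
      obtain w m where wm: "snd (delta M ?q ?ss) ! k = (w, m)" by fastforce
      have kl: "k < length (snd (delta M ?q ?ss))" using b(2) k by (simp add: K_def)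
      have "w < symbol_count M" using b(3) nth_mem[OF kl] wm by force
      then show ?thesis using k kl Suc wm by (simp add: tp_def c cont_act)
    qed
    then show ?case using b Suc c by (simp add: st'_def tp_def K_def)
  qed
  define ss where "ss = (\<lambda>z t. map scanned (tp z t))"
  have ss: "length (ss z t) = tape_count M" "set (ss z t) \<subseteq> {..<symbol_count M}" for z t
  proof -
    have "scanned x < symbol_count M" if "x \<in> set (tp z t)" for x
      using that inv[of z t] unfolding in_set_conv_nth scanned_cont by metis
    then show "length (ss z t) = tape_count M" "set (ss z t) \<subseteq> {..<symbol_count M}"
      using inv[of z t] by (simp_all add: ss_def K_def image_subset_iff)
  qed
  have ssV: "ss z t ! k = V z t k c" if "k < K" for z t k
    using that inv[of z t] by (simp add: ss_def V_def scanned_cont)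
  have stl: "st' z t \<le> state_count M" for z t using inv by blast
  have stS: "st' z (Suc t) = fst (delta M (st' z t) (ss z t))" for z t
    using step_delta[of M "st' z t" "tp z t"] by (simp add: conf_def st'_def tp_def ss_def)
  have lacts: "length (snd (delta M (st' z t) (ss z t))) = K" for z t
    using delta_bounds(2)[OF M stl ss] by (simp add: K_def)
  have VS: "V z (Suc t) k p = (if p' = c then w else V z t k p')"
    if "k < K" "snd (delta M (st' z t) (ss z t)) ! k = (w, m)" "int p' = int p + head_shift m" for z t k p p' w m
  proof -
    have "tp z (Suc t) = map2 act (tp z t) (snd (delta M (st' z t) (ss z t)))"
      using step_delta[of M "st' z t" "tp z t"] by (simp add: conf_def st'_def tp_def ss_def)
    then have "tp z (Suc t) ! k = act (tp z t ! k) (w, m)" using that lacts inv by simp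
    moreover have e: "int p - int c + head_shift m = int p' - int c" using that(3) by simp
    ultimately show ?thesis unfolding V_def by (simp only: cont_act e) auto
  qed
  have V0: "V z 0 k p = (if k = 0 \<and> c \<le> p \<and> p - c < length z then symbol (z ! (p - c)) else 0)" if "k < K" for z k p
    using that by (auto simp: V_def tp_def conf_def initial_def cont_def input_tape_def K_def nth_Cons nat_diff_distrib' split: nat.splits)
  have acc: "V z c 0 c = 2 \<longleftrightarrow> z \<in> R" if z: "z = u @ y" "length y \<le> length YL" for z y
  proof -
    obtain t where t: "t \<le> poly p (length z)" "st' z t = state_count M" "outputs (tp z t ! 0) [z \<in> R]"
      using dec unfolding computes_within_def st'_def tp_def conf_def by (fastforce simp: case_prod_beta)
    have "poly p (length z) \<le> length SL" unfolding SL using z by (intro poly_mono_nat) simp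
    then have tc: "t \<le> c" using t(1) by (simp add: c_def TL_def)
    have "conf z (t + i) = conf z t" for i
    proof (induction i)
      case (Suc i)
      have "step M (conf z t) = conf z t"
        using t(2) by (cases "conf z t") (simp add: st'_def)
      then show ?case using Suc by (simp add: conf_def)
    qed simp
    then have "conf z c = conf z t" using tc by (metis le_add_diff_inverse)
    then have "V z c 0 c = cont (tp z t ! 0) 0" by (simp add: V_def tp_def)
    also have "\<dots> = symbol (z \<in> R)"
      using t(3) by (cases "tp z t ! 0") (auto simp: cont_def)
    finally show ?thesis by (cases "z \<in> R") auto
  qed
  have domsI: "V (u @ y) 0 0 p \<in> set (doms ! p)" if pl: "p \<le> 2 * c" and yl: "length y \<le> length YL" for y p
  proof -
    have k: "(0 :: nat) < K" using K1 by simp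
    have sym: "symbol b \<in> {0, 1, 2}" for b by (cases b) auto
    consider (a) "p < c" | (b) i where "p = c + i" "i < length u" | (c) i where "p = c + length u + i" "i < length YL"
      | (d) i where "p = c + length u + length YL + i" "i < Suc (length SL)"
    proof -
      assume H: "p < c \<Longrightarrow> thesis" "\<And>i. p = c + i \<Longrightarrow> i < length u \<Longrightarrow> thesis"
        "\<And>i. p = c + length u + i \<Longrightarrow> i < length YL \<Longrightarrow> thesis"
        "\<And>i. p = c + length u + length YL + i \<Longrightarrow> i < Suc (length SL) \<Longrightarrow> thesis"
      have c: "c = length SL + length u + length YL" by (simp add: c_def TL_def)
      show thesis
      proof (cases "p < c")
        case False
        then obtain j where j: "p = c + j" using le_Suc_ex by (metis not_less)
        show thesis
        proof (cases "j < length u + length YL")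
          case True
          then show thesis using H(2)[of j] H(3)[of "j - length u"] j by (cases "j < length u") auto
        next
          case False
          then show thesis using H(4)[of "j - length u - length YL"] j pl c by auto
        qed
      qed (rule H(1))
    qed
    then show ?thesis
    proof cases
      case a
      then show ?thesis using V0[OF k] by (simp add: doms_def input_domains_def c_def nth_append)
    next
      case b
      then have "doms ! p = (if u ! i then [2] else [1])"
        by (simp add: doms_def input_domains_def c_def nth_append)
      then show ?thesis using V0[OF k, of "u @ y" p] b by (auto simp: nth_append)
    next
      case c
      then have "doms ! p = [0, 1, 2]"
        by (simp add: doms_def input_domains_def c_def nth_append)
      then show ?thesis using V0[OF k, of "u @ y" p] sym by auto
    next
      case d
      then have "doms ! p = map (\<lambda>_. [0]) (True # SL) ! i"
        unfolding doms_def input_domains_def c_def by (simp only: nth_append length_map) simp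
      then have "doms ! p = [0]" using d(2) by (simp only: nth_map length_Cons)
      then show ?thesis using V0[OF k, of "u @ y" p] d yl by auto
    qed
  qed
  have I: "tableau M u YL SL = (pos_clauses M TL doms, neg_state M TL @ neg_cell M TL @ neg_input TL u YL)"
    by (simp add: tableau_def TL_def doms_def Let_def)
  show ?thesis
  proof
    assume "\<exists>y. length y \<le> length YL \<and> u @ y \<in> R"
    then obtain y where y: "length y \<le> length YL" "u @ y \<in> R" by blast
    define z where "z = u @ y"
    define \<alpha> where "\<alpha> = (\<lambda>(t, k, p, s). (k < K \<and> s = V z t k p) \<or> (k = K \<and> s = st' z t))"
    have Vs: "V z t k p < symbol_count M" if "k < K" for t k p using inv that by (simp add: V_def)
    have "\<exists>v \<in> set C. \<alpha> v" if "C \<in> set (pos_clauses M TL doms)" for C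
    proof -
      from that consider (a) p where "p < length doms" "C = map (\<lambda>s. (0, 0, p, s)) (doms ! p)"
        | (b) k p where "k < K" "1 \<le> k" "C = [(0, k, p, 0)]"
        | (c) "C = [(0, K, c, 0)]" | (d) "C = [(c, 0, c, 2)]"
        | (e) t k p where "k < K" "C = map (\<lambda>s. (Suc t, k, p, s)) [0..<symbol_count M]"
        | (f) t where "C = map (\<lambda>q. (Suc t, K, c, q)) [0..<Suc (state_count M)]"
        unfolding pos_clauses_def K_def[symmetric] c_def[symmetric] zip_upt
        by (auto simp del: upt_Suc map_eq_conv)
      then show ?thesis
      proof cases
        case a
        then have "V z 0 0 p \<in> set (doms ! p)" using domsI[of p y] y ldoms by (simp add: z_def)
        then show ?thesis using a K1 by (auto simp: \<alpha>_def)
      next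
        case b
        then show ?thesis using V0[of k z p] by (auto simp: \<alpha>_def)
      next
        case c
        then show ?thesis by (auto simp: \<alpha>_def st'_def conf_def initial_def)
      next
        case d
        then show ?thesis using acc[of z y] y K1 by (auto simp: \<alpha>_def z_def)
      next
        case e
        then show ?thesis using Vs[of k] by (auto simp: \<alpha>_def)
      next
        case f
        then show ?thesis using stl[of z "Suc t"] by (auto simp: \<alpha>_def less_Suc_eq_le simp del: upt_Suc)
      qed
    qed
    moreover have "\<exists>v \<in> set C. \<not> \<alpha> v" if "C \<in> set (neg_state M TL @ neg_cell M TL @ neg_input TL u YL)" for C
    proof (rule ccontr)
      assume "\<not> ?thesis"
      then have all: "\<forall>v \<in> set C. \<alpha> v" by blast
      have scan: "q = st' z t \<and> ss' = ss z t"
        if "\<forall>v \<in> set (scan_vars K c t (row M q ss')). \<alpha> v" "length ss' = K" for t q ss'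
      proof -
        have "\<alpha> (t, K, c, q)" "\<forall>k < K. \<alpha> (t, k, c, ss' ! k)"
          using that(1) all_scan_vars[OF that(2)] by blast+
        then have "q = st' z t" "\<forall>k < K. ss' ! k = ss z t ! k" using ssV by (auto simp: \<alpha>_def)
        then show ?thesis using that(2) ss(1)[of z t] by (auto intro: nth_equalityI simp: K_def)
      qed
      from that consider (a) "C \<in> set (neg_state M TL)" | (b) "C \<in> set (neg_cell M TL)" | (c) "C \<in> set (neg_input TL u YL)"
        by auto
      then show False
      proof cases
        case a
        obtain t q ss' q' where *: "length ss' = K" "q' \<noteq> fst (delta M q ss')"
          "C = scan_vars K c t (row M q ss') @ [(Suc t, K, c, q')]"
          using neg_stateE[OF a] unfolding K_def[symmetric] c_def[symmetric] by blast
        have "q = st' z t \<and> ss' = ss z t" using scan[of t q ss'] all * by auto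
        moreover have "q' = st' z (Suc t)" using all * by (auto simp: \<alpha>_def)
        ultimately show False using * stS by simp
      next
        case b
        obtain t q ss' k w m p p' s s' where *: "length ss' = K" "k < K" "snd (delta M q ss') ! k = (w, m)"
          "int p' = int p + head_shift m" "s' \<noteq> (if p' = c then w else s)"
          "C = scan_vars K c t (row M q ss') @ [(t, k, p', s), (Suc t, k, p, s')]"
          using neg_cellE[OF b M] unfolding K_def[symmetric] c_def[symmetric] by blast
        have q: "q = st' z t" "ss' = ss z t" using scan[of t q ss'] all * by auto
        have "s = V z t k p'" "s' = V z (Suc t) k p" using all * by (auto simp: \<alpha>_def)
        then have "s' = (if p' = c then w else s)"
          using VS[OF *(2) *(3)[unfolded q] *(4)] by (simp only:)
        then show False using *(5) by blast
      next
        case c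
        then obtain i s where i: "s = 1 \<or> s = 2" "C = [(0, 0, c + length u + i, 0), (0, 0, Suc (c + length u + i), s)]"
          unfolding neg_input_def c_def by auto
        then have "V z 0 0 (c + length u + i) = 0" "V z 0 0 (Suc (c + length u + i)) = s" "s \<noteq> 0"
          using all K1 by (auto simp: \<alpha>_def)
        moreover have nz: "symbol b \<noteq> 0" for b by (cases b) auto
        ultimately show False using V0[of 0 z] K1 by (auto simp: z_def nz split: if_splits)
      qed
    qed
    ultimately have "(\<forall>C \<in> set (fst (tableau M u YL SL)). \<exists>v \<in> set C. \<alpha> v) \<and>
        (\<forall>C \<in> set (snd (tableau M u YL SL)). \<exists>v \<in> set C. \<not> \<alpha> v)"
      unfolding I fst_conv snd_conv by blast
    then show "satisfiable (tableau M u YL SL)" unfolding satisfiable_def by blast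
  next
    assume "satisfiable (tableau M u YL SL)"
    then obtain \<alpha> where pos: "\<And>C. C \<in> set (pos_clauses M TL doms) \<Longrightarrow> \<exists>v \<in> set C. \<alpha> v"
      and neg: "\<And>C. C \<in> set (neg_state M TL) \<union> set (neg_cell M TL) \<union> set (neg_input TL u YL) \<Longrightarrow> \<exists>v \<in> set C. \<not> \<alpha> v"
      unfolding satisfiable_def I fst_conv snd_conv set_append by blast
    have dom: "\<exists>s \<in> set (doms ! p). \<alpha> (0, 0, p, s)" if "p \<le> 2 * c" for p
    proof -
      have "map (\<lambda>s. (0, 0, p, s)) (doms ! p) \<in> set (pos_clauses M TL doms)"
        using that ldoms unfolding pos_clauses_def zip_upt by (auto simp del: upt_Suc)
      from pos[OF this] show ?thesis by auto
    qed
    let ?L = "length YL"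
    \<comment> \<open>\<open>f\<close> picks one of the symbols made true in each guessed cell. With
      \<open>l\<close> the first picked blank, \<open>neg_input\<close> makes all later picks blank,
      so the picks before \<open>l\<close> form the guessed string.\<close>
    define f where "f = (\<lambda>i. SOME s. s \<in> {0, 1, 2} \<and> \<alpha> (0, 0, c + length u + i, s))"
    have f: "f i \<in> {0, 1, 2} \<and> \<alpha> (0, 0, c + length u + i, f i)" if "i < ?L" for i
    proof -
      have d: "doms ! (c + length u + i) = [0, 1, 2]"
        using that by (simp add: doms_def input_domains_def c_def nth_append)
      have "c + length u + i \<le> 2 * c" using that by (simp add: c_def TL_def)
      from dom[OF this] have "\<exists>s. s \<in> {0, 1, 2} \<and> \<alpha> (0, 0, c + length u + i, s)"
        unfolding d list.set by blast
      then show ?thesis unfolding f_def by (rule someI_ex)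
    qed
    define l where "l = (LEAST i. i = ?L \<or> f i = 0)"
    have l: "l = ?L \<or> f l = 0" unfolding l_def by (rule LeastI[of _ ?L]) simp
    have lL: "l \<le> ?L" unfolding l_def by (rule Least_le) simp
    have fl: "f i \<noteq> 0" if "i < l" for i using not_less_Least[OF that[unfolded l_def]] by simp
    have fz: "f i = 0" if "l \<le> i" "i < ?L" for i
      using that
    proof (induction i rule: dec_induct)
      case base
      then show ?case using l by auto
    next
      case (step i)
      then have "\<alpha> (0, 0, c + length u + i, 0)" using f[of i] by auto
      moreover have "[(0, 0, c + length u + i, 0), (0, 0, Suc (c + length u + i), s)] \<in> set (neg_input TL u YL)"
        if "s = 1 \<or> s = 2" for s using that step unfolding neg_input_def c_def by auto
      ultimately have "\<not> \<alpha> (0, 0, Suc (c + length u + i), s)" if "s = 1 \<or> s = 2" for s using neg that by fastforce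
      then show ?case using f[of "Suc i"] step by auto
    qed
    define y where "y = map (\<lambda>i. f i = 2) [0..<l]"
    define z where "z = u @ y"
    have ly: "length y \<le> ?L" using lL by (simp add: y_def)
    have init: "\<alpha> (0, 0, p, V z 0 0 p)" if p: "p \<le> 2 * c" for p
    proof -
      have k: "(0 :: nat) < K" using K1 by simp
      have "V z 0 0 p \<in> set (doms ! p)" using domsI[OF p ly] by (simp add: z_def)
      show ?thesis
      proof (cases "\<exists>i < ?L. p = c + length u + i")
        case True
        then obtain i where i: "i < ?L" "p = c + length u + i" by blast
        have "V z 0 0 p = f i"
        proof (cases "i < l")
          case True
          then have "f i = 1 \<or> f i = 2" using f[OF i(1)] fl by auto
          then show ?thesis using V0[OF k, of z p] True i by (auto simp: z_def y_def nth_append)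
        next
          case False
          then show ?thesis using V0[OF k, of z p] i fz[of i] by (auto simp: z_def y_def)
        qed
        then show ?thesis using f[OF i(1)] i by simp
      next
        case False
        have "\<exists>a. doms ! p = [a]"
        proof -
          have c: "c = length SL + length u + length YL" by (simp add: c_def TL_def)
          have "p < c + length u \<or> c + length u + ?L \<le> p"
            using False by (metis add_diff_inverse_nat add_less_cancel_left not_less)
          then show ?thesis
          proof
            assume "p < c + length u"
            then show ?thesis by (auto simp: doms_def input_domains_def c_def nth_append)
          next
            assume "c + length u + ?L \<le> p"
            then obtain i where i: "p = c + length u + ?L + i" using le_Suc_ex by blast
            then have "i < Suc (length SL)" using p c by simp
            moreover have "doms ! p = map (\<lambda>_. [0]) (True # SL) ! i"
              unfolding doms_def input_domains_def i c_def by (simp only: nth_append length_map) simp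
            ultimately show ?thesis by (simp only: nth_map length_Cons) blast
          qed
        qed
        then show ?thesis using \<open>V z 0 0 p \<in> set (doms ! p)\<close> dom[OF p] by auto
      qed
    qed
    \<comment> \<open>The run is known to be true in a shrinking window: a cell at time
      \<open>Suc t\<close> depends on one at distance at most 1 at time \<open>t\<close>. At time
      \<open>c\<close> just the head cell is left, which is where acceptance is read.\<close>
    let ?good = "\<lambda>t. \<alpha> (t, K, c, st' z t) \<and> (\<forall>k < K. \<forall>p \<le> 2 * c. \<bar>int p - int c\<bar> \<le> int c - int t \<longrightarrow> \<alpha> (t, k, p, V z t k p))"
    have scan: "\<forall>v \<in> set (scan_vars K c t (row M (st' z t) (ss z t))). \<alpha> v" if "?good t" "t < c" for t
    proof -
      have "length (ss z t) = K" using ss(1) by (simp add: K_def)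
      moreover have "\<alpha> (t, k, c, ss z t ! k)" if "k < K" for k
        using \<open>?good t\<close> \<open>t < c\<close> that ssV[OF that] by simp
      ultimately show ?thesis using \<open>?good t\<close> all_scan_vars by blast
    qed
    have uniq_state: "q = st' z (Suc t)" if good: "?good t" "t < c" and q: "q \<le> state_count M" "\<alpha> (Suc t, K, c, q)" for t q
    proof (rule ccontr)
      assume "q \<noteq> st' z (Suc t)"
      then have "scan_vars K c t (row M (st' z t) (ss z t)) @ [(Suc t, K, c, q)] \<in> set (neg_state M TL)"
        using neg_state_member[of t TL "st' z t" M "ss z t" q] stS stl ss q(1) that(2) by (simp add: K_def c_def)
      then have "\<exists>v \<in> set (scan_vars K c t (row M (st' z t) (ss z t)) @ [(Suc t, K, c, q)]). \<not> \<alpha> v" using neg by blast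
      then show False using scan[OF good] q(2) by auto
    qed
    have uniq: "s = V z (Suc t) k p"
      if good: "?good t" "t < c" and k: "k < K" and p: "p \<le> 2 * c" "\<bar>int p - int c\<bar> \<le> int c - int (Suc t)"
        and s: "s < symbol_count M" "\<alpha> (Suc t, k, p, s)" for t k p s
    proof (rule ccontr)
      assume neq: "s \<noteq> V z (Suc t) k p"
      obtain w m where wm: "snd (delta M (st' z t) (ss z t)) ! k = (w, m)" by fastforce
      define p' where "p' = nat (int p + head_shift m)"
      have hs: "\<bar>head_shift m\<bar> \<le> 1" by (cases m) auto
      have p': "int p' = int p + head_shift m" "p' \<le> 2 * c" "\<bar>int p' - int c\<bar> \<le> int c - int t"
        using p hs good(2) unfolding p'_def by linarith+
      have "scan_vars K c t (row M (st' z t) (ss z t)) @ [(t, k, p', V z t k p'), (Suc t, k, p, s)] \<in> set (neg_cell M TL)"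
        unfolding K_def c_def
        by (rule neg_cell_member[OF _ stl ss _ wm])
          (use good(2) k lacts p p' s inv neq VS[OF k wm p'(1)] in \<open>auto simp: c_def[symmetric] V_def\<close>)
      then have "\<exists>v \<in> set (scan_vars K c t (row M (st' z t) (ss z t)) @ [(t, k, p', V z t k p'), (Suc t, k, p, s)]). \<not> \<alpha> v"
        using neg by blast
      then show False using scan[OF good] good(1) k p' s(2) by auto
    qed
    have good: "?good t" if "t \<le> c" for t
      using that
    proof (induction t)
      case 0
      have "[(0, K, c, 0)] \<in> set (pos_clauses M TL doms)" by (simp add: pos_clauses_def K_def c_def)
      from pos[OF this] have "\<alpha> (0, K, c, st' z 0)" by (simp add: st'_def conf_def initial_def)
      moreover have "\<alpha> (0, k, p, V z 0 k p)" if "k < K" "p \<le> 2 * c" for k p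
      proof (cases "k = 0")
        case False
        then have "[(0, k, p, 0)] \<in> set (pos_clauses M TL doms)"
          using that cells unfolding pos_clauses_def K_def by auto
        from pos[OF this] show ?thesis using V0[OF that(1), of z p] False by simp
      qed (use init that in simp)
      ultimately show ?case by blast
    next
      case (Suc t)
      then have g: "?good t" "t < c" by auto
      have "map (\<lambda>q. (Suc t, K, c, q)) [0..<Suc (state_count M)] \<in>
          (\<lambda>t. map (\<lambda>q. (Suc t, K, c, q)) [0..<Suc (state_count M)]) ` set [0..<length TL]"
        by (rule imageI) (use g(2) in \<open>simp add: c_def\<close>)
      then have "map (\<lambda>q. (Suc t, K, c, q)) [0..<Suc (state_count M)] \<in> set (pos_clauses M TL doms)"
        unfolding pos_clauses_def K_def c_def set_append list.set(2) set_map by blast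
      from pos[OF this] obtain q where q: "q \<le> state_count M" "\<alpha> (Suc t, K, c, q)"
        by (auto simp: less_Suc_eq_le simp del: upt_Suc)
      have "\<alpha> (Suc t, k, p, V z (Suc t) k p)" if k: "k < K" and p: "p \<le> 2 * c" "\<bar>int p - int c\<bar> \<le> int c - int (Suc t)" for k p
      proof -
        have "map (\<lambda>s. (Suc t, k, p, s)) [0..<symbol_count M] \<in> set (pos_clauses M TL doms)"
        proof -
          have "k \<in> set [0..<tape_count M]" "t \<in> set [0..<length TL]" "p \<in> set (cells TL)"
            using g(2) k p cells by (auto simp: K_def c_def)
          then show ?thesis unfolding pos_clauses_def by (simp del: set_upt upt_Suc) blast
        qed
        from pos[OF this] obtain s where s: "s < symbol_count M" "\<alpha> (Suc t, k, p, s)" by auto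
        then show ?thesis using uniq[OF g k p s] by simp
      qed
      then show ?case using uniq_state[OF g q] q by blast
    qed
    have "[(c, 0, c, 2)] \<in> set (pos_clauses M TL doms)" by (simp add: pos_clauses_def c_def)
    from pos[OF this] have "\<alpha> (c, 0, c, 2)" by simp
    \<comment> \<open>\<open>uniq\<close> speaks of successor times, and \<open>c\<close> is one
      because \<open>u\<close> is nonempty.\<close>
    moreover obtain t where t: "c = Suc t" using c1 by (cases c) auto
    moreover have "2 < symbol_count M" "0 < K" using sy3 K1 by auto
    ultimately have "2 = V z c 0 c" using uniq[of t 0 c 2] good[of t] by simp
    then have "z \<in> R" using acc[of z y] ly by (simp add: z_def)
    then show "\<exists>y. length y \<le> length YL \<and> u @ y \<in> R" using ly unfolding z_def by blast
  qed
qed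

lemma fp_encode_bits: "fp f \<Longrightarrow> fp (\<lambda>x. encode_list (\<lambda>b. [b]) (f x) :: bool list)"
  by (intro fp_encode_list fp_Cons fp_const fp_snd fp_id)

theorem NP_hard:
  assumes A: "in_NP A" and P: "\<And>E A. P (path_graph E A)"
  shows "poly_reducible A (ETC_language P)"
proof -
  obtain R q where "in_P R" and R: "\<And>x. x \<in> A \<longleftrightarrow> (\<exists>y. length y \<le> poly q (length x) \<and> encode_pair x y \<in> R)"
    using A unfolding in_NP_def by blast
  then obtain M p where M: "turing_machine M" and dec: "computes_within M (\<lambda>z. [z \<in> R]) (poly p)"
    unfolding in_P_def poly_time_def by blast
  define u where "u = (\<lambda>x. encode_list (\<lambda>b. [b]) x :: bool list)"
  define YL where "YL = (\<lambda>x :: bool list. replicate (poly q (length x)) True)"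
  define SL where "SL = (\<lambda>x. replicate (poly p (length (u x @ YL x))) True)"
  define f where "f = (\<lambda>x. path_instance (tableau M (u x) (YL x) (SL x)))"
  have fu: "fp u" unfolding u_def by (intro fp_encode_bits fp_id)
  have fY: "fp YL" unfolding YL_def by (intro fp_replicate_poly fp_id)
  have fS: "fp SL" unfolding SL_def by (intro fp_replicate_poly fp_append fu fY)
  have "fp f" unfolding f_def by (intro fp_path_instance fp_tableau fu fY fS)
  moreover have "x \<in> A \<longleftrightarrow> f x \<in> ETC_language P" for x
  proof -
    let ?I = "tableau M (u x) (YL x) (SL x)"
    have un: "u x \<noteq> []" by (simp add: u_def encode_list_def)
    have "satisfiable ?I \<longleftrightarrow> (\<exists>y. length y \<le> length (YL x) \<and> u x @ y \<in> R)"
      by (rule tableau_sat[OF M dec _ un]) (simp add: SL_def)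
    also have "\<dots> \<longleftrightarrow> x \<in> A" unfolding R by (simp add: YL_def u_def encode_pair_def)
    finally have "satisfiable ?I \<longleftrightarrow> x \<in> A" .
    moreover have "fst ?I \<noteq> []" by (simp add: tableau_def Let_def pos_clauses_def)
    moreover have "C \<noteq> []" if "C \<in> set (fst ?I)" for C
    proof -
      have "d \<noteq> []" if "d \<in> set (input_domains TL (u x) (YL x) (SL x))" for d TL
        using that by (auto simp: input_domains_def)
      moreover have "0 < symbol_count M" using M by (simp add: turing_machine_def)
      ultimately show ?thesis using that unfolding tableau_def Let_def fst_conv pos_clauses_def
        by (auto dest: set_zip_rightD simp del: upt_Suc)
    qed
    ultimately show ?thesis unfolding f_def using path_instance[of P ?I] P by blast
  qed
  ultimately show ?thesis unfolding poly_reducible_def using poly_time_fp by blast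
qed

section \<open>Membership in NP\<close>

subsection \<open>Small solutions\<close>

definition graph_on :: "'v set \<Rightarrow> ('v set \<times> nat) set \<Rightarrow> 'v temporal_graph" where
  "graph_on V F = \<lparr>verts = V, edges = fst ` F, appearances = (\<lambda>e. {t. (e, t) \<in> F})\<rparr>"

lemma graph_on_simps [simp]:
  "verts (graph_on V F) = V" "edges (graph_on V F) = fst ` F" "appearances (graph_on V F) e = {t. (e, t) \<in> F}"
  by (auto simp: graph_on_def)

lemma time_edges_graph_on [simp]: "time_edges (graph_on V F) = F"
  by (force simp: time_edges_def)

lemma modify_graph_on: "modify G \<Pi> = graph_on (verts G) ((time_edges G - \<Pi>) \<union> (\<Pi> - time_edges G))"
  by (simp add: modify_def graph_on_def Let_def)

text \<open>Modification is symmetric difference, an involution, so one may quantify over the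
  resulting time-edges instead of the modifications.\<close>

lemma ETC_iff:
  assumes te: "time_edges G \<subseteq> vertex_pairs (verts G) \<times> {1..}" and fin: "finite (time_edges G)"
  shows "ETC G k a b \<longleftrightarrow> (\<exists>F. finite F \<and> F \<subseteq> vertex_pairs (verts G) \<times> {1..} \<and>
    card ((time_edges G - F) \<union> (F - time_edges G)) \<le> k \<and> cluster_temporal_graph a b (graph_on (verts G) F))"
proof
  assume "ETC G k a b"
  then obtain \<Pi> where P: "\<Pi> \<subseteq> vertex_pairs (verts G) \<times> {1..}" "finite \<Pi>" "card \<Pi> \<le> k"
    "cluster_temporal_graph a b (modify G \<Pi>)" unfolding ETC_def by blast
  let ?F = "(time_edges G - \<Pi>) \<union> (\<Pi> - time_edges G)"
  have "(time_edges G - ?F) \<union> (?F - time_edges G) = \<Pi>" by blast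
  then show "\<exists>F. finite F \<and> F \<subseteq> vertex_pairs (verts G) \<times> {1..} \<and>
    card ((time_edges G - F) \<union> (F - time_edges G)) \<le> k \<and> cluster_temporal_graph a b (graph_on (verts G) F)"
    using P fin te modify_graph_on[of G \<Pi>] by (intro exI[of _ ?F]) auto
next
  assume "\<exists>F. finite F \<and> F \<subseteq> vertex_pairs (verts G) \<times> {1..} \<and>
    card ((time_edges G - F) \<union> (F - time_edges G)) \<le> k \<and> cluster_temporal_graph a b (graph_on (verts G) F)"
  then obtain F where F: "finite F" "F \<subseteq> vertex_pairs (verts G) \<times> {1..}"
    "card ((time_edges G - F) \<union> (F - time_edges G)) \<le> k" "cluster_temporal_graph a b (graph_on (verts G) F)"
    by blast
  let ?P = "(time_edges G - F) \<union> (F - time_edges G)"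
  have "(time_edges G - ?P) \<union> (?P - time_edges G) = F" by blast
  then show "ETC G k a b" unfolding ETC_def
    using F fin te modify_graph_on[of G ?P] by (intro exI[of _ ?P]) auto
qed

text \<open>Pigeonhole: \<open>n + 1\<close> disjoint stretches and at most \<open>n\<close>
  points.\<close>

lemma free_interval:
  assumes "finite S" "card S \<le> n" "1 \<le> d"
  shows "\<exists>j \<le> n. \<forall>t \<in> S. \<not> (T + j * d < t \<and> t \<le> T + Suc j * d)"
proof (rule ccontr)
  assume "\<not> ?thesis"
  then have "\<forall>j \<le> n. \<exists>t \<in> S. T + j * d < t \<and> t \<le> T + Suc j * d" by blast
  then obtain f where f: "\<And>j. j \<le> n \<Longrightarrow> f j \<in> S \<and> T + j * d < f j \<and> f j \<le> T + Suc j * d" by metis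
  have lt: "f i < f j" if "i < j" "j \<le> n" for i j
  proof -
    have "Suc i * d \<le> j * d" using that by (intro mult_right_mono) auto
    then show ?thesis using f[of i] f[of j] that by simp
  qed
  have "inj_on f {..n}"
  proof (rule inj_onI)
    fix i j assume "i \<in> {..n}" "j \<in> {..n}" "f i = f j"
    then show "i = j" using lt[of i j] lt[of j i] by (cases i j rule: linorder_cases) auto
  qed
  then have "card {..n} \<le> card S" using f assms(1) by (intro card_inj_on_le[of f]) auto
  then show False using assms(2) by simp
qed

text \<open>
  Among the stretches of length \<open>d1\<close> after the last original time, one contains no time of the
  solution; everything after it can be cut off. A density witness of a remaining template lies at
  most \<open>d1 - 1\<close> after the new lifetime, hence is not lost.
\<close>

lemma bounded_solution:
  assumes N: "finite N0" "\<And>e t. (e, t) \<in> N0 \<Longrightarrow> t \<le> T" and d1: "1 \<le> d1"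
    and F: "finite F" "F \<subseteq> vertex_pairs V \<times> {1..}" "card ((N0 - F) \<union> (F - N0)) \<le> k"
    and clu: "cluster_temporal_graph d1 d2 (graph_on V F)"
  shows "\<exists>F' \<C>. finite F' \<and> F' \<subseteq> vertex_pairs V \<times> {1..} \<and> card ((N0 - F') \<union> (F' - N0)) \<le> k \<and>
    card F' \<le> 2 * card N0 \<and> (\<forall>(e, t) \<in> F'. t \<le> T + card N0 * d1) \<and>
    realises (graph_on V F') d1 d2 \<C> \<and> finite \<C> \<and> card \<C> \<le> card F'"
proof (cases "card N0 \<le> k")
  \<comment> \<open>Deleting everything is affordable, and the empty collection is realised. In the
    other case \<open>k\<close> is below the number of original time-edges, which bounds the
    additions.\<close>
  case True
  have "realises (graph_on V {}) d1 d2 {}" by (simp add: realises_def)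
  then show ?thesis using True by (intro exI[of _ "{}"]) auto
next
  case False
  define n where "n = card N0"
  obtain \<C> where real: "realises (graph_on V F) d1 d2 \<C>" using clu unfolding cluster_temporal_graph_def by blast
  have finD: "finite ((N0 - F) \<union> (F - N0))" using N F by simp
  have FN: "card (F - N0) \<le> n" using card_mono[OF finD, of "F - N0"] F(3) False by (auto simp: n_def)
  have cardF: "card F \<le> 2 * n"
    using card_mono[of "N0 \<union> (F - N0)" F] card_Un_le[of N0 "F - N0"] N(1) F(1) FN by (fastforce simp: n_def)
  have "card (snd ` (F - N0)) \<le> n" using card_image_le[of "F - N0" snd] F(1) FN by simp
  then obtain j where j: "j \<le> n" "\<forall>t \<in> snd ` (F - N0). \<not> (T + j * d1 < t \<and> t \<le> T + Suc j * d1)"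
    using free_interval[of "snd ` (F - N0)" n d1 T] F(1) d1 by auto
  define B where "B = T + j * d1"
  have TB: "T \<le> B" by (simp add: B_def)
  have gap: "t \<le> B" if "(e, t) \<in> F" "t \<le> B + d1" for e t
  proof (cases "(e, t) \<in> N0")
    case True
    then show ?thesis using N(2) TB le_trans by blast
  next
    case False
    then have "t \<in> snd ` (F - N0)" using that(1) by force
    then have "\<not> (T + j * d1 < t \<and> t \<le> T + Suc j * d1)" using j(2) by blast
    then show ?thesis using that(2) by (auto simp: B_def)
  qed
  define F' where "F' = {p \<in> F. snd p \<le> B}"
  have F'F: "F' \<subseteq> F" "finite F'" using F(1) by (auto simp: F'_def)
  have "(N0 - F') \<union> (F' - N0) \<subseteq> (N0 - F) \<union> (F - N0)"
    using N(2) TB unfolding F'_def by fastforce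
  then have c1: "card ((N0 - F') \<union> (F' - N0)) \<le> k" using card_mono[OF finD] F(3) le_trans by blast
  have c2: "card F' \<le> 2 * n" using card_mono[OF F(1) F'F(1)] cardF by simp
  have c3: "\<forall>(e, t) \<in> F'. t \<le> T + n * d1"
  proof -
    have "B \<le> T + n * d1" using j(1) by (simp add: B_def)
    then show ?thesis unfolding F'_def by auto
  qed
  define L where "L = Max (snd ` F')"
  have L: "t \<le> L" if "(e, t) \<in> F'" for e t
    using that F'F(2) unfolding L_def by (intro Max_ge) force+
  have LB: "L \<le> B" if "F' \<noteq> {}"
  proof -
    have "L \<in> snd ` F'" unfolding L_def using F'F(2) that by (intro Max_in) auto
    then show ?thesis by (auto simp: F'_def)
  qed
  have cov: "\<exists>C \<in> \<C>. fst p \<subseteq> fst C \<and> fst (snd C) \<le> snd p \<and> snd p \<le> snd (snd C)" if "p \<in> F'" for p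
  proof -
    have "\<forall>(e, t) \<in> F. \<exists>(X, a, b) \<in> \<C>. e \<subseteq> X \<and> t \<in> {a..b}"
      using real unfolding realises_def time_edges_graph_on by (elim conjE)
    from bspec[OF this, of p] that F'F(1) have "\<exists>(X, a, b) \<in> \<C>. fst p \<subseteq> X \<and> snd p \<in> {a..b}"
      by (auto simp: case_prod_beta)
    then show ?thesis by (simp add: case_prod_beta)
  qed
  \<comment> \<open>One covering template per remaining time-edge is kept; the given collection may
    contain others that cover no time-edge. This bounds the number of templates.\<close>
  then obtain c where c: "\<And>p. p \<in> F' \<Longrightarrow> c p \<in> \<C> \<and> fst p \<subseteq> fst (c p) \<and> fst (snd (c p)) \<le> snd p \<and> snd p \<le> snd (snd (c p))"
    by metis
  define tr where "tr = (\<lambda>C :: 'a template. (fst C, fst (snd C), min (snd (snd C)) L))"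
  let ?C = "(\<lambda>p. tr (c p)) ` F'"
  have r1: "\<forall>(X, a, b) \<in> \<C>. X \<subseteq> V \<and> 1 \<le> a \<and> a \<le> b \<and> b \<le> lifetime (graph_on V F)"
    and r2: "\<forall>C \<in> \<C>. \<forall>D \<in> \<C>. C \<noteq> D \<longrightarrow> independent d2 C D"
    and r4: "\<forall>(X, a, b) \<in> \<C>. \<forall>x \<in> X. \<forall>y \<in> X. x \<noteq> y \<longrightarrow>
        {x, y} \<in> edges (graph_on V F) \<and> dense (graph_on V F) d1 {x, y} a b"
    by (rule real[unfolded realises_def graph_on_simps(1), THEN conjunct1],
      rule real[unfolded realises_def, THEN conjunct2, THEN conjunct1],
      rule real[unfolded realises_def, THEN conjunct2, THEN conjunct2, THEN conjunct2])
  have "realises (graph_on V F') d1 d2 ?C"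
    unfolding realises_def
  proof (intro conjI)
    show "\<forall>(X, a, b) \<in> ?C. X \<subseteq> verts (graph_on V F') \<and> 1 \<le> a \<and> a \<le> b \<and> b \<le> lifetime (graph_on V F')"
    proof
      fix C assume "C \<in> ?C"
      then obtain p where p: "p \<in> F'" "C = tr (c p)" by blast
      obtain X a b where X: "c p = (X, a, b)" by (metis prod_cases3)
      have "X \<subseteq> V" "1 \<le> a" "a \<le> b" using bspec[OF r1, of "c p"] c[OF p(1)] X by auto
      moreover have "a \<le> L" using c[OF p(1)] L[of "fst p" "snd p"] p(1) X by simp
      moreover have "min b L \<le> lifetime (graph_on V F')" by (simp add: lifetime_def L_def)
      ultimately show "case C of (X, a, b) \<Rightarrow> X \<subseteq> verts (graph_on V F') \<and> 1 \<le> a \<and> a \<le> b \<and> b \<le> lifetime (graph_on V F')"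
        by (simp add: p(2) tr_def X)
    qed
    show "\<forall>C \<in> ?C. \<forall>D \<in> ?C. C \<noteq> D \<longrightarrow> independent d2 C D"
    proof (intro ballI impI)
      fix C D assume CD: "C \<in> ?C" "D \<in> ?C" "C \<noteq> D"
      obtain p where p1: "p \<in> F'" "C = tr (c p)" using CD(1) by blast
      obtain q where q1: "q \<in> F'" "D = tr (c q)" using CD(2) by blast
      have "c p \<noteq> c q" using CD(3) p1 q1 by auto
      note p = p1(1) q1(1) p1(2) q1(2) this
      obtain X a b Y a' b' where X: "c p = (X, a, b)" "c q = (Y, a', b')" by (metis prod_cases3)
      have "independent d2 (c p) (c q)" using r2 c p by blast
      then show "independent d2 C D" unfolding X p(3,4) tr_def by auto
    qed
    show "\<forall>(e, t) \<in> time_edges (graph_on V F'). \<exists>(X, a, b) \<in> ?C. e \<subseteq> X \<and> t \<in> {a..b}"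
    proof (intro ballI, unfold time_edges_graph_on)
      fix p assume p: "p \<in> F'"
      obtain X a b where X: "c p = (X, a, b)" by (metis prod_cases3)
      have "tr (c p) \<in> ?C" using p by blast
      moreover have "fst p \<subseteq> X \<and> snd p \<in> {a..min b L}" using c[OF p] L[of "fst p" "snd p"] p X by auto
      ultimately show "case p of (e, t) \<Rightarrow> \<exists>(X, a, b) \<in> ?C. e \<subseteq> X \<and> t \<in> {a..b}"
        unfolding X tr_def case_prod_beta by (intro bexI[of _ "(X, a, min b L)"]) auto
    qed
    show "\<forall>(X, a, b) \<in> ?C. \<forall>x \<in> X. \<forall>y \<in> X. x \<noteq> y \<longrightarrow>
        {x, y} \<in> edges (graph_on V F') \<and> dense (graph_on V F') d1 {x, y} a b"
    proof
      fix C assume C: "C \<in> ?C"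
      obtain X a b where XC: "C = (X, a, b)" by (metis prod_cases3)
      obtain p where p': "(X, a, b) = tr (c p)" "p \<in> F'" using C unfolding XC by (rule imageE)
      note p = p'(2,1)
      from p(2) obtain b0 where X: "c p = (X, a, b0)" "b = min b0 L" by (cases "c p") (auto simp: tr_def)
      have aL: "a \<le> L" using c[OF p(1)] L[of "fst p" "snd p"] p(1) X by simp
      have LB': "L \<le> B" using LB p(1) by blast
      have "{x, y} \<in> edges (graph_on V F') \<and> dense (graph_on V F') d1 {x, y} a b"
        if xy: "x \<in> X" "y \<in> X" "x \<noteq> y" for x y
      proof -
        have "(X, a, b0) \<in> \<C>" using c[OF p(1)] X(1) by simp
        from bspec[OF r4 this, simplified] xy have d: "dense (graph_on V F) d1 {x, y} a b0" by blast
        have wit: "\<exists>t. ({x, y}, t) \<in> F' \<and> \<tau> \<le> int t \<and> int t \<le> \<tau> + int d1 - 1"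
          if \<tau>: "\<tau> \<in> {int a .. max (int a) (int b - int d1 + 1)}" for \<tau>
        proof -
          have "\<tau> \<in> {int a .. max (int a) (int b0 - int d1 + 1)}" using \<tau> X(2) by auto
          then obtain t where t: "({x, y}, t) \<in> F" "\<tau> \<le> int t" "int t \<le> \<tau> + int d1 - 1"
            using bspec[OF d[unfolded dense_def], of \<tau>] by auto
          have "\<tau> \<le> int L" using \<tau> X(2) aL d1 by auto
          then have "t \<le> B + d1" using t(3) LB' by linarith
          then have "t \<le> B" using gap t(1) by blast
          then show ?thesis using t by (auto simp: F'_def)
        qed
        have "\<exists>t. ({x, y}, t) \<in> F'" using wit[of "int a"] by auto
        then show ?thesis using wit unfolding dense_def by force
      qed
      then show "case C of (X, a, b) \<Rightarrow> \<forall>x \<in> X. \<forall>y \<in> X. x \<noteq> y \<longrightarrow>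
        {x, y} \<in> edges (graph_on V F') \<and> dense (graph_on V F') d1 {x, y} a b" unfolding XC by blast
    qed
  qed
  moreover have "card ?C \<le> card F'" using F'F(2) by (rule card_image_le)
  moreover have "F' \<subseteq> vertex_pairs V \<times> {1..}" using F'F F(2) by blast
  ultimately show ?thesis using c1 c2 c3 F'F(2)
    by (intro exI[of _ F'] exI[of _ ?C]) (simp add: n_def)
qed

subsection \<open>Verifying a solution\<close>

text \<open>An interval can be exponentially long, so its windows cannot be tried one by one. It
  suffices that the first window is hit and that the next appearance comes within \<open>d\<close>:
  for \<open>t\<close> not before \<open>a\<close>, the window beginning at \<open>t + 1\<close> is
  required exactly if \<open>t + d \<le> b\<close>.\<close>

lemma dense_iff:
  assumes d: "1 \<le> d"
  shows "dense G d e a b \<longleftrightarrow> (\<exists>t \<in> appearances G e. a \<le> t \<and> t < a + d) \<and>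
    (\<forall>t \<in> appearances G e. a \<le> t \<and> t + d \<le> b \<longrightarrow> (\<exists>t' \<in> appearances G e. t < t' \<and> t' \<le> t + d))"
    (is "_ \<longleftrightarrow> ?first \<and> ?next")
proof
  assume dn: "dense G d e a b"
  then have "\<exists>t \<in> appearances G e. int a \<le> int t \<and> int t \<le> int a + int d - 1"
    using bspec[OF dn[unfolded dense_def], of "int a"] by simp
  then have ?first by force
  moreover have ?next
  proof (intro ballI impI)
    fix t assume t: "t \<in> appearances G e" "a \<le> t \<and> t + d \<le> b"
    then have "int t + 1 \<in> {int a .. max (int a) (int b - int d + 1)}" by auto
    then obtain t' where t': "t' \<in> appearances G e" "int t + 1 \<le> int t'" "int t' \<le> int t + 1 + int d - 1"
      using dn unfolding dense_def by blast
    then have "t < t' \<and> t' \<le> t + d" by linarith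
    then show "\<exists>t' \<in> appearances G e. t < t' \<and> t' \<le> t + d" using t'(1) by blast
  qed
  ultimately show "?first \<and> ?next" ..
next
  assume fn: "?first \<and> ?next"
  have w: "int (a + i) \<le> max (int a) (int b - int d + 1) \<Longrightarrow>
      \<exists>t \<in> appearances G e. a + i \<le> t \<and> t < a + i + d" for i
  proof (induction i)
    case 0
    then show ?case using fn by simp
  next
    case (Suc i)
    have "int (a + i) \<le> max (int a) (int b - int d + 1)" using Suc.prems by simp
    from Suc.IH[OF this] obtain t where t: "t \<in> appearances G e" "a + i \<le> t" "t < a + i + d" by blast
    show ?case
    proof (cases "t = a + i")
      case True
      have "t + d \<le> b" using Suc.prems True d by auto
      then obtain t' where "t' \<in> appearances G e" "t < t'" "t' \<le> t + d" using fn t(1) True by auto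
      then show ?thesis using True by (intro bexI[of _ t']) auto
    next
      case False
      then show ?thesis using t by (intro bexI[of _ t]) auto
    qed
  qed
  show "dense G d e a b" unfolding dense_def
  proof
    fix \<tau> assume \<tau>: "\<tau> \<in> {int a .. max (int a) (int b - int d + 1)}"
    define i where "i = nat \<tau> - a"
    have i: "\<tau> = int (a + i)" using \<tau> by (auto simp: i_def)
    obtain t where "t \<in> appearances G e" "a + i \<le> t" "t < a + i + d" using w[of i] \<tau> i by auto
    then show "\<exists>t \<in> appearances G e. \<tau> \<le> int t \<and> int t \<le> \<tau> + int d - 1" using i by (intro bexI[of _ t]) auto
  qed
qed

text \<open>Overlapping intervals share a point and are at distance 0; disjoint ones are closest at
  their facing ends.\<close>

lemma independent_iff:
  assumes "1 \<le> d" "a \<le> b" "a' \<le> b'"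
  shows "independent d (X, a, b) (Y, a', b') \<longleftrightarrow> X \<inter> Y = {} \<or> b + d \<le> a' \<or> b' + d \<le> a"
proof -
  have "(\<forall>s \<in> {a..b}. \<forall>t \<in> {a'..b'}. \<bar>int s - int t\<bar> \<ge> int d) \<longleftrightarrow> b + d \<le> a' \<or> b' + d \<le> a" (is "?L \<longleftrightarrow> ?R")
  proof
    assume L: ?L
    consider "b < a'" | "b' < a" | "a' \<le> b" "a \<le> b'" by linarith
    then show ?R
    proof cases
      case 1
      then show ?thesis using L[rule_format, of b a'] assms by auto
    next
      case 2
      then show ?thesis using L[rule_format, of a b'] assms by auto
    next
      case 3
      then have "max a a' \<in> {a..b}" "max a a' \<in> {a'..b'}" using assms by auto
      then show ?thesis using L[rule_format, of "max a a'" "max a a'"] assms(1) by simp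
    qed
  next
    assume ?R
    then show ?L by auto
  qed
  then show ?thesis by simp
qed

section \<open>Solutions as lists and their executable checks\<close>

type_synonym pair_time = "(nat \<times> nat) \<times> nat"
type_synonym listed_template = "nat list \<times> nat \<times> nat"

text \<open>A normal form of undirected edges, so that edges can be compared by their codes.\<close>

definition sort_pair :: "nat \<times> nat \<Rightarrow> nat \<times> nat" where
  "sort_pair p = (if fst p \<le> snd p then p else (snd p, fst p))"

definition pair_set :: "nat \<times> nat \<Rightarrow> nat set" where
  "pair_set p = {fst p, snd p}"

lemma sort_pair_eq: "sort_pair p = sort_pair q \<longleftrightarrow> pair_set p = pair_set q"
  by (cases p; cases q) (auto simp: sort_pair_def pair_set_def doubleton_eq_iff)

lemma pair_set_sort_pair: "pair_set (sort_pair p) = pair_set p"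
  by (auto simp: sort_pair_def pair_set_def)

definition as_edge :: "pair_time \<Rightarrow> nat set \<times> nat" where
  "as_edge p = (pair_set (fst p), snd p)"

definition listed_times :: "edge_entry list \<Rightarrow> pair_time list" where
  "listed_times es = concat (map (\<lambda>e. map (\<lambda>t. (sort_pair (fst e), t)) (snd e)) es)"

definition valid_input :: "nat list \<Rightarrow> edge_entry list \<Rightarrow> bool" where
  "valid_input vs es \<longleftrightarrow> length (dedup vs) = length vs \<and>
     length (dedup (map (\<lambda>e. sort_pair (fst e)) es)) = length (map (\<lambda>e. sort_pair (fst e)) es) \<and>
     (\<forall>e \<in> set es. fst (fst e) \<in> set vs \<and> snd (fst e) \<in> set vs \<and> fst (fst e) \<noteq> snd (fst e) \<and>
        snd e \<noteq> [] \<and> 0 \<notin> set (snd e) \<and> length (dedup (snd e)) = length (snd e))"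

definition valid_path :: "nat list \<Rightarrow> nat list \<Rightarrow> edge_entry list \<Rightarrow> bool" where
  "valid_path ps vs es \<longleftrightarrow> ps \<noteq> [] \<and> length (dedup ps) = length ps \<and>
     (\<forall>v \<in> set vs. v \<in> set ps) \<and> (\<forall>v \<in> set ps. v \<in> set vs) \<and>
     (\<forall>e \<in> set es. sort_pair (fst e) \<in> set (map (\<lambda>p. sort_pair p) (zip ps (tl ps)))) \<and>
     (\<forall>p \<in> set (zip ps (tl ps)). sort_pair p \<in> set (map (\<lambda>e. sort_pair (fst e)) es))"

definition dense_in :: "pair_time list \<Rightarrow> nat \<Rightarrow> nat \<times> nat \<Rightarrow> nat \<Rightarrow> nat \<Rightarrow> bool" where
  "dense_in F d e a b \<longleftrightarrow> (\<exists>p \<in> set F. fst p = e \<and> a \<le> snd p \<and> snd p < a + d) \<and>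
     (\<forall>p \<in> set F. fst p = e \<and> a \<le> snd p \<and> snd p + d \<le> b \<longrightarrow>
        (\<exists>q \<in> set F. fst q = e \<and> snd p < snd q \<and> snd q \<le> snd p + d))"

text \<open>The bound by the lifetime is expressed by a time-edge at least as late. This avoids a
  maximum, and it rejects templates when there are no time-edges and the lifetime is a junk
  value.\<close>

definition valid_templates ::
    "nat list \<Rightarrow> pair_time list \<Rightarrow> listed_template list \<Rightarrow> nat \<Rightarrow> nat \<Rightarrow> bool" where
  "valid_templates vs F Cs d1 d2 \<longleftrightarrow>
     (\<forall>C \<in> set Cs. (\<forall>v \<in> set (fst C). v \<in> set vs) \<and> 1 \<le> fst (snd C) \<and> fst (snd C) \<le> snd (snd C) \<and>
        (\<exists>p \<in> set F. snd (snd C) \<le> snd p)) \<and>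
     (\<forall>C \<in> set Cs. \<forall>D \<in> set Cs. C = D \<or> (\<forall>v \<in> set (fst C). \<not> v \<in> set (fst D)) \<or>
        snd (snd C) + d2 \<le> fst (snd D) \<or> snd (snd D) + d2 \<le> fst (snd C)) \<and>
     (\<forall>p \<in> set F. \<exists>C \<in> set Cs. fst (fst p) \<in> set (fst C) \<and> snd (fst p) \<in> set (fst C) \<and>
        fst (snd C) \<le> snd p \<and> snd p \<le> snd (snd C)) \<and>
     (\<forall>C \<in> set Cs. \<forall>x \<in> set (fst C). \<forall>y \<in> set (fst C). x < y \<longrightarrow> dense_in F d1 (x, y) (fst (snd C)) (snd (snd C)))"

definition valid_times :: "nat list \<Rightarrow> edge_entry list \<Rightarrow> nat \<Rightarrow> pair_time list \<Rightarrow> bool" where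
  "valid_times vs es k F \<longleftrightarrow>
     (\<forall>p \<in> set F. fst (fst p) < snd (fst p) \<and> fst (fst p) \<in> set vs \<and> snd (fst p) \<in> set vs \<and> 1 \<le> snd p) \<and>
     length (filter (\<lambda>p. \<not> p \<in> set F) (listed_times es)) + length (filter (\<lambda>p. \<not> p \<in> set (listed_times es)) F) \<le> k"

definition listed_set :: "listed_template \<Rightarrow> nat template" where
  "listed_set C = (set (fst C), snd C)"

lemma distinct_dedup: "length (dedup xs) = length xs \<longleftrightarrow> distinct xs"
  by (metis card_distinct dedup distinct_card)

text \<open>Two lists may present the same template. The check takes them for different and demands
  independence, which is stronger than realisation. Hence injectivity is assumed, or else validity
  itself, so that one lemma serves completeness and soundness. A nonempty \<open>F\<close> gives the
  lifetime its meaning.\<close>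

lemma templates_iff:
  assumes F: "\<And>p. p \<in> set F \<Longrightarrow> fst (fst p) < snd (fst p)" and d: "1 \<le> d1" "1 \<le> d2"
    and inj: "inj_on listed_set (set Cs) \<or> valid_templates vs F Cs d1 d2" and ne: "Cs = [] \<or> F \<noteq> []"
  shows "valid_templates vs F Cs d1 d2 \<longleftrightarrow>
    realises (graph_on (set vs) (as_edge ` set F)) d1 d2 (listed_set ` set Cs)"
proof -
  let ?G = "graph_on (set vs) (as_edge ` set F)"
  have lt: "(pair_set e, t) \<in> as_edge ` set F \<longleftrightarrow> (e, t) \<in> set F" if "fst e < snd e" for e t
  proof
    assume "(pair_set e, t) \<in> as_edge ` set F"
    then obtain p where p: "p \<in> set F" "pair_set e = pair_set (fst p)" "t = snd p" by (auto simp: as_edge_def)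
    then have "fst p = e" using F[OF p(1)] that by (cases e; cases "fst p") (auto simp: pair_set_def doubleton_eq_iff)
    then show "(e, t) \<in> set F" using p by (metis prod.collapse)
  qed (force simp: as_edge_def)
  have life: "b \<le> lifetime ?G \<longleftrightarrow> (\<exists>p \<in> set F. b \<le> snd p)" if "F \<noteq> []" for b
  proof -
    have "snd ` as_edge ` set F = snd ` set F" by (force simp: as_edge_def image_image)
    then have "lifetime ?G = Max (snd ` set F)" by (simp add: lifetime_def)
    then show ?thesis using that by (simp add: Max_ge_iff)
  qed
  have den: "{x, y} \<in> edges ?G \<and> dense ?G d1 {x, y} a b \<longleftrightarrow> dense_in F d1 (x, y) a b" if "x < y" for x y a b
  proof -
    have "{x, y} = pair_set (x, y)" by (simp add: pair_set_def)
    then have ap: "appearances ?G {x, y} = {t. ((x, y), t) \<in> set F}" using lt[of "(x, y)"] that by simp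
    have "{x, y} \<in> edges ?G" if "t \<in> appearances ?G {x, y}" for t
    proof -
      have "({x, y}, t) \<in> as_edge ` set F" using that by simp
      from imageI[OF this, of fst] show ?thesis by simp
    qed
    then have "{x, y} \<in> edges ?G \<and> dense ?G d1 {x, y} a b \<longleftrightarrow> dense ?G d1 {x, y} a b"
      unfolding dense_iff[OF d(1)] by blast
    also have "\<dots> \<longleftrightarrow> dense_in F d1 (x, y) a b" unfolding dense_iff[OF d(1)] ap dense_in_def by force
    finally show ?thesis .
  qed
  have 4: "(\<forall>x \<in> X. \<forall>y \<in> X. x \<noteq> y \<longrightarrow> {x, y} \<in> edges ?G \<and> dense ?G d1 {x, y} a b) \<longleftrightarrow>
      (\<forall>x \<in> X. \<forall>y \<in> X. x < y \<longrightarrow> dense_in F d1 (x, y) a b)" for X a b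
  proof
    assume "\<forall>x \<in> X. \<forall>y \<in> X. x \<noteq> y \<longrightarrow> {x, y} \<in> edges ?G \<and> dense ?G d1 {x, y} a b"
    then show "\<forall>x \<in> X. \<forall>y \<in> X. x < y \<longrightarrow> dense_in F d1 (x, y) a b"
      using iffD1[OF den] less_imp_neq by (metis (no_types))
  next
    assume *: "\<forall>x \<in> X. \<forall>y \<in> X. x < y \<longrightarrow> dense_in F d1 (x, y) a b"
    show "\<forall>x \<in> X. \<forall>y \<in> X. x \<noteq> y \<longrightarrow> {x, y} \<in> edges ?G \<and> dense ?G d1 {x, y} a b"
    proof (intro ballI impI)
      fix x y assume "x \<in> X" "y \<in> X" "x \<noteq> y"
      then show "{x, y} \<in> edges ?G \<and> dense ?G d1 {x, y} a b"
        using * den[of x y] den[of y x] insert_commute[of x y "{}"]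
        by (metis linorder_neqE_nat)
    qed
  qed
  have 1: "(\<forall>C \<in> set Cs. (\<forall>v \<in> set (fst C). v \<in> set vs) \<and> 1 \<le> fst (snd C) \<and> fst (snd C) \<le> snd (snd C) \<and>
        (\<exists>p \<in> set F. snd (snd C) \<le> snd p)) \<longleftrightarrow>
      (\<forall>(X, a, b) \<in> listed_set ` set Cs. X \<subseteq> verts ?G \<and> 1 \<le> a \<and> a \<le> b \<and> b \<le> lifetime ?G)"
  proof (cases "Cs = []")
    case False
    then have "F \<noteq> []" using ne by blast
    from life[OF this] show ?thesis
      by (simp add: listed_set_def case_prod_beta subset_iff) (simp only: Ball_def)
  qed simp
  have 3: "(\<forall>p \<in> set F. \<exists>C \<in> set Cs. fst (fst p) \<in> set (fst C) \<and> snd (fst p) \<in> set (fst C) \<and>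
        fst (snd C) \<le> snd p \<and> snd p \<le> snd (snd C)) \<longleftrightarrow>
      (\<forall>(e, t) \<in> time_edges ?G. \<exists>(X, a, b) \<in> listed_set ` set Cs. e \<subseteq> X \<and> t \<in> {a..b})"
    by (simp add: listed_set_def case_prod_beta as_edge_def pair_set_def)
  have 2: "(\<forall>C \<in> set Cs. \<forall>D \<in> set Cs. C = D \<or> (\<forall>v \<in> set (fst C). \<not> v \<in> set (fst D)) \<or>
        snd (snd C) + d2 \<le> fst (snd D) \<or> snd (snd D) + d2 \<le> fst (snd C)) \<longleftrightarrow>
      (\<forall>C \<in> listed_set ` set Cs. \<forall>D \<in> listed_set ` set Cs. C \<noteq> D \<longrightarrow> independent d2 C D)" (is "?A \<longleftrightarrow> ?B")
    if le: "\<forall>C \<in> set Cs. fst (snd C) \<le> snd (snd C)"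
  proof -
    have ind: "independent d2 (listed_set C) (listed_set D) \<longleftrightarrow> (\<forall>v \<in> set (fst C). \<not> v \<in> set (fst D)) \<or>
        snd (snd C) + d2 \<le> fst (snd D) \<or> snd (snd D) + d2 \<le> fst (snd C)" if "C \<in> set Cs" "D \<in> set Cs" for C D
      using independent_iff[OF d(2), of "fst (snd C)" "snd (snd C)" "fst (snd D)" "snd (snd D)" "set (fst C)" "set (fst D)"]
        le that unfolding listed_set_def prod.collapse by blast
    show ?thesis
    proof
      assume A: ?A
      show ?B
      proof (intro ballI impI)
        fix C' D' assume CD: "C' \<in> listed_set ` set Cs" "D' \<in> listed_set ` set Cs" "C' \<noteq> D'"
        then obtain C D where "C \<in> set Cs" "D \<in> set Cs" "C' = listed_set C" "D' = listed_set D" "C \<noteq> D" by blast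
        then show "independent d2 C' D'" using A ind by blast
      qed
    next
      assume B: ?B
      show ?A
      proof (cases "valid_templates vs F Cs d1 d2")
        case True
        then show ?thesis unfolding valid_templates_def by (elim conjE)
      next
        case False
        then have inj': "inj_on listed_set (set Cs)" using inj by blast
        show ?thesis
        proof (intro ballI)
          fix C D assume CD: "C \<in> set Cs" "D \<in> set Cs"
          show "C = D \<or> (\<forall>v \<in> set (fst C). \<not> v \<in> set (fst D)) \<or>
            snd (snd C) + d2 \<le> fst (snd D) \<or> snd (snd D) + d2 \<le> fst (snd C)"
          proof (cases "C = D")
            case False
            then have "listed_set C \<noteq> listed_set D" using inj' CD by (meson inj_onD)
            then show ?thesis using B ind[OF CD] CD by blast
          qed simp
        qed
      qed
    qed
  qed
  have 5: "(\<forall>C \<in> set Cs. \<forall>x \<in> set (fst C). \<forall>y \<in> set (fst C). x < y \<longrightarrow> dense_in F d1 (x, y) (fst (snd C)) (snd (snd C))) \<longleftrightarrow>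
      (\<forall>(X, a, b) \<in> listed_set ` set Cs. \<forall>x \<in> X. \<forall>y \<in> X. x \<noteq> y \<longrightarrow> {x, y} \<in> edges ?G \<and> dense ?G d1 {x, y} a b)"
    unfolding ball_simps(9) listed_set_def case_prod_beta fst_conv snd_conv 4 ..
  show ?thesis unfolding valid_templates_def realises_def 1 3 5
  proof (intro conj_cong refl)
    assume "\<forall>(X, a, b) \<in> listed_set ` set Cs. X \<subseteq> verts ?G \<and> 1 \<le> a \<and> a \<le> b \<and> b \<le> lifetime ?G"
    then have "\<forall>C \<in> set Cs. fst (snd C) \<le> snd (snd C)" by (auto simp: listed_set_def)
    from 2[OF this] show "(\<forall>C \<in> set Cs. \<forall>D \<in> set Cs. C = D \<or> (\<forall>v \<in> set (fst C). \<not> v \<in> set (fst D)) \<or>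
        snd (snd C) + d2 \<le> fst (snd D) \<or> snd (snd D) + d2 \<le> fst (snd C)) =
      (\<forall>C \<in> listed_set ` set Cs. \<forall>D \<in> listed_set ` set Cs. C \<noteq> D \<longrightarrow> independent d2 C D)" .
  qed
qed

lemma fp_sort_pair: "fp f \<Longrightarrow> fp (\<lambda>x. sort_pair (f x))"
  unfolding sort_pair_def by (intro fp_if fp_le fp_pair fp_fst fp_snd)

lemma fp_listed_times: "fp es \<Longrightarrow> fp (\<lambda>x. listed_times (es x))"
  unfolding listed_times_def
  by (intro fp_concat fp_map fp_pair fp_sort_pair fp_fst fp_snd fp_id)

lemma fp_valid_input: "fp vs \<Longrightarrow> fp es \<Longrightarrow> fp (\<lambda>x. valid_input (vs x) (es x))"
proof -
  assume *: "fp vs" "fp es"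
  note d = fp_comp[OF *(1)] fp_comp[OF *(2)]
  show ?thesis unfolding valid_input_def
    by (intro fp_conj fp_eq fp_length fp_dedup fp_map fp_sort_pair fp_ball fp_not fp_member fp_const * d
        fp_fst fp_snd fp_id)
qed

lemma fp_valid_path: "fp ps \<Longrightarrow> fp vs \<Longrightarrow> fp es \<Longrightarrow> fp (\<lambda>x. valid_path (ps x) (vs x) (es x))"
proof -
  assume *: "fp ps" "fp vs" "fp es"
  note d = fp_comp[OF *(1)] fp_comp[OF *(2)] fp_comp[OF *(3)]
  show ?thesis unfolding valid_path_def
    by (intro fp_conj fp_eq fp_length fp_dedup fp_map fp_sort_pair fp_ball fp_not fp_member fp_zip fp_tl fp_const * d
        fp_fst fp_snd fp_id)
qed

lemma fp_dense_in:
  "fp F \<Longrightarrow> fp dd \<Longrightarrow> fp e \<Longrightarrow> fp a \<Longrightarrow> fp b \<Longrightarrow> fp (\<lambda>x. dense_in (F x) (dd x) (e x) (a x) (b x))"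
proof -
  assume *: "fp F" "fp dd" "fp e" "fp a" "fp b"
  note d = fp_comp[OF *(1)] fp_comp[OF *(2)] fp_comp[OF *(3)] fp_comp[OF *(4)] fp_comp[OF *(5)]
  show ?thesis unfolding dense_in_def
    by (intro fp_conj fp_imp fp_bex fp_ball fp_eq fp_le fp_less fp_add * d fp_fst fp_snd fp_id)
qed

lemma fp_valid_templates:
  "fp vs \<Longrightarrow> fp F \<Longrightarrow> fp Cs \<Longrightarrow> fp a \<Longrightarrow> fp b \<Longrightarrow> fp (\<lambda>x. valid_templates (vs x) (F x) (Cs x) (a x) (b x))"
proof -
  assume *: "fp vs" "fp F" "fp Cs" "fp a" "fp b"
  note d = fp_comp[OF *(1)] fp_comp[OF *(2)] fp_comp[OF *(3)] fp_comp[OF *(4)] fp_comp[OF *(5)]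
  show ?thesis unfolding valid_templates_def
    by (intro fp_conj fp_disj fp_imp fp_not fp_member fp_bex fp_ball fp_eq fp_le fp_less fp_add fp_dense_in
        fp_pair fp_const * d fp_fst fp_snd fp_id)
qed

lemma fp_valid_times:
  "fp vs \<Longrightarrow> fp es \<Longrightarrow> fp k \<Longrightarrow> fp F \<Longrightarrow> fp (\<lambda>x. valid_times (vs x) (es x) (k x) (F x))"
proof -
  assume *: "fp vs" "fp es" "fp k" "fp F"
  note d = fp_comp[OF *(1)] fp_comp[OF *(2)] fp_comp[OF *(3)] fp_comp[OF *(4)]
  show ?thesis unfolding valid_times_def
    by (intro fp_conj fp_not fp_member fp_ball fp_le fp_less fp_add fp_length fp_filter fp_listed_times
        fp_const * d fp_fst fp_snd fp_id)
qed

text \<open>The instance is part of the certificate: the verifier encodes it again and compares the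
  result with \<open>x\<close>, so inputs are never parsed. The flag \<open>q\<close> switches the
  path restriction on.\<close>

definition accepts ::
    "bool \<Rightarrow> bool list \<Rightarrow> nat list \<Rightarrow> edge_entry list \<Rightarrow> nat \<Rightarrow> nat \<Rightarrow> nat \<Rightarrow> pair_time list \<Rightarrow>
     listed_template list \<Rightarrow> nat list \<Rightarrow> bool" where
  "accepts q x vs es k d1 d2 F Cs ps \<longleftrightarrow> x = encode_input vs es k d1 d2 \<and> 1 \<le> k \<and> 1 \<le> d1 \<and> 1 \<le> d2 \<and>
     valid_input vs es \<and> (q \<longrightarrow> valid_path ps vs es) \<and> valid_times vs es k F \<and> valid_templates vs F Cs d1 d2"

lemma map_pair_set: "map (\<lambda>((u, v), ts). {u, v}) es = map (\<lambda>e. pair_set (fst e)) es"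
  by (auto simp: pair_set_def)

definition graph_of :: "nat list \<Rightarrow> edge_entry list \<Rightarrow> nat temporal_graph" where
  "graph_of vs es = \<lparr>verts = set vs, edges = (\<lambda>e. pair_set (fst e)) ` set es,
     appearances = (\<lambda>f. \<Union> ((\<lambda>e. set (snd e)) ` {e \<in> set es. pair_set (fst e) = f}))\<rparr>"

lemma distinct_sort_pair:
  "distinct (map (\<lambda>e. sort_pair (fst e)) es) \<longleftrightarrow> distinct (map (\<lambda>e. pair_set (fst e)) es)"
  by (simp add: distinct_map inj_on_def sort_pair_eq)

lemma valid_input_presents:
  assumes "valid_input vs es"
  shows "presents vs es (graph_of vs es) \<and> temporal_graph (graph_of vs es)"
proof -
  have v: "distinct vs" "distinct (map (\<lambda>e. pair_set (fst e)) es)"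
    and e: "\<And>e. e \<in> set es \<Longrightarrow> fst (fst e) \<in> set vs \<and> snd (fst e) \<in> set vs \<and> fst (fst e) \<noteq> snd (fst e) \<and>
      snd e \<noteq> [] \<and> 0 \<notin> set (snd e) \<and> distinct (snd e)"
    using assms unfolding valid_input_def distinct_dedup distinct_sort_pair by blast+
  have ap: "appearances (graph_of vs es) (pair_set (fst e)) = set (snd e)" if "e \<in> set es" for e
  proof -
    have "inj_on (\<lambda>e. pair_set (fst e)) (set es)" using v(2) by (simp add: distinct_map)
    then have "{e' \<in> set es. pair_set (fst e') = pair_set (fst e)} = {e}" using that by (auto dest: inj_onD)
    then show ?thesis by (simp add: graph_of_def)
  qed
  have "presents vs es (graph_of vs es)"
    unfolding presents_def map_pair_set
  proof (intro conjI)
    show "\<forall>((u, v), ts) \<in> set es. distinct ts \<and> set ts = appearances (graph_of vs es) {u, v}"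
      using e ap by (fastforce simp: pair_set_def)
  qed (use v in \<open>auto simp: graph_of_def\<close>)
  moreover have "temporal_graph (graph_of vs es)"
    unfolding temporal_graph_def
  proof (intro conjI ballI)
    show "edges (graph_of vs es) \<subseteq> vertex_pairs (verts (graph_of vs es))"
      using e by (auto simp: graph_of_def vertex_pairs_def pair_set_def)
    fix f assume "f \<in> edges (graph_of vs es)"
    then obtain x where x: "x \<in> set es" "f = pair_set (fst x)" by (auto simp: graph_of_def)
    show "finite (appearances (graph_of vs es) f)" "appearances (graph_of vs es) f \<noteq> {}"
      "0 \<notin> appearances (graph_of vs es) f" using e[OF x(1)] unfolding x(2) ap[OF x(1)] by auto
  qed (simp add: graph_of_def)
  ultimately show ?thesis ..
qed

lemma presents_valid_input:
  assumes pr: "presents vs es G" and tg: "temporal_graph G"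
  shows "valid_input vs es"
proof -
  have d: "distinct vs" "distinct (map (\<lambda>e. pair_set (fst e)) es)" and vs: "set vs = verts G"
    and ed: "(\<lambda>e. pair_set (fst e)) ` set es = edges G"
    and ap: "\<forall>((u, v), ts) \<in> set es. distinct ts \<and> set ts = appearances G {u, v}"
    using pr unfolding presents_def map_pair_set by auto
  have "fst (fst e) \<in> set vs \<and> snd (fst e) \<in> set vs \<and> fst (fst e) \<noteq> snd (fst e) \<and>
      snd e \<noteq> [] \<and> 0 \<notin> set (snd e) \<and> distinct (snd e)" if e: "e \<in> set es" for e
  proof -
    have f: "pair_set (fst e) \<in> edges G" using ed e by blast
    then have "pair_set (fst e) \<in> vertex_pairs (verts G)" using tg unfolding temporal_graph_def by blast
    then have 1: "fst (fst e) \<in> verts G \<and> snd (fst e) \<in> verts G \<and> fst (fst e) \<noteq> snd (fst e)"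
      by (auto simp: vertex_pairs_def pair_set_def)
    have 2: "distinct (snd e) \<and> set (snd e) = appearances G (pair_set (fst e))"
      using bspec[OF ap e] by (simp add: case_prod_beta pair_set_def)
    have "appearances G (pair_set (fst e)) \<noteq> {} \<and> 0 \<notin> appearances G (pair_set (fst e))"
      using tg f unfolding temporal_graph_def by blast
    then show ?thesis using 1 2 vs by force
  qed
  then show ?thesis unfolding valid_input_def distinct_dedup distinct_sort_pair using d by blast
qed

lemma presents_listed_times:
  assumes "presents vs es G"
  shows "time_edges G = as_edge ` set (listed_times es)"
proof -
  have "as_edge ` set (listed_times es) = (\<Union>x \<in> set es. (\<lambda>t. (pair_set (fst x), t)) ` set (snd x))"
    by (simp add: listed_times_def as_edge_def image_UN image_image pair_set_sort_pair)
  also have "\<dots> = {(e, t). \<exists>x \<in> set es. e = pair_set (fst x) \<and> t \<in> set (snd x)}" by blast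
  also have "\<dots> = {(e, t). \<exists>u v ts. ((u, v), ts) \<in> set es \<and> e = {u, v} \<and> t \<in> set ts}"
    by (simp add: Bex_def split_paired_Ex pair_set_def)
  finally show ?thesis using presents_time_edges[OF assms] by simp
qed

lemma set_zip_tl: "set (zip ps (tl ps)) = {(ps ! i, ps ! Suc i) | i. Suc i < length ps}"
  by (auto simp: set_zip nth_tl)

lemma valid_path_iff:
  assumes pr: "presents vs es G"
  shows "underlying_path G \<longleftrightarrow> (\<exists>ps. valid_path ps vs es)"
proof -
  have vs: "set vs = verts G" and ed: "(\<lambda>e. pair_set (fst e)) ` set es = edges G"
    using pr unfolding presents_def map_pair_set by auto
  have z: "{{ps ! i, ps ! Suc i} | i. Suc i < length ps} = pair_set ` set (zip ps (tl ps))" for ps :: "nat list"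
    unfolding set_zip_tl by (simp add: setcompr_eq_image image_image pair_set_def)
  have e: "(\<forall>e \<in> set es. sort_pair (fst e) \<in> set (map (\<lambda>p. sort_pair p) Z)) \<and>
      (\<forall>p \<in> set Z. sort_pair p \<in> set (map (\<lambda>e. sort_pair (fst e)) es)) \<longleftrightarrow> edges G = pair_set ` set Z" for Z
  proof -
    have "edges G = pair_set ` set Z \<longleftrightarrow> (\<forall>e \<in> set es. \<exists>p \<in> set Z. pair_set (fst e) = pair_set p) \<and>
        (\<forall>p \<in> set Z. \<exists>e \<in> set es. pair_set p = pair_set (fst e))"
      unfolding ed[symmetric] by (simp only: set_eq_subset image_subset_iff image_iff)
    then show ?thesis by (simp add: image_iff sort_pair_eq)
  qed
  have "valid_path ps vs es \<longleftrightarrow> ps \<noteq> [] \<and> distinct ps \<and> verts G = set ps \<and>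
      edges G = {{ps ! i, ps ! Suc i} | i. Suc i < length ps}" for ps
    unfolding valid_path_def distinct_dedup z e vs[symmetric] by blast
  then show ?thesis unfolding underlying_path_def by simp
qed

section \<open>Soundness and completeness of the verifier\<close>

lemma accepts_sound:
  assumes "accepts q x vs es k d1 d2 F Cs ps"
  shows "x \<in> ETC_language (\<lambda>G. q \<longrightarrow> underlying_path G)"
proof -
  let ?G = "graph_of vs es"
  have x: "x = encode_input vs es k d1 d2" "1 \<le> k" "1 \<le> d1" "1 \<le> d2" and vi: "valid_input vs es"
    and vp: "q \<longrightarrow> valid_path ps vs es" and vt: "valid_times vs es k F" and vc: "valid_templates vs F Cs d1 d2"
    using assms unfolding accepts_def by blast+
  have pr: "presents vs es ?G" and tg: "temporal_graph ?G" using valid_input_presents[OF vi] by auto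
  have V: "verts ?G = set vs" by (simp add: graph_of_def)
  have te: "time_edges ?G = as_edge ` set (listed_times es)" by (rule presents_listed_times[OF pr])
  have tesub: "time_edges ?G \<subseteq> vertex_pairs (verts ?G) \<times> {1..}"
  proof
    fix p assume "p \<in> time_edges ?G"
    then obtain e t where p: "p = (e, t)" "e \<in> edges ?G" "t \<in> appearances ?G e" by (auto simp: time_edges_def)
    then have "t \<noteq> 0" "e \<in> vertex_pairs (verts ?G)" using tg unfolding temporal_graph_def by (metis, blast)
    then show "p \<in> vertex_pairs (verts ?G) \<times> {1..}" using p by auto
  qed
  let ?F = "as_edge ` set F"
  have F: "\<And>p. p \<in> set F \<Longrightarrow> fst (fst p) < snd (fst p) \<and> fst (fst p) \<in> set vs \<and> snd (fst p) \<in> set vs \<and> 1 \<le> snd p"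
    using vt unfolding valid_times_def by blast
  have Fsub: "?F \<subseteq> vertex_pairs (verts ?G) \<times> {1..}"
    using F unfolding V by (force simp: as_edge_def pair_set_def vertex_pairs_def)
  have "card ((time_edges ?G - ?F) \<union> (?F - time_edges ?G)) \<le> k"
  proof -
    let ?A = "filter (\<lambda>p. \<not> p \<in> set F) (listed_times es)" and ?B = "filter (\<lambda>p. \<not> p \<in> set (listed_times es)) F"
    have "card ((time_edges ?G - ?F) \<union> (?F - time_edges ?G)) \<le> card (as_edge ` set (?A @ ?B))"
      unfolding te by (intro card_mono) auto
    also have "\<dots> \<le> card (set (?A @ ?B))" by (rule card_image_le) simp
    also have "\<dots> \<le> length (?A @ ?B)" by (rule card_length)
    also have "\<dots> \<le> k" using vt unfolding valid_times_def by simp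
    finally show ?thesis .
  qed
  moreover have "cluster_temporal_graph d1 d2 (graph_on (verts ?G) ?F)"
  proof -
    have "Cs = [] \<or> F \<noteq> []" using vc unfolding valid_templates_def by (cases Cs) auto
    then have "realises (graph_on (set vs) ?F) d1 d2 (listed_set ` set Cs)"
      using templates_iff[of F d1 d2 Cs vs] F x(3,4) vc by blast
    then show ?thesis unfolding cluster_temporal_graph_def V by blast
  qed
  ultimately have "ETC ?G k d1 d2"
    unfolding ETC_iff[OF tesub, unfolded te, OF finite_imageI[OF finite_set]] te[symmetric]
    using Fsub by (intro exI[of _ ?F]) auto
  moreover have "q \<longrightarrow> underlying_path ?G" using vp valid_path_iff[OF pr] by blast
  ultimately show ?thesis unfolding ETC_language_def using x pr tg by blast
qed

text \<open>Everything is packed into one type, so that a single decoder serves all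
  components.\<close>

definition certificate ::
    "nat list \<Rightarrow> edge_entry list \<Rightarrow> nat \<Rightarrow> nat \<Rightarrow> nat \<Rightarrow> pair_time list \<Rightarrow> listed_template list \<Rightarrow>
     nat list \<Rightarrow> nat list list list" where
  "certificate vs es k d1 d2 F Cs ps =
     [[vs], map (\<lambda>e. fst (fst e) # snd (fst e) # snd e) es, [[k, d1, d2]],
      map (\<lambda>p. [fst (fst p), snd (fst p), snd p]) F,
      map (\<lambda>C. fst (snd C) # snd (snd C) # fst C) Cs, [ps]]"

text \<open>For an input of length n, numbers of the instance have size at most 4n and times of a
  small solution at most 40n + 20; at most 8n time-edges and templates remain, and a list of
  distinct vertices has size at most 4n (4n + 1) + 1.\<close>

definition certificate_bound :: "nat \<Rightarrow> nat" where
  "certificate_bound n = 20 + 4 * n + 4 * n + 12 * n + (8 * n * ((60 * n + 30) + 1) + 1) +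
     (8 * n * (2 * (40 * n + 20) + 2 + (4 * n * (4 * n + 1) + 1) + 1) + 1) + (4 * n * (4 * n + 1) + 1)"

text \<open>The slack 3 makes the estimate pass through \<open>encode_list\<close>: it is exact for
  the empty list, and the marker bit of each element pays for its additional node.\<close>

lemma sz_nat_encode: "sz m + 3 \<le> 4 * length (encode_nat m)"
proof -
  have "length (encode_list (\<lambda>b. [b]) bs) = 2 * length bs + 1" for bs :: "bool list"
    by (induction bs) (auto simp: encode_list_simps)
  then have "length (encode_nat m) = 2 * length (bits m) + 1" by (simp add: encode_nat_def)
  moreover have "sz m \<le> 4 * length (bits m) + 1" using sz_bools_le[of "bits m"] by (simp add: sz_nat)
  ultimately show ?thesis by simp
qed

lemma sz_encode_list:
  "(\<And>x. x \<in> set xs \<Longrightarrow> sz (f x) + 3 \<le> 4 * length (e x)) \<Longrightarrow> sz (map f xs) + 3 \<le> 4 * length (encode_list e xs)"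
proof (induction xs)
  case (Cons x xs)
  have "sz (f x) + 3 \<le> 4 * length (e x)" "sz (map f xs) + 3 \<le> 4 * length (encode_list e xs)"
    using Cons by auto
  then show ?case by (simp add: encode_list_simps)
qed (simp add: encode_list_simps)

lemma sz_list_bound: "(\<And>a. a \<in> set xs \<Longrightarrow> sz a \<le> m) \<Longrightarrow> sz xs \<le> length xs * (m + 1) + 1"
proof (induction xs)
  case (Cons a xs)
  have "sz a \<le> m" "sz xs \<le> length xs * (m + 1) + 1" using Cons by auto
  then show ?case by simp
qed simp

lemma sz_list_bound': "(\<And>a. a \<in> set xs \<Longrightarrow> sz a \<le> m) \<Longrightarrow> length xs \<le> l \<Longrightarrow> sz xs \<le> l * (m + 1) + 1"
  using sz_list_bound[of xs m] mult_le_mono1[of "length xs" l "m + 1"] by simp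

lemma input_sizes:
  assumes "x = encode_input vs es k d1 d2"
  shows "sz vs \<le> 4 * length x" "sz (map (\<lambda>e. fst (fst e) # snd (fst e) # snd e) es) \<le> 4 * length x"
    "sz k \<le> 4 * length x" "sz d1 \<le> 4 * length x" "sz d2 \<le> 4 * length x"
proof -
  have l: "length x = length (encode_list encode_nat vs) + length (encode_list encode_edge_entry es) +
      length (encode_nat k) + length (encode_nat d1) + length (encode_nat d2)"
    unfolding assms encode_input_def by simp
  have 1: "sz (map (\<lambda>m. m) ts) + 3 \<le> 4 * length (encode_list encode_nat ts)" for ts
    by (rule sz_encode_list) (rule sz_nat_encode)
  have 2: "sz (map (\<lambda>e. fst (fst e) # snd (fst e) # snd e) es) + 3 \<le> 4 * length (encode_list encode_edge_entry es)"
  proof (rule sz_encode_list)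
    fix e :: edge_entry
    show "sz (fst (fst e) # snd (fst e) # snd e) + 3 \<le> 4 * length (encode_edge_entry e)"
      using sz_nat_encode[of "fst (fst e)"] sz_nat_encode[of "snd (fst e)"] 1[of "snd e"]
      by (simp add: encode_edge_entry_def case_prod_beta)
  qed
  show "sz vs \<le> 4 * length x" "sz (map (\<lambda>e. fst (fst e) # snd (fst e) # snd e) es) \<le> 4 * length x"
    "sz k \<le> 4 * length x" "sz d1 \<le> 4 * length x" "sz d2 \<le> 4 * length x"
    using l 1[of vs] 2 sz_nat_encode[of k] sz_nat_encode[of d1] sz_nat_encode[of d2] by simp_all
qed

lemma listed_times_length: "length (listed_times es) \<le> sz (map (\<lambda>e. fst (fst e) # snd (fst e) # snd e) es)"
proof (induction es)
  case (Cons e es)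
  then show ?case using length_le_sz[of "snd e"] by (simp add: listed_times_def)
qed (simp add: listed_times_def)

lemma accepts_complete:
  assumes "x \<in> ETC_language (\<lambda>G. q \<longrightarrow> underlying_path G)"
  shows "\<exists>vs es k d1 d2 F Cs ps. accepts q x vs es k d1 d2 F Cs ps \<and>
    sz (certificate vs es k d1 d2 F Cs ps) \<le> certificate_bound (length x)"
proof -
  obtain vs es k d1 d2 G where x: "x = encode_input vs es k d1 d2" and tg: "temporal_graph G"
    and pr: "presents vs es G" and up: "q \<longrightarrow> underlying_path G" and k: "1 \<le> k" "1 \<le> d1" "1 \<le> d2"
    and etc: "ETC G k d1 d2" using assms unfolding ETC_language_def by blast
  define n where "n = length x"
  note sizes = input_sizes[OF x, folded n_def]
  have vi: "valid_input vs es" by (rule presents_valid_input[OF pr tg])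
  have V: "verts G = set vs" using pr unfolding presents_def by simp
  define L where "L = listed_times es"
  have te: "time_edges G = as_edge ` set L" unfolding L_def by (rule presents_listed_times[OF pr])
  have te_sub: "time_edges G \<subseteq> vertex_pairs (verts G) \<times> {1..}"
  proof
    fix p assume "p \<in> time_edges G"
    then obtain e t where p: "p = (e, t)" "e \<in> edges G" "t \<in> appearances G e" by (auto simp: time_edges_def)
    then have "t \<noteq> 0" "e \<in> vertex_pairs (verts G)" using tg unfolding temporal_graph_def by (metis, blast)
    then show "p \<in> vertex_pairs (verts G) \<times> {1..}" using p by auto
  qed
  have fin: "finite (time_edges G)" unfolding te by simp
  obtain F0 where F0: "finite F0" "F0 \<subseteq> vertex_pairs (verts G) \<times> {1..}"
    "card ((time_edges G - F0) \<union> (F0 - time_edges G)) \<le> k" "cluster_temporal_graph d1 d2 (graph_on (verts G) F0)"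
    using etc unfolding ETC_iff[OF te_sub fin] by blast
  have tb: "t \<le> 2 ^ (4 * n)" if et: "(e, t) \<in> time_edges G" for e t
  proof -
    obtain p where p: "p \<in> set L" "(e, t) = as_edge p" using et unfolding te by blast
    then have "snd p = t" by (simp add: as_edge_def)
    note p = p(1) this
    then obtain a where a: "a \<in> set es" "t \<in> set (snd a)" unfolding L_def listed_times_def by auto
    have "sz t \<le> sz (snd a)" using a(2) by (rule sz_member)
    also have "\<dots> \<le> sz (fst (fst a) # snd (fst a) # snd a)" by simp
    also have "\<dots> \<le> sz (map (\<lambda>e. fst (fst e) # snd (fst e) # snd e) es)" using a(1) by (intro sz_member) auto
    finally have "sz t \<le> 4 * n" using sizes(2) by simp
    then have "(2 :: nat) ^ sz t \<le> 2 ^ (4 * n)" by (intro power_increasing) auto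
    from less_imp_le[OF less_le_trans[OF less_sz this]] show ?thesis .
  qed
  have "\<exists>F1 \<C>. finite F1 \<and> F1 \<subseteq> vertex_pairs (verts G) \<times> {1..} \<and>
      card ((time_edges G - F1) \<union> (F1 - time_edges G)) \<le> k \<and> card F1 \<le> 2 * card (time_edges G) \<and>
      (\<forall>(e, t) \<in> F1. t \<le> 2 ^ (4 * n) + card (time_edges G) * d1) \<and>
      realises (graph_on (verts G) F1) d1 d2 \<C> \<and> finite \<C> \<and> card \<C> \<le> card F1"
    by (rule bounded_solution[OF fin _ k(2) F0]) (rule tb)
  then obtain F1 \<C> where F1: "finite F1" "F1 \<subseteq> vertex_pairs (verts G) \<times> {1..}"
    "card ((time_edges G - F1) \<union> (F1 - time_edges G)) \<le> k" "card F1 \<le> 2 * card (time_edges G)"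
    "\<forall>(e, t) \<in> F1. t \<le> 2 ^ (4 * n) + card (time_edges G) * d1"
    and re: "realises (graph_on (verts G) F1) d1 d2 \<C>" and fC: "finite \<C>" "card \<C> \<le> card F1"
    by (elim exE conjE) (rule that)
  have cN: "card (time_edges G) \<le> 4 * n"
  proof -
    have "card (time_edges G) \<le> length L" unfolding te using card_image_le[of "set L" as_edge] card_length[of L] by simp
    then show ?thesis using listed_times_length[of es] sizes(2) unfolding L_def by linarith
  qed
  \<comment> \<open>Original times are at most \<open>2 ^ (4 * n)\<close>, and the stretches behind
    them add at most \<open>4 * n\<close> times a \<open>d1\<close> below the same power, so all
    stays below \<open>2 ^ (8 * n + 2)\<close>.\<close>
  have t1: "sz t \<le> 40 * n + 20" if "t \<le> 2 ^ (4 * n) + card (time_edges G) * d1" for t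
  proof -
    have "d1 < 2 ^ sz d1" by (rule less_sz)
    also have "\<dots> \<le> 2 ^ (4 * n)" using sizes(4) by (intro power_increasing) auto
    finally have "card (time_edges G) * d1 \<le> 4 * n * 2 ^ (4 * n)" using cN by (intro mult_mono) auto
    also have "\<dots> \<le> 2 ^ (4 * n) * 2 ^ (4 * n)" using less_exp[of "4 * n"] by (intro mult_right_mono) auto
    finally have "t \<le> 2 ^ (4 * n) + 2 ^ (8 * n)" using that by (simp add: power_add[symmetric])
    moreover have "(2 :: nat) ^ (4 * n) \<le> 2 ^ (8 * n)" by (intro power_increasing) auto
    moreover have "(2 :: nat) ^ (8 * n) > 0" by simp
    ultimately have "t < 2 ^ (8 * n) * 4" by linarith
    then have "t < 2 ^ (8 * n + 2)" by (simp add: power_add)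
    then have "sz t \<le> 4 * (8 * n + 2) + 1" by (rule sz_nat_le)
    then show ?thesis by simp
  qed
  have sv: "sz v \<le> 4 * n" if "v \<in> set vs" for v using sz_member[OF that] sizes(1) by simp
  have lvs: "length vs \<le> 4 * n" using length_le_sz[of vs] sizes(1) by simp
  define un where "un = (\<lambda>p :: nat set \<times> nat. ((Min (fst p), Max (fst p)), snd p))"
  have un: "as_edge (un p) = p \<and> Min (fst p) < Max (fst p) \<and> Min (fst p) \<in> set vs \<and> Max (fst p) \<in> set vs \<and> 1 \<le> snd p"
    if pv: "p \<in> vertex_pairs (verts G) \<times> {1..}" for p
  proof -
    obtain a b where ab: "fst p = {a, b}" "a \<noteq> b" "a \<in> set vs" "b \<in> set vs" "1 \<le> snd p"
      using pv unfolding vertex_pairs_def V by (auto simp: card_2_iff)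
    then show ?thesis by (cases p) (auto simp: un_def as_edge_def pair_set_def min_def max_def)
  qed
  obtain lF where lF: "set lF = F1" "distinct lF" using finite_distinct_list[OF F1(1)] by blast
  define F where "F = map un lF"
  have FF1: "as_edge ` set F = F1"
  proof -
    have "as_edge ` set F = (\<lambda>p. p) ` F1" unfolding F_def set_map lF image_image
      using un F1(2) by (intro image_cong) blast+
    then show ?thesis by simp
  qed
  have dF: "distinct F"
    unfolding F_def distinct_map using lF un F1(2) by (intro conjI inj_on_inverseI[of _ as_edge]) auto
  have lenF: "length F = card F1" unfolding F_def using lF distinct_card by fastforce
  have Fp: "fst (fst p) < snd (fst p) \<and> fst (fst p) \<in> set vs \<and> snd (fst p) \<in> set vs \<and> 1 \<le> snd p" if "p \<in> set F" for p
  proof -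
    obtain r where "r \<in> F1" "p = un r" using \<open>p \<in> set F\<close> unfolding F_def lF(1)[symmetric] by auto
    then show ?thesis using un[of r] F1(2) by (auto simp: un_def)
  qed
  have Lp: "fst (fst p) < snd (fst p)" if pL: "p \<in> set L" for p
  proof -
    obtain e where e: "e \<in> set es" "fst p = sort_pair (fst e)" using pL unfolding L_def listed_times_def by auto
    then have "fst (fst e) \<noteq> snd (fst e)" using vi unfolding valid_input_def by blast
    then show ?thesis unfolding e(2) sort_pair_def by auto
  qed
  have ase: "p = r" if "fst (fst p) < snd (fst p)" "fst (fst r) < snd (fst r)" "as_edge p = as_edge r" for p r :: pair_time
  proof -
    obtain a b s c d t where "p = ((a, b), s)" "r = ((c, d), t)" by (metis prod.collapse)
    then show ?thesis using that by (auto simp: as_edge_def pair_set_def doubleton_eq_iff)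
  qed
  have dL: "distinct L"
  proof -
    have "distinct (map (\<lambda>e. sort_pair (fst e)) es)" and "\<And>e. e \<in> set es \<Longrightarrow> distinct (snd e)"
      using vi unfolding valid_input_def distinct_dedup by blast+
    then show ?thesis unfolding L_def listed_times_def
    proof (induction es)
      case (Cons e es)
      have "sort_pair (fst e) \<notin> (\<lambda>e. sort_pair (fst e)) ` set es" using Cons.prems(1) by simp
      then have "set (map (\<lambda>t. (sort_pair (fst e), t)) (snd e)) \<inter>
          set (concat (map (\<lambda>e. map (\<lambda>t. (sort_pair (fst e), t)) (snd e)) es)) = {}"
      proof -
        assume ne: "sort_pair (fst e) \<notin> (\<lambda>e. sort_pair (fst e)) ` set es"
        have A: "fst p = sort_pair (fst e)" if "p \<in> set (map (\<lambda>t. (sort_pair (fst e), t)) (snd e))" for p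
          using that by auto
        have B: "fst p \<in> (\<lambda>e. sort_pair (fst e)) ` set es"
          if p: "p \<in> set (concat (map (\<lambda>e. map (\<lambda>t. (sort_pair (fst e), t)) (snd e)) es))" for p
        proof -
          obtain x where "x \<in> set es" "p \<in> set (map (\<lambda>t. (sort_pair (fst x), t)) (snd x))" using p by auto
          then show ?thesis by (intro rev_image_eqI[of x]) auto
        qed
        show ?thesis
        proof (rule equals0I)
          fix p assume p: "p \<in> set (map (\<lambda>t. (sort_pair (fst e), t)) (snd e)) \<inter>
            set (concat (map (\<lambda>e. map (\<lambda>t. (sort_pair (fst e), t)) (snd e)) es))"
          show False using A[OF IntD1[OF p]] B[OF IntD2[OF p]] ne by simp
        qed
      qed
      moreover have "distinct (concat (map (\<lambda>e. map (\<lambda>t. (sort_pair (fst e), t)) (snd e)) es))"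
        using Cons by simp
      moreover have "distinct (map (\<lambda>t. (sort_pair (fst e), t)) (snd e))"
        using Cons.prems(2)[of e] by (simp add: distinct_map inj_on_def)
      ultimately show ?case by simp
    qed simp
  qed
  have vt: "valid_times vs es k F"
  proof -
    let ?A = "filter (\<lambda>p. \<not> p \<in> set F) L" and ?B = "filter (\<lambda>p. \<not> p \<in> set L) F"
    have inj: "inj_on as_edge (set L \<union> set F)" using Lp Fp ase by (intro inj_onI) blast
    have "distinct (?A @ ?B)" using dL dF by auto
    then have "length (?A @ ?B) = card (set (?A @ ?B))" by (rule distinct_card[symmetric])
    also have "\<dots> = card (as_edge ` set (?A @ ?B))"
    proof (rule card_image[symmetric])
      show "inj_on as_edge (set (?A @ ?B))" by (rule inj_on_subset[OF inj]) auto
    qed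
    also have "as_edge ` set (?A @ ?B) = (time_edges G - F1) \<union> (F1 - time_edges G)"
    proof -
      have "set (?A @ ?B) = (set L - set F) \<union> (set F - set L)" by auto
      moreover have "as_edge ` (set L - set F) = time_edges G - F1" "as_edge ` (set F - set L) = F1 - time_edges G"
        unfolding te FF1[symmetric] by (intro inj_on_image_set_diff[OF inj]; blast)+
      ultimately show ?thesis by (simp only: image_Un)
    qed
    finally have "length (?A @ ?B) \<le> k" using F1(3) by simp
    then show ?thesis unfolding valid_times_def L_def[symmetric] using Fp by simp
  qed
  obtain lC where lC: "set lC = \<C>" "distinct lC" using finite_distinct_list[OF fC(1)] by blast
  \<comment> \<open>Sorted lists make the presentation of templates injective, as
    \<open>templates_iff\<close> asks.\<close>
  define Cs where "Cs = map (\<lambda>C. (sorted_list_of_set (fst C), snd C)) lC"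
  have r1: "\<forall>(X, a, b) \<in> \<C>. X \<subseteq> verts (graph_on (verts G) F1) \<and> 1 \<le> a \<and> a \<le> b \<and> b \<le> lifetime (graph_on (verts G) F1)"
    using re[unfolded realises_def] by (rule conjunct1)
  have CX: "fst C \<subseteq> set vs \<and> fst (snd C) \<le> snd (snd C) \<and> snd (snd C) \<le> lifetime (graph_on (verts G) F1)"
    if "C \<in> \<C>" for C using bspec[OF r1 that] by (simp add: case_prod_beta V)
  have lsC: "listed_set (sorted_list_of_set (fst C), snd C) = C" if "C \<in> \<C>" for C
    using CX[OF that] finite_subset[of "fst C" "set vs"] by (simp add: listed_set_def)
  have ls: "listed_set ` set Cs = \<C>"
  proof -
    have "listed_set ` set Cs = (\<lambda>C. C) ` \<C>" unfolding Cs_def set_map lC image_image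
      using lsC by (intro image_cong) auto
    then show ?thesis by simp
  qed
  have injC: "inj_on listed_set (set Cs)"
    unfolding Cs_def set_map lC using lsC by (auto simp: inj_on_def)
  have lenC: "length Cs = card \<C>" unfolding Cs_def using lC distinct_card by fastforce
  have neC: "Cs = [] \<or> F \<noteq> []" using lenC lenF fC(2) by (cases "card F1 = 0") auto
  have vc: "valid_templates vs F Cs d1 d2"
    using templates_iff[of F d1 d2 Cs vs] Fp k injC neC re unfolding FF1 ls V by blast
  obtain ps where ps: "q \<longrightarrow> valid_path ps vs es" and psz: "sz ps \<le> 4 * n * (4 * n + 1) + 1"
  proof (cases q)
    case True
    then obtain ps where p: "valid_path ps vs es" using up valid_path_iff[OF pr] by blast
    then have d: "distinct ps" "set ps = set vs" unfolding valid_path_def distinct_dedup by blast+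
    have "distinct vs" using pr unfolding presents_def by blast
    then have "length ps = length vs" using d distinct_card by metis
    then have "sz ps \<le> 4 * n * (4 * n + 1) + 1" using lvs sv d(2) by (intro sz_list_bound') auto
    then show ?thesis using that p by blast
  next
    case False
    then show ?thesis using that[of "[]"] by simp
  qed
  have acc: "accepts q x vs es k d1 d2 F Cs ps"
    unfolding accepts_def using x k vi ps vt vc by blast
  define M1 where "M1 = 60 * n + 30"
  define M2 where "M2 = 4 * n * (4 * n + 1) + 1"
  have lF8: "length F \<le> 8 * n" using lenF F1(4) cN by simp
  have lC8: "length Cs \<le> 8 * n" using lenC fC(2) F1(4) cN by simp
  have sF: "sz (map (\<lambda>p. [fst (fst p), snd (fst p), snd p]) F) \<le> 8 * n * (M1 + 1) + 1"
  proof (rule sz_list_bound')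
    fix a assume "a \<in> set (map (\<lambda>p. [fst (fst p), snd (fst p), snd p]) F)"
    then obtain p where p: "p \<in> set F" "a = [fst (fst p), snd (fst p), snd p]" by auto
    have "(pair_set (fst p), snd p) \<in> F1" using p(1) FF1 by (force simp: as_edge_def)
    then have "sz (snd p) \<le> 40 * n + 20" using F1(5) t1 by blast
    then show "sz a \<le> M1" using Fp[OF p(1)] sv[of "fst (fst p)"] sv[of "snd (fst p)"] by (simp add: p(2) M1_def)
  qed (use lF8 in simp)
  have sC: "sz (map (\<lambda>C. fst (snd C) # snd (snd C) # fst C) Cs) \<le> 8 * n * (2 * (40 * n + 20) + 2 + M2 + 1) + 1"
  proof (rule sz_list_bound')
    fix a assume "a \<in> set (map (\<lambda>C. fst (snd C) # snd (snd C) # fst C) Cs)"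
    then obtain C where C: "C \<in> \<C>" "a = fst (snd C) # snd (snd C) # sorted_list_of_set (fst C)"
      unfolding Cs_def using lC by auto
    have X: "fst C \<subseteq> set vs" using CX[OF C(1)] by blast
    have fX: "finite (fst C)" using X finite_subset by blast
    have "card (fst C) \<le> length vs" using card_mono[OF _ X] card_length[of vs] by simp
    then have "sz (sorted_list_of_set (fst C)) \<le> M2"
      unfolding M2_def using lvs X sv fX by (intro sz_list_bound') auto
    moreover have "lifetime (graph_on (verts G) F1) \<le> 2 ^ (4 * n) + card (time_edges G) * d1"
    proof -
      have "F1 \<noteq> {}" using C(1) fC by auto
      then have "lifetime (graph_on (verts G) F1) \<in> snd ` F1"
        unfolding lifetime_def time_edges_graph_on using F1(1) by (intro Max_in) auto
      then show ?thesis using F1(5) by auto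
    qed
    then have "sz (fst (snd C)) \<le> 40 * n + 20" "sz (snd (snd C)) \<le> 40 * n + 20"
      using CX[OF C(1)] by (auto intro!: t1)
    ultimately show "sz a \<le> 2 * (40 * n + 20) + 2 + M2" by (simp add: C(2))
  qed (use lC8 in simp)
  have "sz (certificate vs es k d1 d2 F Cs ps) \<le> 20 + 4 * n + 4 * n + 12 * n + (8 * n * (M1 + 1) + 1) +
      (8 * n * (2 * (40 * n + 20) + 2 + M2 + 1) + 1) + M2"
    using sizes sF sC psz unfolding certificate_def M2_def by simp
  also have "\<dots> = certificate_bound n" unfolding certificate_bound_def M1_def M2_def ..
  finally show ?thesis using acc unfolding n_def by blast
qed

subsection \<open>Parsing certificates\<close>

type_synonym unpair_state = "bool \<times> bool \<times> bool list \<times> bool list"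

text \<open>The state: whether the separator has passed, whether the next bit is a payload bit of
  the first component, and the two components read so far, reversed.\<close>

definition unpair_step :: "unpair_state \<Rightarrow> bool \<Rightarrow> unpair_state" where
  "unpair_step s b =
     (if fst s then (True, False, fst (snd (snd s)), b # snd (snd (snd s)))
      else if fst (snd s) then (False, False, b # fst (snd (snd s)), snd (snd (snd s)))
      else if b then (False, True, fst (snd (snd s)), snd (snd (snd s)))
      else (True, False, fst (snd (snd s)), snd (snd (snd s))))"

definition unpair :: "bool list \<Rightarrow> bool list \<times> bool list" where
  "unpair z = (let s = foldl unpair_step (False, False, [], []) z in (rev (fst (snd (snd s))), rev (snd (snd (snd s)))))"

lemma unpair: "unpair (encode_pair x y) = (x, y)"
proof -
  have 1: "foldl unpair_step (True, False, rx, ry) y = (True, False, rx, rev y @ ry)" for rx ry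
    by (induction y arbitrary: ry) (auto simp: unpair_step_def)
  have "foldl unpair_step (False, False, rx, []) (encode_list (\<lambda>b. [b]) x @ y) = (True, False, rev x @ rx, rev y)" for rx
    using 1 by (induction x arbitrary: rx) (auto simp: encode_list_simps unpair_step_def)
  then show ?thesis by (simp add: unpair_def encode_pair_def)
qed

lemma fp_unpair: "fp f \<Longrightarrow> fp (\<lambda>x. unpair (f x))"
proof -
  have "fp (\<lambda>z :: bool list. foldl (\<lambda>acc a. unpair_step acc a) (False, False, [], []) z)"
  proof (rule fp_foldl_grow[where r = "\<lambda>n. 20" and g = "\<lambda>x a acc. unpair_step acc a"])
    show "fp (\<lambda>q :: bool list \<times> bool \<times> unpair_state. unpair_step (snd (snd q)) (fst (snd q)))"
      unfolding unpair_step_def by (intro fp_if fp_pair fp_Cons fp_const fp_fst fp_snd fp_id)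
    fix a and acc :: unpair_state
    obtain p q r s where acc: "acc = (p, q, r, s)" by (cases acc) auto
    show "sz (unpair_step acc a) \<le> sz acc + 20"
      using sz_bool_le[of a] unfolding acc unpair_step_def by auto
  qed (intro fp_pair fp_const fp_id pb_intros)+
  then have "fp (\<lambda>z. unpair z)" unfolding unpair_def Let_def by (intro fp_pair fp_rev fp_fst fp_snd)
  then show "fp f \<Longrightarrow> fp (\<lambda>x. unpair (f x))" by (rule fp_comp)
qed

fun kids :: "tree \<Rightarrow> tree list" where
  "kids Leaf = []"
| "kids (Node a b) = a # kids b"

text \<open>Every tree is the code of the list of left subtrees along its right spine, so reading it
  as a list is free.\<close>

lemma enc_kids: "enc (kids t) = enc t"
  by (induction t) (auto simp: enc_tree_def)

lemma fp_kids: "fp f \<Longrightarrow> fp (\<lambda>x. kids (f x))"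
  by (rule fp_recode[of f]) (auto simp: enc_kids)

lemma kids_enc: "kids (enc xs) = map enc xs"
  by (induction xs) auto

lemma fp_Node: "fp f \<Longrightarrow> fp g \<Longrightarrow> fp (\<lambda>x. Node (f x) (g x))"
  by (rule fp_recode[OF fp_pair[of f g]]) (auto simp: enc_prod_def enc_tree_def)

text \<open>The preorder code is read from right to left: \<open>False\<close> pushes a leaf,
  \<open>True\<close> joins the two topmost trees. The guard matters on strings that are no codes,
  where \<open>hd []\<close> would have an unknown size.\<close>

definition shift_reduce :: "tree list \<Rightarrow> bool \<Rightarrow> tree list" where
  "shift_reduce s b =
     (if \<not> b then Leaf # s else if tl s = [] then s else Node (hd s) (hd (tl s)) # tl (tl s))"

definition parse :: "bool list \<Rightarrow> tree" where
  "parse y = hd (foldl shift_reduce [] (rev y))"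

lemma parse_code: "parse (code t) = t"
proof -
  have "foldl shift_reduce s (rev (code t)) = t # s" for s
    by (induction t arbitrary: s) (auto simp: shift_reduce_def)
  then show ?thesis by (simp add: parse_def)
qed

lemma fp_parse: "fp f \<Longrightarrow> fp (\<lambda>x. parse (f x))"
proof -
  have "fp (\<lambda>z :: bool list. foldl (\<lambda>acc a. shift_reduce acc a) [] (rev z))"
  proof (rule fp_foldl_grow[where r = "\<lambda>n. 20" and g = "\<lambda>x a acc. shift_reduce acc a"])
    show "fp (\<lambda>q :: bool list \<times> bool \<times> tree list. shift_reduce (snd (snd q)) (fst (snd q)))"
      unfolding shift_reduce_def
      by (intro fp_if fp_not fp_eq fp_Cons fp_Node fp_hd fp_tl fp_const fp_fst fp_snd fp_id)
    fix a and acc :: "tree list"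
    have [simp]: "sz Leaf = 1" "sz (Node a b) = Suc (sz a + sz b)" for a b by (simp_all add: sz_def enc_tree_def)
    show "sz (shift_reduce acc a) \<le> sz acc + 20"
      by (cases acc; cases "tl acc") (auto simp: shift_reduce_def)
  qed (intro fp_rev fp_const fp_id pb_intros)+
  then have "fp (\<lambda>z. parse z)" unfolding parse_def by (intro fp_hd)
  then show "fp f \<Longrightarrow> fp (\<lambda>x. parse (f x))" by (rule fp_comp)
qed

definition tree_nat :: "tree \<Rightarrow> nat" where
  "tree_nat t = val (map (\<lambda>a. a \<noteq> Leaf) (kids t))"

lemma tree_nat: "tree_nat (enc n) = n"
proof -
  have "map (\<lambda>a. a \<noteq> Leaf) (map enc bs) = bs" for bs :: "bool list"
    by (induction bs) (auto simp: enc_bool_def)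
  then show ?thesis by (simp add: tree_nat_def enc_nat_def kids_enc del: map_map)
qed

definition tree_numbers :: "tree \<Rightarrow> nat list list list" where
  "tree_numbers t = map (\<lambda>a. map (\<lambda>b. map (\<lambda>c. tree_nat c) (kids b)) (kids a)) (kids t)"

lemma tree_numbers: "tree_numbers (enc w) = w"
  by (simp add: tree_numbers_def kids_enc tree_nat comp_def)

lemma fp_tree_numbers: "fp f \<Longrightarrow> fp (\<lambda>x. tree_numbers (f x))"
  unfolding tree_numbers_def tree_nat_def
  by (intro fp_map fp_val fp_not fp_eq fp_kids fp_const fp_fst fp_snd fp_id)

text \<open>A malformed certificate yields arbitrary components; this does no harm, as
  \<open>accepts_sound\<close> covers all of them.\<close>

definition check :: "bool \<Rightarrow> bool list \<Rightarrow> nat list list list \<Rightarrow> bool" where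
  "check q x w = accepts q x (hd (hd w))
     (map (\<lambda>e. ((hd e, hd (tl e)), tl (tl e))) (hd (tl w)))
     (hd (hd (hd (tl (tl w))))) (hd (tl (hd (hd (tl (tl w)))))) (hd (tl (tl (hd (hd (tl (tl w)))))))
     (map (\<lambda>e. ((hd e, hd (tl e)), hd (tl (tl e)))) (hd (tl (tl (tl w)))))
     (map (\<lambda>e. (tl (tl e), hd e, hd (tl e))) (hd (tl (tl (tl (tl w))))))
     (hd (hd (tl (tl (tl (tl (tl w)))))))"

lemma check_certificate:
  "check q x (certificate vs es k d1 d2 F Cs ps) = accepts q x vs es k d1 d2 F Cs ps"
  by (simp add: check_def certificate_def comp_def)

lemma fp_accepts:
  "fp x \<Longrightarrow> fp vs \<Longrightarrow> fp es \<Longrightarrow> fp k \<Longrightarrow> fp a \<Longrightarrow> fp b \<Longrightarrow> fp F \<Longrightarrow> fp Cs \<Longrightarrow> fp ps \<Longrightarrow>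
   fp (\<lambda>z. accepts q (x z) (vs z) (es z) (k z) (a z) (b z) (F z) (Cs z) (ps z))"
  unfolding accepts_def
  by (intro fp_conj fp_imp fp_eq fp_encode_input fp_le fp_const fp_valid_input fp_valid_path fp_valid_times
      fp_valid_templates)

lemma fp_check: "fp x \<Longrightarrow> fp w \<Longrightarrow> fp (\<lambda>z. check q (x z) (w z))"
proof -
  assume *: "fp x" "fp w"
  note d = fp_comp[OF *(1)] fp_comp[OF *(2)]
  show ?thesis unfolding check_def
    by (intro fp_accepts fp_map fp_pair fp_hd fp_tl * d fp_fst fp_snd fp_id)
qed

theorem in_NP_ETC: "in_NP (ETC_language (\<lambda>G. q \<longrightarrow> underlying_path G))"
proof -
  define R where "R = {z. check q (fst (unpair z)) (tree_numbers (parse (snd (unpair z))))}"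
  have "fp (\<lambda>z. [check q (fst (unpair z)) (tree_numbers (parse (snd (unpair z))))])"
    by (intro fp_Cons fp_check fp_tree_numbers fp_parse fp_unpair fp_fst fp_snd fp_id fp_const)
  then have "in_P R" unfolding in_P_def R_def by (simp add: poly_time_fp)
  moreover have "pb certificate_bound" unfolding certificate_bound_def by (intro pb_intros)
  then obtain p where p: "\<And>n. certificate_bound n \<le> poly p n" using pb_bound_poly by blast
  moreover have "x \<in> ETC_language (\<lambda>G. q \<longrightarrow> underlying_path G) \<longleftrightarrow>
      (\<exists>y. length y \<le> poly p (length x) \<and> encode_pair x y \<in> R)" for x
  proof
    assume "x \<in> ETC_language (\<lambda>G. q \<longrightarrow> underlying_path G)"
    then obtain vs es k d1 d2 F Cs ps where a: "accepts q x vs es k d1 d2 F Cs ps"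
      and s: "sz (certificate vs es k d1 d2 F Cs ps) \<le> certificate_bound (length x)"
      using accepts_complete by blast
    let ?y = "code (enc (certificate vs es k d1 d2 F Cs ps))"
    have "length ?y \<le> poly p (length x)" using s p[of "length x"] unfolding sz_def by linarith
    moreover have "encode_pair x ?y \<in> R"
      unfolding R_def by (simp add: unpair parse_code tree_numbers check_certificate a)
    ultimately show "\<exists>y. length y \<le> poly p (length x) \<and> encode_pair x y \<in> R" by blast
  next
    assume "\<exists>y. length y \<le> poly p (length x) \<and> encode_pair x y \<in> R"
    then obtain y where "check q x (tree_numbers (parse y))" unfolding R_def by (auto simp: unpair)
    then show "x \<in> ETC_language (\<lambda>G. q \<longrightarrow> underlying_path G)"
      unfolding check_def by (rule accepts_sound)
  qed
  ultimately show ?thesis unfolding in_NP_def by blast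
qed

theorem theorem1:
  shows "NP_complete (ETC_language (\<lambda>G. True)) \<and> NP_complete (ETC_language underlying_path)"
proof -
  have "in_NP (ETC_language (\<lambda>G. True))" "in_NP (ETC_language underlying_path)"
    using in_NP_ETC[of False] in_NP_ETC[of True] by simp_all
  moreover have "poly_reducible A (ETC_language (\<lambda>G. True))" "poly_reducible A (ETC_language underlying_path)"
    if "in_NP A" for A
    by (rule NP_hard[OF that]; simp add: underlying_path_path_graph)+
  ultimately show ?thesis unfolding NP_complete_def by blast
qed

end
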